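(* Let $K$ be an imaginary quadratic field, $f_\rho$ a positive integer, $\underline{\mathfrak c}=f_\rho\sqrt{D_K}\mathcal O_K$. Let $\chi$ be a character of $(\mathcal O_K/\underline{\mathfrak c})^\times$ with $\chi(u)=u$ for $u\in\mathcal O_K^\times$, and let $\varphi$ be a Hecke character of $K$ of infinity type $[-1/2;1,0]$ with conductor $\mathfrak c_f\mid\underline{\mathfrak c}$ whose finite character $\chi'_\varphi$, pulled back to $(\mathcal O_K/\underline{\mathfrak c})^\times$, equals $\chi^{-1}$. If $r$ is a positive integer for which there exists an integral ideal $\mathfrak q_r$ of $\mathcal O_K$ with $\mathrm{Nm}_{K/\mathbb Q}(\mathfrak q_r)=r$ and $\mathfrak q_r\mid\underline{\mathfrak c}\,\mathfrak c_f^{-1}$, then the oldform $\vartheta(\tau;\varphi)|[\mathrm{diag}(r,1)]_2=r\,\vartheta(r\tau;\varphi)$ lies in $F^{\chi^{-1}}(f_\rho)$.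
   Context: Embed $K\subset\mathbb C$ with $\sqrt{D_K}$ in the upper half plane $\mathcal H$; $D_K<0$ the discriminant, $h$ the class number. Hecke character of infinity type $[-1/2;1,0]$ with conductor $\mathfrak c_f$: a homomorphism $\varphi$ from fractional ideals prime to $\mathfrak c_f$ to $\mathbb C^\times$ with $\varphi(\alpha\mathcal O_K)=\alpha\chi'_\varphi(\alpha)$ for $\alpha\in\mathcal O_K$ prime to $\mathfrak c_f$, $\chi'_\varphi$ a character of $(\mathcal O_K/\mathfrak c_f)^\times$, $\mathfrak c_f$ minimal. $\vartheta(\tau;\varphi)=\sum_I\varphi(I)e^{2\pi i\tau\mathrm{Nm}(I)}$ over nonzero integral ideals ($\varphi(I)=0$ if $I$ not prime to $\mathfrak c_f$). For $f$ holomorphic on $\mathcal H$, $(f|[\mathrm{diag}(r,1)]_2)(\tau)=r f(r\tau)$. Let $z_1,\dots,z_h\in\mathcal H$ represent the $\mathbb C$-isomorphism classes of elliptic curves with CM by $\mathcal O_K$, $\mathfrak b_{z_a}=\mathbb Z+z_a\mathbb Z$; for $z=z_a$ let $(a_z,b_z,c_z)$ coprime, $a_z>0$, $a_zz^2+b_zz+c_z=0$. $\Lambda_a$: lattice with basis $e_2,e_1$ and Gram matrix $f_\rho\begin{pmatrix}2a_z&b_z\\ b_z&2c_z\end{pmatrix}$; $G_{\Lambda_a}=\Lambda_a^\vee/\Lambda_a$; $\Omega'_a$ the $\mathbb Q$-linear map with $\Omega'_a(e_2)=\sqrt{2a_zf_\rho}$, $\Omega'_a(e_1)=-\sqrt{2a_zf_\rho}z$;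 $\Omega_a=i\sqrt{|G_{\Lambda_a}|}(2a_zf_\rho)^{-1/2}\Omega'_a$ gives $G_{\Lambda_a}\cong\mathfrak b_{z_a}/\underline{\mathfrak c}\mathfrak b_{z_a}$, on which $(\mathcal O_K/\underline{\mathfrak c})^\times$ acts by multiplication ($g\cdot\beta$). $f_a(\tau;\beta)=\sum_{y\in\Lambda_a^\vee,\,y+\Lambda_a=\beta}\Omega'_a(y)e^{\pi if_\rho|D_K|\tau(y,y)}$. $F_a^{\chi^{-1}}$ is the span over $\beta_0\in G_{\Lambda_a}$ of $\sum_{g}\chi(g)f_a(\tau;g^{-1}\cdot\beta_0)$ (sum over $g\in(\mathcal O_K/\underline{\mathfrak c})^\times$), and $F^{\chi^{-1}}(f_\rho)=\sum_{a=1}^hF^{\chi^{-1}}_a$. *)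

theory Defs
  imports "HOL-Analysis.Analysis" "HOL-Computational_Algebra.Squarefree"
begin

definition fund_disc :: "int \<Rightarrow> bool" where
  "fund_disc D \<longleftrightarrow> D \<noteq> 1 \<and>
     ((D mod 4 = 1 \<and> squarefree D) \<or>
      (\<exists>m. D = 4 * m \<and> (m mod 4 = 2 \<or> m mod 4 = 3) \<and> squarefree m))"

definition sqrtD :: "int \<Rightarrow> complex" where
  "sqrtD D = \<i> * complex_of_real (sqrt (- of_int D))"

definition omegaK :: "int \<Rightarrow> complex" where
  "omegaK D = (of_int D + sqrtD D) / 2"

definition OK :: "int \<Rightarrow> complex set" where
  "OK D = {of_int a + of_int b * omegaK D | a b. True}"

definition OK_units :: "int \<Rightarrow> complex set" where
  "OK_units D = {u \<in> OK D. u \<noteq> 0 \<and> 1 / u \<in> OK D}"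

definition setmul :: "complex set \<Rightarrow> complex set \<Rightarrow> complex set" where
  "setmul A B = \<Inter>{S. (\<forall>x\<in>A. \<forall>y\<in>B. x * y \<in> S) \<and> 0 \<in> S \<and>
                      (\<forall>u\<in>S. \<forall>v\<in>S. u + v \<in> S \<and> - u \<in> S)}"

definition int_ideal :: "int \<Rightarrow> complex set \<Rightarrow> bool" where
  "int_ideal D I \<longleftrightarrow> I \<subseteq> OK D \<and> I \<noteq> {0} \<and> 0 \<in> I \<and>
     (\<forall>x\<in>I. \<forall>y\<in>I. x + y \<in> I) \<and> (\<forall>x\<in>I. - x \<in> I) \<and>
     (\<forall>a\<in>OK D. \<forall>x\<in>I. a * x \<in> I)"

definition pid :: "int \<Rightarrow> complex \<Rightarrow> complex set" where
  "pid D \<alpha> = {\<alpha> * x | x. x \<in> OK D}"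

definition ideal_norm :: "int \<Rightarrow> complex set \<Rightarrow> nat" where
  "ideal_norm D I = card {{y \<in> OK D. x - y \<in> I} | x. x \<in> OK D}"

definition ideal_dvd :: "int \<Rightarrow> complex set \<Rightarrow> complex set \<Rightarrow> bool" where
  "ideal_dvd D I J \<longleftrightarrow> (\<exists>L. int_ideal D L \<and> setmul I L = J)"

definition ideal_coprime :: "int \<Rightarrow> complex set \<Rightarrow> complex set \<Rightarrow> bool" where
  "ideal_coprime D I J \<longleftrightarrow> {x + y | x y. x \<in> I \<and> y \<in> J} = OK D"

definition unit_mod :: "int \<Rightarrow> complex set \<Rightarrow> complex \<Rightarrow> bool" where
  "unit_mod D m \<alpha> \<longleftrightarrow> \<alpha> \<in> OK D \<and> (\<exists>\<beta>\<in>OK D. \<alpha> * \<beta> - 1 \<in> m)"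

definition rcls :: "int \<Rightarrow> complex set \<Rightarrow> complex \<Rightarrow> complex set" where
  "rcls D m \<alpha> = {x \<in> OK D. x - \<alpha> \<in> m}"

definition unit_classes :: "int \<Rightarrow> complex set \<Rightarrow> complex set set" where
  "unit_classes D m = {rcls D m \<alpha> | \<alpha>. unit_mod D m \<alpha>}"

definition inv_mod :: "int \<Rightarrow> complex set \<Rightarrow> complex \<Rightarrow> complex" where
  "inv_mod D m \<alpha> = (SOME \<beta>. \<beta> \<in> OK D \<and> \<alpha> * \<beta> - 1 \<in> m)"

text \<open>A character of (O_K/m)^*, given by its values on elements of O_K prime to m.\<close>
definition char_mod :: "int \<Rightarrow> complex set \<Rightarrow> (complex \<Rightarrow> complex) \<Rightarrow> bool" where
  "char_mod D m chi \<longleftrightarrow>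
     (\<forall>\<alpha> \<beta>. unit_mod D m \<alpha> \<longrightarrow> unit_mod D m \<beta> \<longrightarrow> \<alpha> - \<beta> \<in> m \<longrightarrow> chi \<alpha> = chi \<beta>) \<and>
     (\<forall>\<alpha> \<beta>. unit_mod D m \<alpha> \<longrightarrow> unit_mod D m \<beta> \<longrightarrow> chi (\<alpha> * \<beta>) = chi \<alpha> * chi \<beta>) \<and>
     (\<forall>\<alpha>. unit_mod D m \<alpha> \<longrightarrow> chi \<alpha> \<noteq> 0)"

text \<open>Hecke character of infinity type [-1/2;1,0] with modulus m, recorded by its
  values on nonzero integral ideals (the homomorphism on fractional ideals prime to m
  is the unique extension); by convention phi(I) = 0 if I is not prime to m.\<close>
definition hecke_mod ::
  "int \<Rightarrow> complex set \<Rightarrow> (complex set \<Rightarrow> complex) \<Rightarrow> (complex \<Rightarrow> complex) \<Rightarrow> bool" where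
  "hecke_mod D m \<phi> chi' \<longleftrightarrow> int_ideal D m \<and> char_mod D m chi' \<and>
     (\<forall>I. int_ideal D I \<longrightarrow> \<not> ideal_coprime D I m \<longrightarrow> \<phi> I = 0) \<and>
     (\<forall>I. int_ideal D I \<longrightarrow> ideal_coprime D I m \<longrightarrow> \<phi> I \<noteq> 0) \<and>
     (\<forall>I J. int_ideal D I \<longrightarrow> int_ideal D J \<longrightarrow> ideal_coprime D I m \<longrightarrow>
        ideal_coprime D J m \<longrightarrow> \<phi> (setmul I J) = \<phi> I * \<phi> J) \<and>
     (\<forall>\<alpha>. unit_mod D m \<alpha> \<longrightarrow> \<phi> (pid D \<alpha>) = \<alpha> * chi' \<alpha>)"

definition hecke_char ::
  "int \<Rightarrow> complex set \<Rightarrow> (complex set \<Rightarrow> complex) \<Rightarrow> (complex \<Rightarrow> complex) \<Rightarrow> bool" where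
  "hecke_char D cf \<phi> chi' \<longleftrightarrow> hecke_mod D cf \<phi> chi' \<and>
     \<not> (\<exists>m \<phi>' chi2. int_ideal D m \<and> cf \<subset> m \<and> hecke_mod D m \<phi>' chi2 \<and>
          (\<forall>I. int_ideal D I \<longrightarrow> ideal_coprime D I cf \<longrightarrow> \<phi>' I = \<phi> I))"

definition theta :: "int \<Rightarrow> (complex set \<Rightarrow> complex) \<Rightarrow> complex \<Rightarrow> complex" where
  "theta D \<phi> \<tau> = infsum (\<lambda>I. \<phi> I * exp (2 * pi * \<i> * \<tau> * of_nat (ideal_norm D I)))
                     {I. int_ideal D I}"

definition lat :: "complex \<Rightarrow> complex set" where
  "lat z = {of_int m + of_int n * z | m n. True}"

definition mult_ring :: "complex set \<Rightarrow> complex set" where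
  "mult_ring L = {l. \<forall>x\<in>L. l * x \<in> L}"

definition homothetic :: "complex set \<Rightarrow> complex set \<Rightarrow> bool" where
  "homothetic L L' \<longleftrightarrow> (\<exists>l. l \<noteq> 0 \<and> (\<lambda>x. l * x) ` L = L')"

text \<open>zs lists representatives z_1..z_h in H of the C-isomorphism classes of elliptic
  curves C/(Z+zZ) with CM by O_K (so h = length zs).\<close>
definition CM_reps :: "int \<Rightarrow> complex list \<Rightarrow> bool" where
  "CM_reps D zs \<longleftrightarrow>
     (\<forall>z\<in>set zs. Im z > 0 \<and> mult_ring (lat z) = OK D) \<and>
     (\<forall>i<length zs. \<forall>j<length zs. i \<noteq> j \<longrightarrow> \<not> homothetic (lat (zs!i)) (lat (zs!j))) \<and>
     (\<forall>w. Im w > 0 \<and> mult_ring (lat w) = OK D \<longrightarrow> (\<exists>z\<in>set zs. homothetic (lat z) (lat w)))"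

definition qcoef :: "complex \<Rightarrow> int \<times> int \<times> int" where
  "qcoef z = (THE (a, b, c). gcd a (gcd b c) = 1 \<and> a > 0 \<and>
                 of_int a * z^2 + of_int b * z + of_int c = 0)"

text \<open>Vectors x e_2 + y e_1 of Lambda_a tensor Q are the pairs (x, y).\<close>
definition gram :: "int \<Rightarrow> complex \<Rightarrow> rat \<times> rat \<Rightarrow> rat \<times> rat \<Rightarrow> rat" where
  "gram f z v w = (case qcoef z of (a, b, c) \<Rightarrow>
      of_int f * (2 * of_int a * fst v * fst w + of_int b * (fst v * snd w + snd v * fst w)
                  + 2 * of_int c * snd v * snd w))"

definition Lam :: "(rat \<times> rat) set" where
  "Lam = {(of_int m, of_int n) | m n. True}"

definition Lam_dual :: "int \<Rightarrow> complex \<Rightarrow> (rat \<times> rat) set" where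
  "Lam_dual f z = {v. \<forall>w\<in>Lam. gram f z v w \<in> \<int>}"

definition lcoset :: "rat \<times> rat \<Rightarrow> (rat \<times> rat) set" where
  "lcoset v = {(fst v + fst u, snd v + snd u) | u. u \<in> Lam}"

definition GLam :: "int \<Rightarrow> complex \<Rightarrow> (rat \<times> rat) set set" where
  "GLam f z = {lcoset v | v. v \<in> Lam_dual f z}"

definition Omega' :: "int \<Rightarrow> complex \<Rightarrow> rat \<times> rat \<Rightarrow> complex" where
  "Omega' f z v = (case qcoef z of (a, b, c) \<Rightarrow>
      complex_of_real (sqrt (2 * of_int a * of_int f)) * (of_rat (fst v) - of_rat (snd v) * z))"

definition Omega :: "int \<Rightarrow> complex \<Rightarrow> rat \<times> rat \<Rightarrow> complex" where
  "Omega f z v = (case qcoef z of (a, b, c) \<Rightarrow>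
      \<i> * complex_of_real (sqrt (real (card (GLam f z))))
        * complex_of_real (1 / sqrt (2 * of_int a * of_int f)) * Omega' f z v)"

definition cund :: "int \<Rightarrow> int \<Rightarrow> complex set" where
  "cund D f = pid D (of_int f * sqrtD D)"

text \<open>Action of g in (O_K/c)^* on G_Lambda via G_Lambda = b_z / c b_z.\<close>
definition gact :: "int \<Rightarrow> int \<Rightarrow> complex \<Rightarrow> complex \<Rightarrow> (rat \<times> rat) set \<Rightarrow> (rat \<times> rat) set" where
  "gact D f z g \<beta> = {v \<in> Lam_dual f z. \<exists>w\<in>\<beta>.
       Omega f z v - g * Omega f z w \<in> setmul (cund D f) (lat z)}"

definition fa :: "int \<Rightarrow> int \<Rightarrow> complex \<Rightarrow> complex \<Rightarrow> (rat \<times> rat) set \<Rightarrow> complex" where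
  "fa D f z \<tau> \<beta> = infsum (\<lambda>v. Omega' f z v *
       exp (pi * \<i> * of_int f * of_int \<bar>D\<bar> * \<tau> * of_rat (gram f z v v))) \<beta>"

definition Fgen :: "int \<Rightarrow> int \<Rightarrow> (complex \<Rightarrow> complex) \<Rightarrow> complex \<Rightarrow> (rat \<times> rat) set
                     \<Rightarrow> complex \<Rightarrow> complex" where
  "Fgen D f chi z \<beta>0 \<tau> = (\<Sum>C\<in>unit_classes D (cund D f).
      chi (SOME g. g \<in> C) *
      fa D f z \<tau> (gact D f z (inv_mod D (cund D f) (SOME g. g \<in> C)) \<beta>0))"

definition cspanH :: "(complex \<Rightarrow> complex) set \<Rightarrow> (complex \<Rightarrow> complex) set" where
  "cspanH S = {h. \<exists>T c. finite T \<and> T \<subseteq> S \<and>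
                  (\<forall>\<tau>. Im \<tau> > 0 \<longrightarrow> h \<tau> = (\<Sum>g\<in>T. c g * g \<tau>))}"

definition Fspace :: "int \<Rightarrow> int \<Rightarrow> (complex \<Rightarrow> complex) \<Rightarrow> complex list
                        \<Rightarrow> (complex \<Rightarrow> complex) set" where
  "Fspace D f chi zs = cspanH {Fgen D f chi (zs ! a) \<beta>0 | a \<beta>0.
                                a < length zs \<and> \<beta>0 \<in> GLam f (zs ! a)}"

end

theory Submission
  imports Defs
begin

text \<open>
  Let \<open>\<bb> = \<int> + z\<int>\<close> be one of the CM lattices and \<open>B = \<qq>\<bb>\<close>. A nonzero \<open>\<nu> \<in> B\<close>
  determines the integral ideal \<open>I = \<nu> B\<inverse>\<close>, whose norm satisfies \<open>r Nm(I) = a |\<nu>|\<^sup>2\<close>; running over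
  all the lattices, every integral ideal arises exactly once for each unit of the ring of integers.
  Hence \<open>\<theta>(r\<tau>)\<close> is a sum over lattices of \<open>\<psi>(\<nu>) \<nu> exp(2\<pi>i a |\<nu>|\<^sup>2 \<tau>)\<close> with
  \<open>\<psi>(\<nu>) = \<phi>(\<nu> B\<inverse>) / \<nu>\<close>. Since \<open>\<qq>\<close> times the conductor divides \<open>c\<close>, the function \<open>\<psi>\<close>
  is constant on cosets of \<open>c\<bb>\<close> and satisfies \<open>\<psi>(g\<nu>) = \<chi>(g)\<inverse> \<psi>(\<nu>)\<close>; averaging over
  the units modulo \<open>c\<close> rewrites the sum in terms of the generators of the space.
\<close>

section \<open>Modules over the ring of integers\<close>

text \<open>A Hecke character is recorded on integral ideals only, so it has to be evaluated along
  \<nu> B^{-1}, which is integral exactly when \<nu> lies in B. The resulting weight is periodic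
  modulo c_f B, and c \<bb> is contained in c_f B = q c_f \<bb> because q c_f divides c; the norm of
  q is what turns \<tau> into r \<tau>.

  Inverses are the obstacle, since ideals and lattices are bare subsets of the complex numbers. They
  all come from one kind of computation, an ideal times its conjugate, where primitivity of binary
  forms of fundamental discriminant yields (Nm I), and the analogue for \<bb> yields norm 1 / a.
  Cancelling invertible modules then takes the place of unique factorisation.

  The averaging loses nothing: the weight already transforms by the inverse of \<chi>, so every unit
  class contributes the same sum, and the total is a nonzero multiple of the sum wanted.\<close>

definition addsub :: "complex set \<Rightarrow> bool" where
  "addsub S \<longleftrightarrow> 0 \<in> S \<and> (\<forall>u\<in>S. \<forall>v\<in>S. u + v \<in> S \<and> - u \<in> S)"

lemma addsubI:
  assumes "0 \<in> S" "\<And>u v. u \<in> S \<Longrightarrow> v \<in> S \<Longrightarrow> u + v \<in> S" "\<And>u. u \<in> S \<Longrightarrow> - u \<in> S"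
  shows "addsub S"
  using assms unfolding addsub_def by blast

lemma addsub_zero: "addsub S \<Longrightarrow> 0 \<in> S"
  and addsub_add: "addsub S \<Longrightarrow> u \<in> S \<Longrightarrow> v \<in> S \<Longrightarrow> u + v \<in> S"
  and addsub_minus: "addsub S \<Longrightarrow> u \<in> S \<Longrightarrow> - u \<in> S"
  unfolding addsub_def by blast+

lemma addsub_diff: "addsub S \<Longrightarrow> u \<in> S \<Longrightarrow> v \<in> S \<Longrightarrow> u - v \<in> S"
  using addsub_add[of S u "- v"] addsub_minus[of S v] by simp

lemma addsub_of_nat: "addsub S \<Longrightarrow> u \<in> S \<Longrightarrow> of_nat n * u \<in> S"
  by (induction n) (auto simp: addsub_zero addsub_add algebra_simps)

lemma addsub_of_int: "addsub S \<Longrightarrow> u \<in> S \<Longrightarrow> of_int n * u \<in> S"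
proof (cases n)
  case (nonneg k)
  then show "addsub S \<Longrightarrow> u \<in> S \<Longrightarrow> of_int n * u \<in> S" using addsub_of_nat by simp
next
  case (neg k)
  then have "of_int n * u = - (of_nat (Suc k) * u)"
    by (simp only: neg of_int_minus of_int_of_nat_eq mult_minus_left)
  then show "addsub S \<Longrightarrow> u \<in> S \<Longrightarrow> of_int n * u \<in> S"
    by (metis addsub_minus addsub_of_nat)
qed

lemma addsub_image:
  assumes "addsub S" "\<And>x y. h (x + y) = h x + h y" "\<And>x. h (- x) = - h x" "h 0 = 0"
  shows "addsub (h ` S)"
proof (rule addsubI)
  show "0 \<in> h ` S" using addsub_zero[OF assms(1)] assms(4) by force
  fix u v assume "u \<in> h ` S" "v \<in> h ` S"
  then obtain x y where "x \<in> S" "y \<in> S" "u = h x" "v = h y" by blast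
  then show "u + v \<in> h ` S" using addsub_add[OF assms(1)] by (auto simp flip: assms(2))
next
  fix u assume "u \<in> h ` S"
  then show "- u \<in> h ` S" using addsub_minus[OF assms(1)] by (auto simp flip: assms(3))
qed

lemma addsub_scale: "addsub S \<Longrightarrow> addsub ((*) c ` S)"
  by (rule addsub_image) (auto simp: algebra_simps)

lemma addsub_vimage_scale: "addsub S \<Longrightarrow> addsub {x. c * x \<in> S}"
  by (rule addsubI) (auto simp: addsub_zero addsub_add addsub_minus algebra_simps)

lemma addsub_setmul: "addsub (setmul A B)"
  unfolding addsub_def setmul_def by blast

lemma setmul_mem: "x \<in> A \<Longrightarrow> y \<in> B \<Longrightarrow> x * y \<in> setmul A B"
  unfolding setmul_def by blast

text \<open>\<open>addsub\<close> is the closure condition inside the definition of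
  \<open>setmul\<close>, so this is the universal property of the generated subgroup. It reduces an
  inclusion of module products to a check on elementary products.\<close>

lemma setmul_least:
  assumes "addsub S" "\<And>x y. x \<in> A \<Longrightarrow> y \<in> B \<Longrightarrow> x * y \<in> S"
  shows "setmul A B \<subseteq> S"
  using assms unfolding addsub_def setmul_def by blast

lemma setmul_mono: "A \<subseteq> A' \<Longrightarrow> B \<subseteq> B' \<Longrightarrow> setmul A B \<subseteq> setmul A' B'"
  by (rule setmul_least[OF addsub_setmul]) (auto intro: setmul_mem)

lemma setmul_commute: "setmul A B = setmul B A"
proof -
  have "setmul A B \<subseteq> setmul B A" for A B
    by (rule setmul_least[OF addsub_setmul]) (metis mult.commute setmul_mem)
  then show ?thesis by blast
qed

text \<open>Elements of a product are sums, so factors cannot be regrouped directly. Instead, the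
  numbers that a fixed \<open>c\<close> multiplies into the target form a subgroup containing all
  elementary products. The opposite inclusion is the same one read backwards through
  commutativity.\<close>

lemma setmul_assoc: "setmul (setmul A B) C = setmul A (setmul B C)"
proof -
  have *: "setmul (setmul A B) C \<subseteq> setmul A (setmul B C)" for A B C
  proof (rule setmul_least[OF addsub_setmul])
    fix x c assume x: "x \<in> setmul A B" and c: "c \<in> C"
    have "setmul A B \<subseteq> {x. c * x \<in> setmul A (setmul B C)}"
    proof (rule setmul_least[OF addsub_vimage_scale[OF addsub_setmul]])
      fix a b assume "a \<in> A" "b \<in> B"
      then have "a * (b * c) \<in> setmul A (setmul B C)" using c by (intro setmul_mem)
      then show "a * b \<in> {x. c * x \<in> setmul A (setmul B C)}" by (simp add: mult_ac)
    qed
    then show "x * c \<in> setmul A (setmul B C)" using x by (auto simp: mult.commute)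
  qed
  have "setmul A (setmul B C) = setmul (setmul C B) A"
    by (simp add: setmul_commute)
  also have "\<dots> \<subseteq> setmul C (setmul B A)" by (rule *)
  also have "\<dots> = setmul (setmul A B) C" by (simp add: setmul_commute)
  finally show ?thesis using * by blast
qed

lemma setmul_left_commute: "setmul A (setmul B C) = setmul B (setmul A C)"
  by (metis setmul_assoc setmul_commute)

lemma setmul_scale: "setmul ((*) c ` A) B = (*) c ` setmul A B"
proof
  show "setmul ((*) c ` A) B \<subseteq> (*) c ` setmul A B"
    by (rule setmul_least[OF addsub_scale[OF addsub_setmul]]) (auto simp: mult.assoc setmul_mem)
  have "setmul A B \<subseteq> {x. c * x \<in> setmul ((*) c ` A) B}"
    by (rule setmul_least[OF addsub_vimage_scale[OF addsub_setmul]])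
       (auto simp flip: mult.assoc intro!: setmul_mem)
  then show "(*) c ` setmul A B \<subseteq> setmul ((*) c ` A) B" by blast
qed

lemma setmul_scale_right: "setmul A ((*) c ` B) = (*) c ` setmul A B"
  by (metis setmul_commute setmul_scale)

text \<open>Conjugation is an involution: the inclusion for the conjugated sets, conjugated once
  more, is the reverse inclusion.\<close>

lemma setmul_cnj: "cnj ` setmul A B = setmul (cnj ` A) (cnj ` B)"
proof -
  have *: "setmul (cnj ` A) (cnj ` B) \<subseteq> cnj ` setmul A B" for A B
  proof (rule setmul_least)
    show "addsub (cnj ` setmul A B)" by (rule addsub_image[OF addsub_setmul]) auto
    show "x * y \<in> cnj ` setmul A B" if "x \<in> cnj ` A" "y \<in> cnj ` B" for x y
      using that setmul_mem[of _ A _ B] by (auto simp flip: complex_cnj_mult)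
  qed
  have "setmul A B \<subseteq> cnj ` setmul (cnj ` A) (cnj ` B)"
    using *[of "cnj ` A" "cnj ` B"] by (simp add: image_image)
  then have "cnj ` setmul A B \<subseteq> cnj ` (cnj ` setmul (cnj ` A) (cnj ` B))" by (rule image_mono)
  then show ?thesis using * by (fastforce simp: image_image)
qed

section \<open>Lattices with basis 1, z\<close>

lemma addsub_lat: "addsub (lat z)"
proof (rule addsubI)
  show "0 \<in> lat z" unfolding lat_def by (rule CollectI, rule exI[of _ 0], rule exI[of _ 0]) simp
next
  fix u v assume "u \<in> lat z" "v \<in> lat z"
  then obtain m n m' n' where "u = of_int m + of_int n * z" "v = of_int m' + of_int n' * z"
    unfolding lat_def by blast
  then have "u + v = of_int (m + m') + of_int (n + n') * z" by (simp add: algebra_simps)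
  then show "u + v \<in> lat z" unfolding lat_def by blast
next
  fix u assume "u \<in> lat z"
  then obtain m n where "u = of_int m + of_int n * z" unfolding lat_def by blast
  then have "- u = of_int (- m) + of_int (- n) * z" by (simp add: algebra_simps)
  then show "- u \<in> lat z" unfolding lat_def by blast
qed

lemma lat_mem: "of_int m + of_int n * z \<in> lat z"
  unfolding lat_def by blast

lemma latE:
  assumes "x \<in> lat z" obtains m n where "x = of_int m + of_int n * z"
  using assms unfolding lat_def by blast

lemma OK_eq_lat: "OK D = lat (omegaK D)"
  unfolding OK_def lat_def ..

lemma OKE:
  assumes "x \<in> OK D" obtains m n where "x = of_int m + of_int n * omegaK D"
  using assms unfolding OK_def by blast

lemma pid_eq: "pid D a = (*) a ` OK D"
  unfolding pid_def by blast

section \<open>Modules, ideal quotients and invertibility\<close>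

definition ok_module :: "int \<Rightarrow> complex set \<Rightarrow> bool" where
  "ok_module D L \<longleftrightarrow> addsub L \<and> (\<forall>a\<in>OK D. \<forall>x\<in>L. a * x \<in> L)"

text \<open>The ideal quotient (O_K : L), which is the inverse of L as soon as L is
  invertible.\<close>

definition colon :: "int \<Rightarrow> complex set \<Rightarrow> complex set" where
  "colon D L = {x. \<forall>y\<in>L. x * y \<in> OK D}"

definition inv_module :: "int \<Rightarrow> complex set \<Rightarrow> bool" where
  "inv_module D L \<longleftrightarrow> ok_module D L \<and> setmul L (colon D L) = OK D"

lemma int_ideal_iff: "int_ideal D I \<longleftrightarrow> ok_module D I \<and> I \<subseteq> OK D \<and> I \<noteq> {0}"
  unfolding int_ideal_def ok_module_def addsub_def by blast

lemma ok_module_scale: "ok_module D L \<Longrightarrow> ok_module D ((*) c ` L)"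
  unfolding ok_module_def using addsub_scale[of L c] by (auto simp: mult.left_commute)

lemma ok_module_setmul:
  assumes "ok_module D A"
  shows "ok_module D (setmul A B)"
proof -
  have "a * x \<in> setmul A B" if a: "a \<in> OK D" and x: "x \<in> setmul A B" for a x
  proof -
    have "setmul A B \<subseteq> {x. a * x \<in> setmul A B}"
    proof (rule setmul_least[OF addsub_vimage_scale[OF addsub_setmul]])
      fix u v assume "u \<in> A" "v \<in> B"
      then have "(a * u) * v \<in> setmul A B"
        using assms a unfolding ok_module_def by (blast intro: setmul_mem)
      then show "u * v \<in> {x. a * x \<in> setmul A B}" by (simp add: mult.assoc)
    qed
    then show ?thesis using x by blast
  qed
  then show ?thesis unfolding ok_module_def using addsub_setmul by blast
qed

section \<open>The ring of integers of the imaginary quadratic field\<close>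

locale imag_quad_field =
  fixes D :: int
  assumes D_neg: "D < 0" and fund: "fund_disc D"
begin

abbreviation "\<omega> \<equiv> omegaK D"

text \<open>The norm of \<omega>, whose trace is D; thus \<omega> is a root of X^2 - D X +
  E.\<close>

definition E :: int where "E = (D\<^sup>2 - D) div 4"

lemma D_mod_4: "D mod 4 = 0 \<or> D mod 4 = 1"
  using fund unfolding fund_disc_def by auto

lemma E_eq: "4 * E = D\<^sup>2 - D"
proof -
  have "4 dvd D * (D - 1)"
  proof -
    have "4 dvd D \<or> 4 dvd D - 1"
      using D_mod_4 by presburger
    then show ?thesis by auto
  qed
  then show ?thesis unfolding E_def by (simp add: power2_eq_square algebra_simps)
qed

lemma sqrtD_sq: "sqrtD D * sqrtD D = of_int D"
proof -
  have "complex_of_real (sqrt (- of_int D)) * complex_of_real (sqrt (- of_int D)) = - of_int D"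
    using D_neg by (simp flip: of_real_mult)
  then show ?thesis unfolding sqrtD_def by (simp add: algebra_simps)
qed

lemma cnj_sqrtD: "cnj (sqrtD D) = - sqrtD D"
  unfolding sqrtD_def by simp

lemma sqrtD_nonzero: "sqrtD D \<noteq> 0"
  using sqrtD_sq D_neg by auto

lemma Im_omega: "Im \<omega> = sqrt (- of_int D) / 2" and Im_omega_pos: "Im \<omega> > 0"
  using D_neg unfolding omegaK_def sqrtD_def by auto

lemma omega_sq: "\<omega> * \<omega> = of_int D * \<omega> - of_int E"
proof -
  have "(of_int (4 * E) :: complex) = of_int (D\<^sup>2 - D)" by (simp only: E_eq)
  then have "4 * (of_int E :: complex) = of_int D * of_int D - of_int D"
    by (simp add: power2_eq_square)
  then have E: "of_int E = (of_int D * of_int D - of_int D) / (4 :: complex)" by (simp add: field_simps)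
  have "\<omega> * \<omega> = (of_int D * of_int D + 2 * of_int D * sqrtD D + sqrtD D * sqrtD D) / 4"
    unfolding omegaK_def by (simp add: field_simps)
  then show ?thesis unfolding E sqrtD_sq unfolding omegaK_def by (simp add: field_simps)
qed

lemma cnj_omega: "cnj \<omega> = of_int D - \<omega>"
  unfolding omegaK_def using cnj_sqrtD by (simp add: field_simps)

lemma omega_cnj_omega: "\<omega> * cnj \<omega> = of_int E"
  unfolding cnj_omega right_diff_distrib omega_sq by (simp add: algebra_simps)

lemma addsub_OK: "addsub (OK D)"
  unfolding OK_eq_lat by (rule addsub_lat)

lemma of_int_in_OK: "of_int n \<in> OK D"
  using lat_mem[of n 0 \<omega>] by (simp add: OK_eq_lat)

lemma one_in_OK: "1 \<in> OK D"
  using of_int_in_OK[of 1] by simp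

lemma omega_in_OK: "\<omega> \<in> OK D"
  using lat_mem[of 0 1 \<omega>] by (simp add: OK_eq_lat)

lemma mult_in_OK:
  assumes "x \<in> OK D" "y \<in> OK D" shows "x * y \<in> OK D"
proof -
  obtain m n m' n' where *: "x = of_int m + of_int n * \<omega>" "y = of_int m' + of_int n' * \<omega>"
    using assms by (meson OKE)
  have "x * y = of_int (m * m' - n * n' * E) + of_int (m * n' + n * m' + n * n' * D) * \<omega>"
  proof -
    have "x * y = of_int m * of_int m' + (of_int m * of_int n' + of_int n * of_int m') * \<omega>
        + of_int n * of_int n' * (\<omega> * \<omega>)"
      unfolding * by (simp add: algebra_simps)
    then show ?thesis unfolding omega_sq by (simp add: algebra_simps)
  qed
  then show ?thesis unfolding OK_eq_lat using lat_mem by metis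
qed

lemma cnj_in_OK:
  assumes "x \<in> OK D" shows "cnj x \<in> OK D"
proof -
  obtain m n where "x = of_int m + of_int n * \<omega>"
    using assms by (meson OKE)
  then have "cnj x = of_int (m + n * D) + of_int (- n) * \<omega>"
    by (simp add: cnj_omega algebra_simps)
  then show ?thesis unfolding OK_eq_lat using lat_mem by metis
qed

lemma cnj_OK: "cnj ` OK D = OK D"
  using cnj_in_OK by (auto simp: image_iff) (metis complex_cnj_cnj)

lemma ok_module_OK: "ok_module D (OK D)"
  unfolding ok_module_def using addsub_OK mult_in_OK by blast

lemma setmul_OK: "ok_module D L \<Longrightarrow> setmul (OK D) L = L"
proof
  assume "ok_module D L"
  then show "setmul (OK D) L \<subseteq> L" by (intro setmul_least) (auto simp: ok_module_def)
  show "L \<subseteq> setmul (OK D) L" using setmul_mem[OF one_in_OK, of _ L] by auto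
qed

lemma setmul_pid: "ok_module D L \<Longrightarrow> setmul (pid D a) L = (*) a ` L"
  by (simp add: pid_eq setmul_scale setmul_OK)

lemma setmul_subset:
  assumes "ok_module D L" "A \<subseteq> OK D" shows "setmul A L \<subseteq> L"
  using setmul_mono[OF assms(2) subset_refl, of L] setmul_OK[OF assms(1)] by simp

lemma ok_module_colon: "ok_module D (colon D L)"
  unfolding ok_module_def colon_def
  by (auto intro!: addsubI addsub_add[OF addsub_OK] addsub_minus[OF addsub_OK]
           simp: addsub_zero[OF addsub_OK] distrib_right mult.assoc mult_in_OK)

text \<open>Any M with L M = O_K carries L into O_K, so it lies in the colon, while L times the
  colon never leaves O_K. Exhibiting some inverse is therefore enough.\<close>

lemma inv_moduleI:
  assumes "ok_module D L" "setmul L M = OK D"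
  shows "inv_module D L"
proof -
  have "M \<subseteq> colon D L"
    unfolding colon_def assms(2)[symmetric] by (subst setmul_commute) (auto intro: setmul_mem)
  then have "OK D \<subseteq> setmul L (colon D L)"
    using setmul_mono[of L L M] assms(2) by blast
  moreover have "setmul L (colon D L) \<subseteq> OK D"
    by (rule setmul_least[OF addsub_OK]) (auto simp: colon_def mult.commute)
  ultimately show ?thesis using assms(1) unfolding inv_module_def by blast
qed

lemma inv_module_ok: "inv_module D L \<Longrightarrow> ok_module D L"
  and inv_module_colon: "inv_module D L \<Longrightarrow> setmul L (colon D L) = OK D"
  unfolding inv_module_def by auto

lemma inv_module_setmul:
  assumes "inv_module D A" "inv_module D B"
  shows "inv_module D (setmul A B)"
proof (rule inv_moduleI)
  show "ok_module D (setmul A B)" using assms by (intro ok_module_setmul inv_module_ok)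
  have "setmul (setmul A B) (setmul (colon D A) (colon D B))
      = setmul (setmul A (colon D A)) (setmul B (colon D B))"
    by (simp add: setmul_assoc setmul_left_commute)
  then show "setmul (setmul A B) (setmul (colon D A) (colon D B)) = OK D"
    using assms by (simp add: inv_module_colon setmul_OK ok_module_OK)
qed

lemma inv_module_cancel:
  assumes "inv_module D L" "ok_module D X" "ok_module D Y" "setmul L X = setmul L Y"
  shows "X = Y"
proof -
  have "setmul (setmul L (colon D L)) X = setmul (setmul L (colon D L)) Y"
    using assms(4) by (metis setmul_assoc setmul_commute)
  then show ?thesis using assms by (simp add: inv_module_colon setmul_OK)
qed

text \<open>Turns L X = (c) into X = c L^{-1}. It recovers an ideal from its number \<nu>, and a
  lattice, up to homothety, from the ideal that it inverts.\<close>

lemma setmul_eq_scaled_OK: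
  assumes "inv_module D L" "ok_module D X"
  shows "setmul L X = (*) c ` OK D \<longleftrightarrow> X = (*) c ` colon D L"
proof -
  have *: "setmul L ((*) c ` colon D L) = (*) c ` OK D"
    using assms by (simp add: setmul_scale_right inv_module_colon)
  show ?thesis
    using * inv_module_cancel[OF assms ok_module_scale[OF ok_module_colon]] by metis
qed

end

section \<open>Index of sublattices of the integer plane\<close>

lemma int_subgroup_principal:
  fixes S :: "int set"
  assumes zero: "0 \<in> S" and diff: "\<And>x y. x \<in> S \<Longrightarrow> y \<in> S \<Longrightarrow> x - y \<in> S"
    and N: "N \<in> S" "N > 0"
  obtains d where "d > 0" "\<And>x. x \<in> S \<longleftrightarrow> d dvd x"
proof -
  define P where "P = (\<lambda>n::nat. n > 0 \<and> int n \<in> S)"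
  define d where "d = int (LEAST n. P n)"
  have "P (nat N)" using N by (simp add: P_def)
  then have "P (LEAST n. P n)" by (rule LeastI)
  then have d: "d > 0" "d \<in> S" by (auto simp: P_def d_def)
  have least: "x \<ge> d" if "x \<in> S" "x > 0" for x
  proof -
    have "P (nat x)" using that by (simp add: P_def)
    then have "(LEAST n. P n) \<le> nat x" by (rule Least_le)
    then show ?thesis using that by (simp add: d_def)
  qed
  have neg: "- x \<in> S" if "x \<in> S" for x using diff[OF zero that] by simp
  have add: "x + y \<in> S" if "x \<in> S" "y \<in> S" for x y using diff[OF that(1) neg[OF that(2)]] by simp
  have nmult: "int j * d \<in> S" for j
    by (induction j) (auto simp: zero add d distrib_right)
  have mult: "j * d \<in> S" for j
  proof (cases "j \<ge> 0")
    case True then show ?thesis using nmult[of "nat j"] by simp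
  next
    case False then show ?thesis using neg[OF nmult[of "nat (- j)"]] by simp
  qed
  have "x \<in> S \<longleftrightarrow> d dvd x" for x
  proof
    assume "x \<in> S"
    then have "x - (x div d) * d \<in> S" using diff mult by blast
    then have "x mod d \<in> S" by (simp add: minus_div_mult_eq_mod)
    moreover have "0 \<le> x mod d" "x mod d < d" using d by auto
    ultimately have "x mod d = 0" using least[of "x mod d"] by linarith
    then show "d dvd x" by auto
  next
    assume "d dvd x" then show "x \<in> S" using mult by (metis dvd_div_mult_self)
  qed
  then show ?thesis using that d by blast
qed

text \<open>Hermite normal form: m generates the projection of H to the second coordinate, k is a
  first coordinate lying over m, and n generates the part of H on the first axis. The vectors with
  entry N guarantee that both generators are positive.\<close>

lemma sublattice_normal_form:
  fixes H :: "(int \<times> int) set"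
  assumes zero: "(0, 0) \<in> H"
    and diff: "\<And>x y x' y'. (x, y) \<in> H \<Longrightarrow> (x', y') \<in> H \<Longrightarrow> (x - x', y - y') \<in> H"
    and N: "(N, 0) \<in> H" "(0, N) \<in> H" "N > 0"
  obtains n m k where "n > 0" "m > 0"
    "\<And>x y. (x, y) \<in> H \<longleftrightarrow> (\<exists>i j. x = i * n + j * k \<and> y = j * m)"
proof -
  obtain n where n: "n > 0" "\<And>x. x \<in> {x. (x, 0) \<in> H} \<longleftrightarrow> n dvd x"
    using int_subgroup_principal[of "{x. (x, 0) \<in> H}" N] zero N diff[of _ 0 _ 0] by auto
  obtain m where m: "m > 0" "\<And>y. y \<in> {y. \<exists>x. (x, y) \<in> H} \<longleftrightarrow> m dvd y"
  proof (rule int_subgroup_principal[of "{y. \<exists>x. (x, y) \<in> H}" N])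
    show "x - y \<in> {y. \<exists>x. (x, y) \<in> H}"
      if "x \<in> {y. \<exists>x. (x, y) \<in> H}" "y \<in> {y. \<exists>x. (x, y) \<in> H}" for x y
      using that diff by blast
  qed (use zero N in auto)
  obtain k where k: "(k, m) \<in> H" using m(2)[of m] by auto
  have add: "(x + x', y + y') \<in> H" if "(x, y) \<in> H" "(x', y') \<in> H" for x y x' y'
    using diff[OF that(1) diff[OF zero that(2)]] by simp
  have nmult: "(int j * k, int j * m) \<in> H" for j
    by (induction j) (auto simp: zero distrib_right intro: add k)
  have mult: "(j * k, j * m) \<in> H" for j
  proof (cases "j \<ge> 0")
    case True then show ?thesis using nmult[of "nat j"] by simp
  next
    case False then show ?thesis using diff[OF zero nmult[of "nat (- j)"]] by simp
  qed
  have "(x, y) \<in> H \<longleftrightarrow> (\<exists>i j. x = i * n + j * k \<and> y = j * m)" for x y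
  proof
    assume H: "(x, y) \<in> H"
    then have "m dvd y" using m(2)[of y] by auto
    then obtain j where j: "y = j * m" by (metis dvd_div_mult_self)
    have "(x - j * k, 0) \<in> H" using diff[OF H mult[of j]] j by simp
    then have "n dvd x - j * k" using n(2) by auto
    then obtain i where "x - j * k = i * n" by (metis dvd_def mult.commute)
    then show "\<exists>i j. x = i * n + j * k \<and> y = j * m" using j by (metis diff_add_cancel)
  next
    assume "\<exists>i j. x = i * n + j * k \<and> y = j * m"
    then obtain i j where ij: "x = i * n + j * k" "y = j * m" by blast
    have "(i * n, 0) \<in> H" using n(2)[of "i * n"] by auto
    from add[OF this mult[of j]] show "(x, y) \<in> H" by (simp add: ij)
  qed
  then show ?thesis using that n(1) m(1) by blast
qed

lemma card_quotient_normal_form: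
  fixes H :: "(int \<times> int) set"
  assumes n: "n > 0" and m: "m > 0"
    and H: "\<And>x y. (x, y) \<in> H \<longleftrightarrow> (\<exists>i j. x = i * n + j * k \<and> y = j * m)"
  shows "card (range (\<lambda>(x, y). {(x', y'). (x - x', y - y') \<in> H})) = nat (n * m)"
proof -
  define cl where "cl = (\<lambda>(x, y). {(x', y'). (x - x', y - y') \<in> H})"
  have zero: "(0, 0) \<in> H" unfolding H by (rule exI[of _ 0], rule exI[of _ 0]) simp
  have diff: "(x - x', y - y') \<in> H" if xy: "(x, y) \<in> H" "(x', y') \<in> H" for x y x' y'
  proof -
    obtain i j i' j' where "x = i * n + j * k" "y = j * m" "x' = i' * n + j' * k" "y' = j' * m"
      using xy unfolding H by blast
    then have "x - x' = (i - i') * n + (j - j') * k" "y - y' = (j - j') * m"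
      by (auto simp: algebra_simps)
    then show ?thesis unfolding H by blast
  qed
  have cl_eq: "cl (x, y) = cl (x', y') \<longleftrightarrow> (x - x', y - y') \<in> H" for x y x' y'
  proof
    assume "cl (x, y) = cl (x', y')"
    moreover have "(x', y') \<in> cl (x', y')" using zero by (simp add: cl_def)
    ultimately have "(x', y') \<in> cl (x, y)" by simp
    then show "(x - x', y - y') \<in> H" by (simp add: cl_def)
  next
    assume h: "(x - x', y - y') \<in> H"
    have "(x - u, y - v) \<in> H \<longleftrightarrow> (x' - u, y' - v) \<in> H" for u v
      using diff[OF _ h, of "x - u" "y - v"] diff[OF h diff[OF zero, of "x' - u" "y' - v"]]
      by auto
    then show "cl (x, y) = cl (x', y')" by (simp add: cl_def)
  qed
  have "inj_on cl ({0..<n} \<times> {0..<m})"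
  proof (rule inj_onI, clarify)
    fix x y x' y'
    assume b: "x \<in> {0..<n}" "y \<in> {0..<m}" "x' \<in> {0..<n}" "y' \<in> {0..<m}"
      and "cl (x, y) = cl (x', y')"
    then obtain i j where ij: "x - x' = i * n + j * k" "y - y' = j * m" unfolding cl_eq H by blast
    have "\<bar>j * m\<bar> < m" using b ij(2) by auto
    then have "j = 0" using m by (simp add: abs_mult)
    have "\<bar>i * n\<bar> < n" using b ij(1) \<open>j = 0\<close> by auto
    then have "i = 0" using n by (simp add: abs_mult)
    then show "x = x' \<and> y = y'" using ij \<open>j = 0\<close> by simp
  qed
  moreover have "cl ` ({0..<n} \<times> {0..<m}) = range cl"
  proof -
    have "cl (x, y) \<in> cl ` ({0..<n} \<times> {0..<m})" for x y
    proof -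
      \<comment> \<open>Removing y div m copies of (k, m) reduces the second coordinate but shifts
        the first; only then is the first coordinate reduced mod n.\<close>
      define x' where "x' = x - (y div m) * k"
      have "cl (x, y) = cl (x' mod n, y mod m)"
        unfolding cl_eq H
        by (intro exI[of _ "x' div n"] exI[of _ "y div m"])
           (simp add: x'_def minus_mod_eq_div_mult[symmetric])
      then show ?thesis using n m by auto
    qed
    then show ?thesis by auto
  qed
  ultimately have "card (range cl) = card ({0..<n} \<times> {0..<m})"
    by (metis card_image)
  also have "\<dots> = nat (n * m)" using n m by (simp add: card_cartesian_product nat_mult_distrib)
  finally show ?thesis by (simp add: cl_def)
qed

text \<open>The given generators and those of the normal form are integer combinations of each
  other, so by multiplicativity of the determinant each of d and n m divides the other. The index n
  m of the normal form is therefore the absolute value of d.\<close>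

lemma card_quotient_det:
  fixes p q s t :: int
  assumes det: "p * t - q * s \<noteq> 0"
    and H: "\<And>x y. (x, y) \<in> H \<longleftrightarrow> (\<exists>i j. x = i * p + j * s \<and> y = i * q + j * t)"
  shows "card (range (\<lambda>(x, y). {(x', y'). (x - x', y - y') \<in> H})) = nat \<bar>p * t - q * s\<bar>"
proof -
  define d where "d = p * t - q * s"
  have zero: "(0, 0) \<in> H" unfolding H by (rule exI[of _ 0], rule exI[of _ 0]) simp
  have diff: "(x - x', y - y') \<in> H" if xy: "(x, y) \<in> H" "(x', y') \<in> H" for x y x' y'
  proof -
    obtain i j i' j' where "x = i * p + j * s" "y = i * q + j * t"
      "x' = i' * p + j' * s" "y' = i' * q + j' * t"
      using xy unfolding H by blast
    then have "x - x' = (i - i') * p + (j - j') * s" "y - y' = (i - i') * q + (j - j') * t"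
      by (auto simp: algebra_simps)
    then show ?thesis unfolding H by blast
  qed
  \<comment> \<open>Cramer's rule: the coefficients are adjugate entries with the sign of d, which
    places |d| times each unit vector in H.\<close>
  have "(\<bar>d\<bar>, 0) \<in> H"
    unfolding H by (rule exI[of _ "sgn d * t"], rule exI[of _ "- sgn d * q"])
      (simp add: d_def abs_sgn algebra_simps)
  moreover have "(0, \<bar>d\<bar>) \<in> H"
    unfolding H by (rule exI[of _ "- sgn d * s"], rule exI[of _ "sgn d * p"])
      (simp add: d_def abs_sgn algebra_simps)
  moreover have "\<bar>d\<bar> > 0" using det by (simp add: d_def)
  ultimately obtain n m k where nmk: "n > 0" "m > 0"
    "\<And>x y. (x, y) \<in> H \<longleftrightarrow> (\<exists>i j. x = i * n + j * k \<and> y = j * m)"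
    using sublattice_normal_form[OF zero diff] by metis
  have "(p, q) \<in> H" unfolding H by (rule exI[of _ 1], rule exI[of _ 0]) simp
  then obtain p' q' where 1: "p = p' * n + q' * k" "q = q' * m" unfolding nmk(3) by blast
  have "(s, t) \<in> H" unfolding H by (rule exI[of _ 0], rule exI[of _ 1]) simp
  then obtain s' t' where 2: "s = s' * n + t' * k" "t = t' * m" unfolding nmk(3) by blast
  have "d = n * m * (p' * t' - q' * s')" unfolding d_def 1 2 by (simp add: algebra_simps)
  then have dvd1: "n * m dvd d" by simp
  have "(n, 0) \<in> H" unfolding nmk(3) by (rule exI[of _ 1], rule exI[of _ 0]) simp
  then obtain i j where 3: "n = i * p + j * s" "0 = i * q + j * t" unfolding H by blast
  have "(k, m) \<in> H" unfolding nmk(3) by (rule exI[of _ 0], rule exI[of _ 1]) simp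
  then obtain i' j' where 4: "k = i' * p + j' * s" "m = i' * q + j' * t" unfolding H by blast
  have "n * m = n * m - k * 0" by simp
  also have "\<dots> = d * (i * j' - i' * j)" unfolding d_def 3(2)
    by (subst 3(1), subst 4(1), subst 4(2)) (simp add: algebra_simps)
  finally have "d dvd n * m" by simp
  with dvd1 have "\<bar>d\<bar> = \<bar>n * m\<bar>" using zdvd_antisym_abs by blast
  then have "nat \<bar>d\<bar> = nat (n * m)" using nmk by (simp add: abs_mult)
  then show ?thesis using card_quotient_normal_form[OF nmk] by (simp add: d_def)
qed

section \<open>Norms and invertibility of ideals\<close>

text \<open>A common factor g gives D = g^2 D1 with D1 again congruent to 0 or 1 mod 4, which a
  fundamental discriminant allows only for a unit g. This is where maximality of the order
  enters.\<close>

lemma primitive_of_fund_disc: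
  assumes "fund_disc D" "b\<^sup>2 - 4 * a * c = D"
  shows "gcd a (gcd b c) = 1"
proof -
  define g where "g = gcd a (gcd b c)"
  obtain a1 b1 c1 where abc: "a = g * a1" "b = g * b1" "c = g * c1"
  proof -
    have "g dvd a" "g dvd b" "g dvd c"
      unfolding g_def by (auto intro: dvd_trans[OF gcd_dvd2])
    then show ?thesis using that by (elim dvdE)
  qed
  define D1 where "D1 = b1\<^sup>2 - 4 * a1 * c1"
  have D: "D = g\<^sup>2 * D1"
    using assms(2) unfolding abc D1_def by (simp add: power2_eq_square algebra_simps)
  have D1: "D1 mod 4 = 0 \<or> D1 mod 4 = 1"
  proof -
    have "D1 mod 4 = b1\<^sup>2 mod 4" unfolding D1_def by (simp add: mod_diff_eq[symmetric] mult.assoc)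
    also have "\<dots> = 0 \<or> \<dots> = 1"
    proof (cases "even b1")
      case True then show ?thesis by (auto elim!: evenE simp: power2_eq_square)
    next
      case False
      then obtain e where "b1 = 2 * e + 1" by (elim oddE)
      then have "b1\<^sup>2 = 1 + 4 * (e * e + e)" by (simp add: power2_eq_square algebra_simps)
      then show ?thesis by (simp only: mod_mult_self2) simp
    qed
    finally show ?thesis .
  qed
  have "is_unit g"
  proof (cases "D mod 4 = 1 \<and> squarefree D")
    case True
    then show ?thesis using squarefreeD[of D g] D by auto
  next
    case False
    then obtain m where m: "D = 4 * m" "m mod 4 = 2 \<or> m mod 4 = 3" "squarefree m"
      using assms(1) unfolding fund_disc_def by blast
    show ?thesis
    proof (cases "even g")
      case True
      then obtain h where h: "g = 2 * h" by blast
      \<comment> \<open>Squarefreeness of m only forces h^2 = 1, hence m = D1. The contradiction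
        comes from residues: m is 2 or 3 mod 4, while D1 is 0 or 1.\<close>
      have mh: "m = h\<^sup>2 * D1" using D m(1) unfolding h by (simp add: power2_eq_square)
      then have "is_unit h" using squarefreeD[OF m(3), of h] by auto
      then have "h\<^sup>2 = 1" by (auto simp: power2_eq_square zdvd1_eq abs_if split: if_splits)
      then show ?thesis using mh m(2) D1 by auto
    next
      case False
      then have "coprime (g\<^sup>2) 4"
        using coprime_power_left_iff[of g 2 "2 ^ 2"] coprime_power_right_iff[of g 2 2] by simp
      moreover have "g\<^sup>2 dvd 4 * m" using D m(1) by auto
      ultimately have "g\<^sup>2 dvd m" by (simp add: coprime_dvd_mult_right_iff)
      then show ?thesis using squarefreeD[OF m(3), of g] by auto
    qed
  qed
  then show ?thesis unfolding g_def by simp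
qed

lemma gcd3_eq_1_bezout:
  fixes a b c :: int
  assumes "gcd a (gcd b c) = 1"
  obtains u v w where "u * a + v * b + w * c = 1"
proof -
  obtain x y where 1: "x * b + y * c = gcd b c" using bezout_int by blast
  obtain u v where 2: "u * a + v * gcd b c = 1" using bezout_int[of a "gcd b c"] assms by auto
  have "u * a + (v * x) * b + (v * y) * c = 1"
    using 2 unfolding 1[symmetric] by (simp add: algebra_simps)
  then show ?thesis using that by blast
qed

section \<open>Integral ideals: standard bases, norms and inverses\<close>

context imag_quad_field
begin

lemma omega_coeffs_unique:
  assumes "of_int x + of_int y * \<omega> = of_int x' + of_int y' * \<omega>"
  shows "x = x'" "y = y'"
proof -
  have "of_int y * Im \<omega> = of_int y' * Im \<omega>" using arg_cong[OF assms, of Im] by simp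
  then show "y = y'" using Im_omega_pos by simp
  then show "x = x'" using assms by simp
qed

lemma norm_int:
  assumes "x \<in> OK D"
  obtains n :: int where "x * cnj x = of_int n" "n \<ge> 0" "x \<noteq> 0 \<Longrightarrow> n > 0"
proof -
  obtain i j where x: "x = of_int i + of_int j * \<omega>" using assms by (rule OKE)
  have "x * cnj x = of_int i * of_int i + of_int i * of_int j * (\<omega> + cnj \<omega>)
      + of_int j * of_int j * (\<omega> * cnj \<omega>)"
    unfolding x by (simp add: algebra_simps)
  also have "\<dots> = of_int (i * i + i * j * D + j * j * E)"
    unfolding omega_cnj_omega by (simp add: cnj_omega)
  finally have 1: "x * cnj x = of_int (i * i + i * j * D + j * j * E)" .
  define n where "n = i * i + i * j * D + j * j * E"
  have "complex_of_real ((cmod x)\<^sup>2) = of_int n"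
    using 1 by (simp only: complex_norm_square n_def)
  then have "(cmod x)\<^sup>2 = of_int n" by (metis of_real_eq_iff of_real_of_int_eq)
  then have "n \<ge> 0" "x \<noteq> 0 \<Longrightarrow> n > 0"
    by (metis of_int_0_le_iff zero_le_power2)
       (metis \<open>(cmod x)\<^sup>2 = of_int n\<close> of_int_0_less_iff zero_less_norm_iff zero_less_power)
  then show ?thesis using that[OF 1[folded n_def]] by blast
qed

text \<open>In the coordinates 1, \<omega> the Hermite basis of I is n and k + m \<omega>. Stability
  under \<omega> forces m to divide n and k, leaving m times an ideal with basis a and k' +
  \<omega>, where a divides the norm of k' + \<omega>. The ideal norm is the index of this
  sublattice.\<close>

lemma int_ideal_normal_form:
  assumes I: "int_ideal D I"
  obtains m a k c :: int where "m > 0" "a > 0" "a * c = k * k + k * D + E"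
    "I = {of_int m * (of_int i * of_int a + of_int j * (of_int k + \<omega>)) | i j. True}"
    "ideal_norm D I = nat (m * m * a)"
proof -
  define H where "H = {(x, y). of_int x + of_int y * \<omega> \<in> I}"
  have mod: "addsub I" "\<And>x y. x \<in> OK D \<Longrightarrow> y \<in> I \<Longrightarrow> x * y \<in> I" and sub: "I \<subseteq> OK D"
    using I unfolding int_ideal_iff ok_module_def by auto
  obtain x where x: "x \<in> I" "x \<noteq> 0"
    using I unfolding int_ideal_def by blast
  obtain N where N: "x * cnj x = of_int N" "N > 0"
    by (rule norm_int[of x]) (use x sub in auto)
  \<comment> \<open>The norm of a nonzero element is a positive integer in I; together with its
    multiple by \<omega> it supplies the full rank that the normal form asks for.\<close>
  have NI: "of_int N \<in> I"
    using mod(2)[OF cnj_in_OK[of x] x(1)] x sub N(1) by (auto simp: mult.commute)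
  have zero: "(0, 0) \<in> H" using addsub_zero[OF mod(1)] by (simp add: H_def)
  have diff: "(x - x', y - y') \<in> H" if "(x, y) \<in> H" "(x', y') \<in> H" for x y x' y'
    using that addsub_diff[OF mod(1)] by (fastforce simp: H_def algebra_simps)
  have N0: "(N, 0) \<in> H" using NI by (simp add: H_def)
  have "\<omega> * of_int N \<in> I" using mod(2)[OF omega_in_OK NI] .
  then have N1: "(0, N) \<in> H" by (simp add: H_def mult.commute)
  obtain n m k where nmk: "n > 0" "m > 0"
    "\<And>x y. (x, y) \<in> H \<longleftrightarrow> (\<exists>i j. x = i * n + j * k \<and> y = j * m)"
    using sublattice_normal_form[OF zero diff N0 N1 N(2)] by metis
  have n_in: "(n, 0) \<in> H" unfolding nmk(3) by (rule exI[of _ 1], rule exI[of _ 0]) simp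
  have k_in: "(k, m) \<in> H" unfolding nmk(3) by (rule exI[of _ 0], rule exI[of _ 1]) simp
  have om: "(- y * E, x + y * D) \<in> H" if "(x, y) \<in> H" for x y
  proof -
    have "\<omega> * (of_int x + of_int y * \<omega>) \<in> I" using that mod(2)[OF omega_in_OK] by (simp add: H_def)
    also have "\<omega> * (of_int x + of_int y * \<omega>) = of_int x * \<omega> + of_int y * (\<omega> * \<omega>)"
      by (simp add: algebra_simps)
    also have "\<dots> = of_int (- y * E) + of_int (x + y * D) * \<omega>"
      unfolding omega_sq by (simp add: algebra_simps)
    finally show ?thesis by (simp only: H_def mem_Collect_eq prod.case)
  qed
  have "(- 0 * E, n + 0 * D) \<in> H" by (rule om[OF n_in])
  then have "m dvd n" unfolding nmk(3) by auto
  then obtain a where a: "n = m * a" by (elim dvdE)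
  \<comment> \<open>These are the coordinates of \<omega> (k + m \<omega>): the second shows that m
    divides k, the first that a divides the norm of k' + \<omega>.\<close>
  obtain i j where ij: "- m * E = i * n + j * k" "k + m * D = j * m"
    using om[OF k_in] unfolding nmk(3) by blast
  define k' where "k' = j - D"
  have k': "k = m * k'" using ij(2) by (simp add: k'_def algebra_simps)
  have "m * (- E) = m * (i * a + j * k')"
    using ij(1) unfolding a k' by (simp add: algebra_simps)
  then have "- E = i * a + j * k'" using nmk(2) by (metis less_irrefl mult_left_cancel)
  then have "a * (- i) = j * k' + E" by (simp add: mult.commute)
  also have "j = k' + D" by (simp add: k'_def)
  finally have c: "a * (- i) = k' * k' + k' * D + E" by (simp add: algebra_simps)
  have "I = {of_int m * (of_int i * of_int a + of_int j * (of_int k' + \<omega>)) | i j. True}"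
  proof -
    have "x \<in> I \<longleftrightarrow> (\<exists>i j. x = of_int m * (of_int i * of_int a + of_int j * (of_int k' + \<omega>)))" for x
    proof
      assume "x \<in> I"
      moreover obtain u v where uv: "x = of_int u + of_int v * \<omega>" using \<open>x \<in> I\<close> sub by (blast elim: OKE)
      ultimately have "(u, v) \<in> H" by (simp add: H_def)
      then obtain i j where "u = i * n + j * k" "v = j * m" unfolding nmk(3) by blast
      then have "x = of_int m * (of_int i * of_int a + of_int j * (of_int k' + \<omega>))"
        unfolding uv a k' by (simp add: algebra_simps)
      then show "\<exists>i j. x = of_int m * (of_int i * of_int a + of_int j * (of_int k' + \<omega>))" by blast
    next
      assume "\<exists>i j. x = of_int m * (of_int i * of_int a + of_int j * (of_int k' + \<omega>))"
      then obtain i j where x: "x = of_int m * (of_int i * of_int a + of_int j * (of_int k' + \<omega>))" by blast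
      have "(i * n + j * k, j * m) \<in> H" unfolding nmk(3) by blast
      then show "x \<in> I" unfolding x H_def a k' by (simp add: algebra_simps)
    qed
    then show ?thesis by blast
  qed
  moreover have "ideal_norm D I = nat (m * m * a)"
  proof -
    define h where "h = (\<lambda>(x, y). complex_of_int x + complex_of_int y * \<omega>)"
    define cl where "cl = (\<lambda>(x, y). {(x', y'). (x - x', y - y') \<in> H})"
    have h_inj: "inj h" unfolding h_def by (auto intro!: injI dest: omega_coeffs_unique)
    have h_range: "OK D = range h" unfolding h_def OK_def by auto
    have hcl: "{y \<in> OK D. h u - y \<in> I} = h ` cl u" for u
      unfolding h_range by (cases u) (auto simp: h_def cl_def H_def algebra_simps image_iff)
    have "{{y \<in> OK D. x - y \<in> I} | x. x \<in> OK D} = (\<lambda>x. {y \<in> OK D. x - y \<in> I}) ` range h"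
      unfolding h_range[symmetric] by blast
    also have "\<dots> = (`) h ` range cl" by (simp only: image_image hcl)
    finally have "ideal_norm D I = card ((`) h ` range cl)" by (simp only: ideal_norm_def)
    also have "\<dots> = card (range cl)"
      using h_inj by (intro card_image) (auto intro!: inj_onI simp: inj_image_eq_iff)
    also have "\<dots> = nat (n * m)" unfolding cl_def by (rule card_quotient_normal_form[OF nmk])
    finally show ?thesis by (simp add: a mult_ac)
  qed
  ultimately show ?thesis using that[OF nmk(2) _ c] nmk(1) nmk(2) a by (simp add: zero_less_mult_iff)
qed

text \<open>After removing the factor m^2 a, the products of basis elements with conjugate basis
  elements are a, k + \<omega>, its conjugate and c. All lie in O_K. Among their combinations are a,
  the trace 2 k + D and c, which are the coefficients of a form of discriminant D, hence coprime, so
  1 is reached.\<close>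

lemma int_ideal_mult_cnj:
  assumes I: "int_ideal D I"
  shows "setmul I (cnj ` I) = pid D (of_nat (ideal_norm D I))" and "ideal_norm D I > 0"
proof -
  obtain m a k c :: int where ma: "m > 0" "a > 0" and c: "a * c = k * k + k * D + E"
    and Ieq: "I = {of_int m * (of_int i * of_int a + of_int j * (of_int k + \<omega>)) | i j. True}"
    and nrm: "ideal_norm D I = nat (m * m * a)"
    by (rule int_ideal_normal_form[OF I])
  show "ideal_norm D I > 0" using ma nrm by simp
  define N :: complex where "N = of_int m * of_int m * of_int a"
  have N: "of_nat (ideal_norm D I) = N" using ma unfolding nrm N_def by simp
  have cI: "ok_module D (setmul I (cnj ` I))"
    using I unfolding int_ideal_iff by (auto intro: ok_module_setmul)
  have kw: "(of_int k + \<omega>) * (of_int k + cnj \<omega>) = of_int a * of_int c"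
  proof -
    have "(of_int k + \<omega>) * (of_int k + cnj \<omega>)
        = of_int k * of_int k + of_int k * (\<omega> + cnj \<omega>) + \<omega> * cnj \<omega>" by (simp add: algebra_simps)
    also have "\<dots> = of_int (k * k + k * D + E)" unfolding omega_cnj_omega by (simp add: cnj_omega)
    finally show ?thesis unfolding c[symmetric] by simp
  qed
  show "setmul I (cnj ` I) = pid D (of_nat (ideal_norm D I))"
  proof
    show "setmul I (cnj ` I) \<subseteq> pid D (of_nat (ideal_norm D I))"
      unfolding N pid_eq
    proof (rule setmul_least[OF addsub_scale[OF addsub_OK]])
      fix x y assume "x \<in> I" "y \<in> cnj ` I"
      then obtain i j i' j' where
        x: "x = of_int m * (of_int i * of_int a + of_int j * (of_int k + \<omega>))" and
        y: "y = of_int m * (of_int i' * of_int a + of_int j' * (of_int k + cnj \<omega>))"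
        unfolding Ieq by (fastforce simp del: mult_cancel_left)
      define w where "w = of_int (i * i' * a) + of_int (i * j') * (of_int k + cnj \<omega>)
          + of_int (i' * j) * (of_int k + \<omega>) + of_int (j * j' * c)"
      have "x * y = of_int m * of_int m * (of_int a * (of_int (i * i' * a)
          + of_int (i * j') * (of_int k + cnj \<omega>) + of_int (i' * j) * (of_int k + \<omega>))
          + of_int (j * j') * ((of_int k + \<omega>) * (of_int k + cnj \<omega>)))"
        unfolding x y by (simp add: algebra_simps)
      also have "\<dots> = N * w" unfolding kw N_def w_def by (simp add: algebra_simps)
      finally have "x * y = N * w" .
      moreover have "w \<in> OK D" unfolding w_def
        by (intro addsub_add[OF addsub_OK] mult_in_OK of_int_in_OK omega_in_OK cnj_in_OK)
      ultimately show "x * y \<in> (*) N ` OK D" by blast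
    qed
    have "(2 * k + D)\<^sup>2 - 4 * a * c = D"
    proof -
      have "(2 * k + D)\<^sup>2 - 4 * (a * c) = D\<^sup>2 - 4 * E"
        unfolding c by (simp add: power2_eq_square algebra_simps)
      then show ?thesis using E_eq by (simp add: mult.assoc)
    qed
    then obtain u v w where uvw: "u * a + v * (2 * k + D) + w * c = 1"
      by (meson gcd3_eq_1_bezout primitive_of_fund_disc[OF fund])
    define g where "g = of_int m * (of_int k + \<omega>)"
    have g: "g \<in> I" unfolding Ieq g_def by (rule CollectI, rule exI[of _ 0], rule exI[of _ 1]) simp
    have ma_in: "of_int m * of_int a \<in> I"
      unfolding Ieq by (rule CollectI, rule exI[of _ 1], rule exI[of _ 0]) simp
    then have ma_in': "of_int m * of_int a \<in> cnj ` I" by (force simp: image_iff)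
    have gc: "cnj g \<in> cnj ` I" using g by blast
    \<comment> \<open>The Bezout combination multiplied by N = m^2 a, written in products available
      in I times its conjugate.\<close>
    have "of_int u * ((of_int m * of_int a) * (of_int m * of_int a))
        + of_int v * ((of_int m * of_int a) * cnj g + g * (of_int m * of_int a))
        + of_int w * (g * cnj g) \<in> setmul I (cnj ` I)" (is "?z \<in> _")
      by (intro addsub_add[OF addsub_setmul] addsub_of_int[OF addsub_setmul] setmul_mem g gc ma_in ma_in')
    also have "?z = of_int u * (of_int a * N) + of_int v * (N * (2 * of_int k + (\<omega> + cnj \<omega>)))
       + of_int w * (of_int m * of_int m * ((of_int k + \<omega>) * (of_int k + cnj \<omega>)))"
      unfolding g_def N_def by (simp add: algebra_simps)
    also have "\<dots> = N * of_int (u * a + v * (2 * k + D) + w * c)"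
      unfolding kw by (simp add: cnj_omega N_def algebra_simps)
    finally have "N \<in> setmul I (cnj ` I)" unfolding uvw by simp
    then show "pid D (of_nat (ideal_norm D I)) \<subseteq> setmul I (cnj ` I)"
      using cI unfolding N pid_def ok_module_def by (auto simp: mult.commute)
  qed
qed

lemma int_ideal_inv_module:
  assumes "int_ideal D I" shows "inv_module D I"
proof (rule inv_moduleI)
  show "ok_module D I" using assms by (simp add: int_ideal_iff)
  show "setmul I ((*) (1 / of_nat (ideal_norm D I)) ` cnj ` I) = OK D"
    using int_ideal_mult_cnj[OF assms]
    by (simp only: setmul_scale_right pid_eq) (simp add: image_image)
qed

end

section \<open>Lattices with complex multiplication\<close>

lemma quadratic_proportional:
  fixes a b c a' b' c' :: int
  assumes "Im z \<noteq> 0"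
    and 1: "of_int a * z\<^sup>2 + of_int b * z + of_int c = 0"
    and 2: "of_int a' * z\<^sup>2 + of_int b' * z + of_int c' = 0"
  shows "a * b' = a' * b" "a * c' = a' * c"
proof -
  have "of_int (a * b' - a' * b) * z + of_int (a * c' - a' * c)
      = of_int a * (of_int a' * z\<^sup>2 + of_int b' * z + of_int c')
        - of_int a' * (of_int a * z\<^sup>2 + of_int b * z + of_int c)"
    by (simp add: algebra_simps)
  then have *: "of_int (a * b' - a' * b) * z + of_int (a * c' - a' * c) = 0"
    unfolding 1 2 by simp
  have "of_int (a * b' - a' * b) * Im z = 0" using arg_cong[OF *, of Im] by simp
  then have h: "a * b' - a' * b = 0" using assms(1) by (metis mult_eq_0_iff of_int_eq_0_iff)
  then show "a * b' = a' * b" by simp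
  show "a * c' = a' * c" using * unfolding h by (metis add_0 eq_iff_diff_eq_0 mult_zero_left of_int_0 of_int_eq_0_iff)
qed

lemma primitive_dvd:
  fixes a b c n b' c' :: int
  assumes "gcd a (gcd b c) = 1" "a * b' = n * b" "a * c' = n * c"
  shows "a dvd n"
proof -
  obtain u v w where uvw: "u * a + v * b + w * c = 1" using gcd3_eq_1_bezout[OF assms(1)] .
  have "n = n * (u * a + v * b + w * c)" by (simp add: uvw)
  also have "\<dots> = n * u * a + v * (n * b) + w * (n * c)" by (simp add: algebra_simps)
  also have "\<dots> = a * (n * u + v * b' + w * c')"
    unfolding assms(2,3)[symmetric] by (simp add: algebra_simps)
  finally show ?thesis by (metis dvd_triv_left)
qed

text \<open>Discharges the definite description: two integer equations for a non-real z have
  proportional coefficients, primitivity makes the leading coefficients divide each other, and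
  positivity fixes the sign.\<close>

lemma qcoef_eqI:
  assumes "Im z \<noteq> 0" "gcd a (gcd b c) = 1" "a > 0"
    "of_int a * z\<^sup>2 + of_int b * z + of_int c = 0"
  shows "qcoef z = (a, b, c)"
  unfolding qcoef_def
proof (rule the_equality)
  show "case (a, b, c) of (a, b, c) \<Rightarrow> gcd a (gcd b c) = 1 \<and> a > 0 \<and>
      of_int a * z\<^sup>2 + of_int b * z + of_int c = 0"
    using assms by simp
  fix t :: "int \<times> int \<times> int"
  assume t: "case t of (a, b, c) \<Rightarrow> gcd a (gcd b c) = 1 \<and> a > 0 \<and>
      of_int a * z\<^sup>2 + of_int b * z + of_int c = 0"
  obtain a' b' c' where t_eq: "t = (a', b', c')" by (metis prod_cases3)
  have h: "gcd a' (gcd b' c') = 1" "a' > 0" "of_int a' * z\<^sup>2 + of_int b' * z + of_int c' = 0"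
    using t unfolding t_eq by auto
  note p = quadratic_proportional[OF assms(1,4) h(3)]
  have "a dvd a'" by (rule primitive_dvd[OF assms(2) p])
  moreover have "a' dvd a" using primitive_dvd[OF h(1), of b a c] p by simp
  ultimately have "a = a'" using assms(3) h(2) by (simp add: zdvd_antisym_nonneg)
  then show "t = (a, b, c)" using p assms(3) t_eq by simp
qed

context imag_quad_field
begin

text \<open>The action of \<omega> on the basis 1, z yields an integer equation for z with leading
  coefficient n and content g. Since a z is a multiplier too, it lies in O_K, and comparing
  imaginary parts leaves g = 1. So a z has the imaginary part of \<omega>, and the primitive
  equation has discriminant D.\<close>

lemma CM_coeffs:
  assumes z: "Im z > 0" and ring: "mult_ring (lat z) = OK D"
  obtains a b c :: int where "qcoef z = (a, b, c)" "a > 0" "gcd a (gcd b c) = 1"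
    "of_int a * z\<^sup>2 + of_int b * z + of_int c = 0"
    "2 * of_int a * z + of_int b = sqrtD D" "b\<^sup>2 - 4 * a * c = D"
proof -
  have "\<omega> * 1 \<in> lat z" "\<omega> * z \<in> lat z"
    using omega_in_OK lat_mem[of 1 0 z] lat_mem[of 0 1 z]
    unfolding ring[symmetric] mult_ring_def by auto
  then obtain m n s t where om: "\<omega> = of_int m + of_int n * z"
    and omz: "\<omega> * z = of_int s + of_int t * z"
    by (auto elim!: latE)
  have Imw: "Im \<omega> = of_int n * Im z" using arg_cong[OF om, of Im] by simp
  then have n: "n > 0" using Im_omega_pos z by (metis of_int_0_less_iff zero_less_mult_pos2)
  have eq1: "of_int n * z\<^sup>2 + of_int (m - t) * z + of_int (- s) = 0"
    using omz unfolding om by (simp add: power2_eq_square algebra_simps)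
  define g where "g = gcd n (gcd (m - t) (- s))"
  have g: "g > 0" unfolding g_def using n by auto
  have "g dvd n" "g dvd m - t" "g dvd - s"
    unfolding g_def by (auto intro: dvd_trans[OF gcd_dvd2])
  then obtain a b c where abc: "n = g * a" "m - t = g * b" "- s = g * c" by (elim dvdE)
  have a: "a > 0" using n g abc(1) by (simp add: zero_less_mult_iff)
  have "g = gcd (g * a) (gcd (g * b) (g * c))" unfolding abc[symmetric] by (rule g_def)
  also have "\<dots> = g * gcd a (gcd b c)"
    using g by (simp only: gcd_mult_distrib_int[symmetric]) (simp flip: gcd_mult_distrib_int)
  finally have "g = g * gcd a (gcd b c)" .
  then have gcd: "gcd a (gcd b c) = 1" using g by simp
  have "of_int g * (of_int a * z\<^sup>2 + of_int b * z + of_int c) = 0"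
    using eq1 unfolding abc by (simp add: algebra_simps)
  then have quad: "of_int a * z\<^sup>2 + of_int b * z + of_int c = 0" using g by simp
  have "of_int a * z \<in> mult_ring (lat z)"
    unfolding mult_ring_def
  proof (intro CollectI ballI)
    fix x assume "x \<in> lat z"
    then obtain i j where x: "x = of_int i + of_int j * z" by (rule latE)
    have "of_int a * z * x = of_int i * of_int a * z + of_int j * (of_int a * z\<^sup>2)"
      unfolding x by (simp add: power2_eq_square algebra_simps)
    also have "of_int a * z\<^sup>2 = - of_int b * z - of_int c"
      using quad by (simp add: add_eq_0_iff2 algebra_simps)
    also have "of_int i * of_int a * z + of_int j * (- of_int b * z - of_int c)
       = of_int (- j * c) + of_int (i * a - j * b) * z" by (simp add: algebra_simps)
    finally show "of_int a * z * x \<in> lat z" using lat_mem by metis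
  qed
  then obtain p q where "of_int a * z = of_int p + of_int q * \<omega>"
    unfolding ring by (rule OKE)
  from arg_cong[OF this, of Im] have "of_int a * Im z = of_int q * Im \<omega>" by simp
  moreover have "Im \<omega> = of_int g * (of_int a * Im z)" unfolding Imw abc(1) by simp
  ultimately have "of_int q * of_int g * Im \<omega> = Im \<omega>" by (metis mult.commute mult.left_commute)
  then have "of_int (q * g) = (1 :: real)" using Im_omega_pos by simp
  then have "q * g = 1" by linarith
  then have "g = 1" using g by (metis abs_of_pos dvd_triv_right zdvd1_eq)
  then have aIm: "2 * of_int a * Im z = sqrt (- of_int D)"
    using Imw abc(1) Im_omega by simp
  have "Im (of_int a * z\<^sup>2 + of_int b * z + of_int c) = Im z * (2 * of_int a * Re z + of_int b)"
    by (simp add: power2_eq_square algebra_simps)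
  then have aRe: "2 * of_int a * Re z + of_int b = 0" using quad z by simp
  have sq: "2 * of_int a * z + of_int b = sqrtD D"
    using aRe aIm unfolding sqrtD_def by (simp add: complex_eq_iff)
  have "of_int D = (2 * of_int a * z + of_int b) * (2 * of_int a * z + of_int b)"
    unfolding sq by (simp add: sqrtD_sq)
  also have "\<dots> = 4 * of_int a * (of_int a * z\<^sup>2 + of_int b * z + of_int c) + of_int (b\<^sup>2 - 4 * a * c)"
    by (simp add: power2_eq_square algebra_simps)
  finally have "(of_int D :: complex) = of_int (b\<^sup>2 - 4 * a * c)" unfolding quad by simp
  then have "b\<^sup>2 - 4 * a * c = D" by (simp only: of_int_eq_iff)
  then show ?thesis using that[OF qcoef_eqI[OF _ gcd a quad] a gcd quad sq] z by simp
qed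

lemma CM_ok_module: "mult_ring (lat z) = OK D \<Longrightarrow> ok_module D (lat z)"
  unfolding ok_module_def using addsub_lat unfolding mult_ring_def by blast

lemma CM_cnj:
  assumes z: "Im z > 0" and ring: "mult_ring (lat z) = OK D" and qc: "qcoef z = (a, b, c)"
  shows "of_int a * cnj z = - of_int b - of_int a * z" "of_int a * (z * cnj z) = of_int c"
proof -
  have quad: "of_int a * z\<^sup>2 + of_int b * z + of_int c = 0"
    and sq: "2 * of_int a * z + of_int b = sqrtD D"
    using CM_coeffs[OF z ring] unfolding qc by auto
  have "2 * of_int a * cnj z + of_int b = - sqrtD D"
    using arg_cong[OF sq, of cnj] by (simp add: cnj_sqrtD)
  then have "2 * (of_int a * cnj z) = 2 * (- of_int b - of_int a * z)"
    unfolding sq[symmetric] by (simp add: algebra_simps) algebra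
  then show acz: "of_int a * cnj z = - of_int b - of_int a * z"
    by (simp only: mult_cancel_left) simp
  have "of_int a * (z * cnj z) = z * (of_int a * cnj z)" by simp
  also have "\<dots> = of_int c"
    unfolding acz using quad by (simp add: power2_eq_square algebra_simps add_eq_0_iff2)
  finally show "of_int a * (z * cnj z) = of_int c" .
qed

text \<open>The lattice has norm 1 / a: after multiplication by a, the products of basis vectors
  with conjugates are a, a z, its conjugate and c. The two middle ones add up to -b, and a, b, c are
  coprime.\<close>

lemma CM_mult_cnj:
  assumes z: "Im z > 0" and ring: "mult_ring (lat z) = OK D" and qc: "qcoef z = (a, b, c)"
  shows "setmul (lat z) (cnj ` lat z) = (*) (1 / of_int a) ` OK D"
proof -
  have a: "a > 0" and gcd: "gcd a (gcd b c) = 1"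
    and sq: "2 * of_int a * z + of_int b = sqrtD D" and disc: "b\<^sup>2 - 4 * a * c = D"
    using CM_coeffs[OF z ring] unfolding qc by auto
  note acz = CM_cnj(1)[OF z ring qc] and azz = CM_cnj(2)[OF z ring qc]
  have az: "of_int a * z \<in> OK D"
  proof -
    \<comment> \<open>Parity of D + b makes \<omega> - a z = (D + b) / 2 an integer.\<close>
    have "even (b\<^sup>2 - 4 * a * c + b)" by simp
    then have "even (D + b)" unfolding disc .
    then obtain e where e: "D + b = 2 * e" by blast
    have "2 * \<omega> = of_int (D + b) + 2 * (of_int a * z)"
      unfolding omegaK_def sq[symmetric] by simp
    then have "2 * (of_int a * z) = 2 * (\<omega> - of_int e)" unfolding e by simp
    then have "of_int a * z = \<omega> - of_int e" by (simp only: mult_cancel_left) simp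
    then show ?thesis by (simp add: addsub_diff[OF addsub_OK] omega_in_OK of_int_in_OK)
  qed
  have aczO: "of_int a * cnj z \<in> OK D" using cnj_in_OK[OF az] by simp
  show ?thesis
  proof
    show "setmul (lat z) (cnj ` lat z) \<subseteq> (*) (1 / of_int a) ` OK D"
    proof (rule setmul_least[OF addsub_scale[OF addsub_OK]])
      fix x y assume "x \<in> lat z" "y \<in> cnj ` lat z"
      then obtain i j i' j' where x: "x = of_int i + of_int j * z"
        and y: "y = of_int i' + of_int j' * cnj z"
        by (fastforce elim!: latE)
      have "of_int a * (x * y) = of_int (a * i * i') + of_int (j * i') * (of_int a * z)
          + of_int (i * j') * (of_int a * cnj z) + of_int (j * j') * (of_int a * (z * cnj z))"
        unfolding x y by (simp add: algebra_simps)
      also have "\<dots> \<in> OK D" unfolding azz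
        by (intro addsub_add[OF addsub_OK] mult_in_OK[OF of_int_in_OK] of_int_in_OK az aczO)
      finally have "of_int a * (x * y) \<in> OK D" .
      moreover have "x * y = 1 / of_int a * (of_int a * (x * y))" using a by simp
      ultimately show "x * y \<in> (*) (1 / of_int a) ` OK D" by (rule rev_image_eqI)
    qed
    obtain u v w where uvw: "u * a + v * b + w * c = 1" using gcd3_eq_1_bezout[OF gcd] .
    have in1: "1 \<in> lat z" "1 \<in> cnj ` lat z" and inz: "z \<in> lat z" "cnj z \<in> cnj ` lat z"
      using lat_mem[of 1 0 z] lat_mem[of 0 1 z] by (auto simp: image_iff intro: bexI[of _ 1])
    have "of_int u * (1 * 1) + of_int (- v) * (z * 1 + 1 * cnj z) + of_int w * (z * cnj z)
        \<in> setmul (lat z) (cnj ` lat z)" (is "?y \<in> _")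
      by (intro addsub_add[OF addsub_setmul] addsub_of_int[OF addsub_setmul] setmul_mem in1 inz)
    moreover have "of_int a * ?y = 1"
    proof -
      have "of_int a * ?y = of_int u * of_int a - of_int v * (of_int a * z + of_int a * cnj z)
          + of_int w * (of_int a * (z * cnj z))" by (simp add: algebra_simps)
      also have "\<dots> = of_int (u * a + v * b + w * c)" unfolding azz acz by simp
      finally show ?thesis unfolding uvw by simp
    qed
    ultimately have "1 / of_int a \<in> setmul (lat z) (cnj ` lat z)"
      using a by (metis mult.commute nonzero_eq_divide_eq of_int_eq_0_iff less_irrefl)
    then show "(*) (1 / of_int a) ` OK D \<subseteq> setmul (lat z) (cnj ` lat z)"
      using ok_module_setmul[OF CM_ok_module[OF ring], of "cnj ` lat z"]
      unfolding ok_module_def by (metis (no_types, lifting) image_subsetI mult.commute)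
  qed
qed

lemma CM_inv_module:
  assumes "Im z > 0" "mult_ring (lat z) = OK D"
  shows "inv_module D (lat z)"
proof -
  obtain a b c where qc: "qcoef z = (a, b, c)" and a: "a > 0" using CM_coeffs[OF assms] by metis
  show ?thesis
  proof (rule inv_moduleI)
    show "ok_module D (lat z)" by (rule CM_ok_module[OF assms(2)])
    show "setmul (lat z) ((*) (of_int a) ` cnj ` lat z) = OK D"
      unfolding setmul_scale_right CM_mult_cnj[OF assms qc] using a by (simp add: image_image)
  qed
qed

text \<open>Multiplying the inclusion of l L in L by the inverse of L gives l O_K inside
  O_K.\<close>

lemma mult_ring_inv_module:
  assumes "inv_module D L"
  shows "mult_ring L = OK D"
proof
  show "OK D \<subseteq> mult_ring L"
    using inv_module_ok[OF assms] unfolding ok_module_def mult_ring_def by blast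
  show "mult_ring L \<subseteq> OK D"
  proof
    fix l assume "l \<in> mult_ring L"
    then have "(*) l ` L \<subseteq> L" unfolding mult_ring_def by blast
    then have "setmul ((*) l ` L) (colon D L) \<subseteq> setmul L (colon D L)" by (rule setmul_mono) simp
    then have "(*) l ` OK D \<subseteq> OK D" unfolding setmul_scale inv_module_colon[OF assms] .
    then show "l \<in> OK D" using one_in_OK by force
  qed
qed

section \<open>Ideal classes and the representative lattices\<close>

lemma int_ideal_class:
  assumes I: "int_ideal D I"
  obtains w l where "Im w > 0" "mult_ring (lat w) = OK D" "l \<noteq> 0"
    "setmul I ((*) l ` lat w) = OK D"
proof -
  obtain m a k c :: int where ma: "m > 0" "a > 0"
    and Ieq: "I = {of_int m * (of_int i * of_int a + of_int j * (of_int k + \<omega>)) | i j. True}"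
    by (rule int_ideal_normal_form[OF I])
  \<comment> \<open>The inverse of I is its conjugate divided by the norm, and that conjugate is m a
    (Z + w Z); the minus sign puts w in the upper half plane.\<close>
  define w where "w = - (of_int k + cnj \<omega>) / of_int a"
  have aw: "of_int a * w = - (of_int k + cnj \<omega>)" unfolding w_def using ma by simp
  have Imw: "Im w > 0" unfolding w_def using ma Im_omega_pos by simp
  have cI: "cnj ` I = (*) (of_int (m * a)) ` lat w"
  proof (intro set_eqI iffI)
    fix x assume "x \<in> cnj ` I"
    then obtain i j where "x = cnj (of_int m * (of_int i * of_int a + of_int j * (of_int k + \<omega>)))"
      unfolding Ieq by blast
    then have "x = of_int m * (of_int i * of_int a + of_int j * (of_int k + cnj \<omega>))" by simp
    also have "\<dots> = of_int m * (of_int i * of_int a + of_int (- j) * (of_int a * w))"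
      unfolding aw by (simp add: algebra_simps)
    also have "\<dots> = of_int (m * a) * (of_int i + of_int (- j) * w)" by (simp add: algebra_simps)
    finally show "x \<in> (*) (of_int (m * a)) ` lat w" using lat_mem by blast
  next
    fix x assume "x \<in> (*) (of_int (m * a)) ` lat w"
    then obtain i j where "x = of_int (m * a) * (of_int i + of_int j * w)" by (auto elim!: latE)
    then have "x = of_int m * (of_int i * of_int a + of_int j * (of_int a * w))"
      by (simp add: algebra_simps)
    also have "\<dots> = cnj (of_int m * (of_int i * of_int a + of_int (- j) * (of_int k + \<omega>)))"
      unfolding aw by (simp add: algebra_simps)
    finally show "x \<in> cnj ` I" unfolding Ieq by blast
  qed
  define N where "N = (of_nat (ideal_norm D I) :: complex)"
  have N: "N \<noteq> 0" "setmul I (cnj ` I) = (*) N ` OK D"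
    using int_ideal_mult_cnj[OF I] by (auto simp: N_def pid_eq)
  define l where "l = of_int (m * a) / N"
  have l: "l \<noteq> 0" unfolding l_def using ma N by simp
  have lw: "(*) l ` lat w = (*) (1 / N) ` cnj ` I" unfolding cI by (simp add: image_image l_def)
  have prod: "setmul I ((*) l ` lat w) = OK D"
    unfolding lw setmul_scale_right N(2) using N(1) by (simp add: image_image)
  have "inv_module D (lat w)"
  proof (rule inv_moduleI)
    show "setmul (lat w) ((*) l ` I) = OK D"
      using prod by (simp only: setmul_scale_right setmul_commute)
    have "ok_module D (cnj ` I)"
    proof -
      have "addsub (cnj ` I)" using I by (intro addsub_image) (auto simp: int_ideal_iff ok_module_def)
      moreover have "x * y \<in> cnj ` I" if x: "x \<in> OK D" and y: "y \<in> cnj ` I" for x y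
      proof -
        obtain y' where "y' \<in> I" "y = cnj y'" using y by blast
        then have "cnj x * y' \<in> I" "x * y = cnj (cnj x * y')"
          using I cnj_in_OK[OF x] by (auto simp: int_ideal_def)
        then show ?thesis by blast
      qed
      ultimately show ?thesis unfolding ok_module_def by blast
    qed
    then have "ok_module D ((*) (1 / of_int (m * a)) ` cnj ` I)" by (rule ok_module_scale)
    then show "ok_module D (lat w)" unfolding cI using ma by (simp add: image_image)
  qed
  then show ?thesis using that[OF Imw mult_ring_inv_module l prod] by blast
qed

text \<open>The inverse class of J contains a lattice with basis 1, w, and the list contains one
  homothetic to it; the two scalings combine in \<nu>.\<close>

lemma CM_reps_cover:
  assumes "CM_reps D zs" "int_ideal D J"
  obtains i \<nu> where "i < length zs" "\<nu> \<noteq> 0" "setmul J (lat (zs ! i)) = (*) \<nu> ` OK D"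
proof -
  obtain w l where w: "Im w > 0" "mult_ring (lat w) = OK D" "l \<noteq> 0"
    "setmul J ((*) l ` lat w) = OK D"
    by (rule int_ideal_class[OF assms(2)])
  obtain z where "z \<in> set zs" "homothetic (lat z) (lat w)"
    using assms(1) w unfolding CM_reps_def by blast
  then obtain i l' where i: "i < length zs" and l': "l' \<noteq> 0" "(*) l' ` lat (zs ! i) = lat w"
    unfolding homothetic_def by (metis in_set_conv_nth)
  have "OK D = setmul J ((*) (l * l') ` lat (zs ! i))"
    using w(4) unfolding l'(2)[symmetric] by (simp add: image_image mult.assoc)
  then have "OK D = (*) (l * l') ` setmul J (lat (zs ! i))" by (simp only: setmul_scale_right)
  then have "(*) (1 / (l * l')) ` OK D = setmul J (lat (zs ! i))"
    using w(3) l'(1) by (simp add: image_image)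
  then show ?thesis using that[OF i, of "1 / (l * l')"] w(3) l'(1) by simp
qed

text \<open>Two listed lattices that both invert J up to scaling are multiples of J^{-1}, hence
  homothetic to each other.\<close>

lemma CM_reps_unique:
  assumes "CM_reps D zs" "inv_module D J" "i < length zs" "j < length zs"
    and "\<nu> \<noteq> 0" "setmul J (lat (zs ! i)) = (*) \<nu> ` OK D"
    and "\<mu> \<noteq> 0" "setmul J (lat (zs ! j)) = (*) \<mu> ` OK D"
  shows "i = j"
proof (rule ccontr)
  assume "i \<noteq> j"
  have ok: "ok_module D (lat (zs ! k))" if "k < length zs" for k
    using assms(1) that unfolding CM_reps_def by (simp add: CM_ok_module)
  have "lat (zs ! i) = (*) \<nu> ` colon D J" "lat (zs ! j) = (*) \<mu> ` colon D J"
    using setmul_eq_scaled_OK[OF assms(2) ok] assms by auto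
  then have "(*) (\<mu> / \<nu>) ` lat (zs ! i) = lat (zs ! j)"
    using assms(5) by (simp add: image_image)
  then have "homothetic (lat (zs ! i)) (lat (zs ! j))"
    unfolding homothetic_def using assms(5,7) by (intro exI[of _ "\<mu> / \<nu>"]) simp
  then show False using assms(1,3,4) \<open>i \<noteq> j\<close> unfolding CM_reps_def by blast
qed

section \<open>The Hecke character as a function on a lattice\<close>

lemma colon_ideal:
  assumes B: "inv_module D B" and l: "\<nu> \<in> B" "\<nu> \<noteq> 0"
  shows "int_ideal D ((*) \<nu> ` colon D B)"
    and "setmul B ((*) \<nu> ` colon D B) = (*) \<nu> ` OK D"
proof -
  show prod: "setmul B ((*) \<nu> ` colon D B) = (*) \<nu> ` OK D"
    by (simp add: setmul_scale_right inv_module_colon[OF B])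
  have "(*) \<nu> ` colon D B \<subseteq> OK D"
    using l(1) unfolding colon_def by (auto simp: mult.commute)
  moreover have "(*) \<nu> ` colon D B \<noteq> {0}"
  proof
    assume "(*) \<nu> ` colon D B = {0}"
    then have "(*) \<nu> ` OK D = setmul B {0}" using prod by simp
    also have "\<dots> \<subseteq> {0}" by (rule setmul_least) (auto simp: addsub_def)
    finally have "\<nu> * 1 = 0" using one_in_OK by blast
    then show False using l(2) by simp
  qed
  ultimately show "int_ideal D ((*) \<nu> ` colon D B)"
    unfolding int_ideal_iff by (auto intro: ok_module_scale ok_module_colon)
qed

lemma ideal_coprime_iff:
  assumes "ok_module D I" "I \<subseteq> OK D" "ok_module D J" "J \<subseteq> OK D"
  shows "ideal_coprime D I J \<longleftrightarrow> (\<exists>x\<in>I. 1 - x \<in> J)"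
proof
  assume "ideal_coprime D I J"
  then obtain x y where "x \<in> I" "y \<in> J" "1 = x + y"
    using one_in_OK unfolding ideal_coprime_def by blast
  then show "\<exists>x\<in>I. 1 - x \<in> J" by (metis add_diff_cancel_left')
next
  assume "\<exists>x\<in>I. 1 - x \<in> J"
  then obtain x where x: "x \<in> I" "1 - x \<in> J" by blast
  have "a \<in> {x + y | x y. x \<in> I \<and> y \<in> J}" if "a \<in> OK D" for a
  proof -
    have "a * x \<in> I" "a * (1 - x) \<in> J" using x that assms unfolding ok_module_def by auto
    moreover have "a = a * x + a * (1 - x)" by (simp add: algebra_simps)
    ultimately show ?thesis by blast
  qed
  moreover have "x + y \<in> OK D" if "x \<in> I" "y \<in> J" for x y
    using that assms addsub_add[OF addsub_OK] by blast
  ultimately show "ideal_coprime D I J" unfolding ideal_coprime_def by blast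
qed

lemma hecke_mod_one:
  assumes "hecke_mod D cf \<phi> \<eta>"
  shows "\<eta> 1 = 1"
proof -
  have cf: "ok_module D cf" and ch: "char_mod D cf \<eta>"
    using assms unfolding hecke_mod_def int_ideal_iff by auto
  have "unit_mod D cf 1"
    using one_in_OK addsub_zero cf unfolding unit_mod_def ok_module_def by force
  then have "\<eta> (1 * 1) = \<eta> 1 * \<eta> 1" "\<eta> 1 \<noteq> 0" using ch unfolding char_mod_def by blast+
  then show ?thesis by simp
qed

text \<open>The infinity type forbids the unit modulus: 1 and -1 generate the same ideal, so if they
  were congruent the value of \<phi> there would be both 1 and -1. Hence numbers congruent to 1
  modulo \<open>cf\<close> are nonzero, which makes the later divisions legitimate.\<close>

lemma hecke_mod_proper:
  assumes "hecke_mod D cf \<phi> \<eta>"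
  shows "1 \<notin> cf"
proof
  assume 1: "1 \<in> cf"
  have cf: "ok_module D cf" and ch: "char_mod D cf \<eta>"
    and pr: "\<And>\<alpha>. unit_mod D cf \<alpha> \<Longrightarrow> \<phi> (pid D \<alpha>) = \<alpha> * \<eta> \<alpha>"
    using assms unfolding hecke_mod_def int_ideal_iff by auto
  have all: "x \<in> cf" if "x \<in> OK D" for x
    using cf 1 that unfolding ok_module_def by (metis mult.right_neutral)
  have m1: "- 1 \<in> OK D" using of_int_in_OK[of "-1"] by simp
  have u: "unit_mod D cf 1" "unit_mod D cf (- 1)"
    using all one_in_OK m1 addsub_zero[OF addsub_OK] unfolding unit_mod_def by force+
  have "pid D (- 1) = pid D 1"
    unfolding pid_eq using addsub_minus[OF addsub_OK] by (force simp: image_iff)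
  then have "- 1 * \<eta> (- 1) = 1 * \<eta> 1" using pr[OF u(1)] pr[OF u(2)] by simp
  moreover have "\<eta> (- 1) = \<eta> 1"
  proof -
    have "- 1 - 1 \<in> cf" by (rule all[OF addsub_diff[OF addsub_OK m1 one_in_OK]])
    then show ?thesis using ch u unfolding char_mod_def by blast
  qed
  ultimately show False using hecke_mod_one[OF assms] by simp
qed

text \<open>The Hecke character along \<nu> B^{-1} with its infinity type divided out, so that
  multiplication of \<nu> is seen only by the finite character. Extension by 0 off B, and x / 0 = 0
  at the origin, allow summation over a whole lattice containing B.\<close>

definition psi :: "(complex set \<Rightarrow> complex) \<Rightarrow> complex set \<Rightarrow> complex \<Rightarrow> complex" where
  "psi \<phi> B \<nu> = (if \<nu> \<in> B then \<phi> ((*) \<nu> ` colon D B) / \<nu> else 0)"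

text \<open>Given \<open>\<alpha> \<equiv> 1\<close> modulo the conductor in the ideal \<open>I\<close> attached to \<open>\<nu>\<close>, the integral
  ideal \<open>A = (\<alpha> / \<nu>) B\<close> satisfies \<open>I A = (\<alpha>)\<close> and \<open>I' A = (\<alpha> \<nu>' / \<nu>)\<close>, both with generators
  congruent to 1.\<close>

lemma psi_cong_coprime:
  assumes hecke: "hecke_mod D cf \<phi> \<eta>" and B: "inv_module D B"
    and l: "\<nu> \<in> B" "ideal_coprime D ((*) \<nu> ` colon D B) cf"
    and d: "\<nu>' - \<nu> \<in> setmul cf B"
  shows "psi \<phi> B \<nu>' = psi \<phi> B \<nu>"
proof -
  have cf: "ok_module D cf" "cf \<subseteq> OK D" and ch: "char_mod D cf \<eta>"
    and mult: "\<And>I J. int_ideal D I \<Longrightarrow> int_ideal D J \<Longrightarrow> ideal_coprime D I cf \<Longrightarrow>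
        ideal_coprime D J cf \<Longrightarrow> \<phi> (setmul I J) = \<phi> I * \<phi> J"
    and nz: "\<And>I. int_ideal D I \<Longrightarrow> ideal_coprime D I cf \<Longrightarrow> \<phi> I \<noteq> 0"
    and pr: "\<And>\<alpha>. unit_mod D cf \<alpha> \<Longrightarrow> \<phi> (pid D \<alpha>) = \<alpha> * \<eta> \<alpha>"
    using hecke unfolding hecke_mod_def int_ideal_iff by auto
  note okB = inv_module_ok[OF B]
  let ?M = "colon D B"
  have cfB: "setmul cf B \<subseteq> B" by (rule setmul_subset[OF okB cf(2)])
  have l'B: "\<nu>' \<in> B"
    using addsub_add[OF _ l(1), of "\<nu>' - \<nu>"] d cfB okB unfolding ok_module_def by auto
  \<comment> \<open>Multiplication by B^{-1} carries c_f B to c_f, so replacing \<nu> by \<nu>'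
    changes \<nu> x only by an element of the conductor.\<close>
  have dM: "x * (\<nu>' - \<nu>) \<in> cf" if "x \<in> ?M" for x
  proof -
    have "x * (\<nu>' - \<nu>) \<in> setmul ?M (setmul cf B)" using that d by (rule setmul_mem)
    also have "\<dots> = setmul cf (setmul B ?M)"
      by (metis setmul_assoc setmul_commute)
    also have "\<dots> = cf" using cf(1) by (simp add: inv_module_colon[OF B] setmul_OK setmul_commute[of cf])
    finally show ?thesis .
  qed
  have sub: "(*) x ` ?M \<subseteq> OK D" if "x \<in> B" for x
    using that unfolding colon_def by (auto simp: mult.commute)
  note okM = ok_module_scale[OF ok_module_colon]
  obtain \<alpha> where \<alpha>: "\<alpha> \<in> (*) \<nu> ` ?M" "1 - \<alpha> \<in> cf"
    using l(2) unfolding ideal_coprime_iff[OF okM sub[OF l(1)] cf] by blast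
  obtain x where x: "x \<in> ?M" "\<alpha> = \<nu> * x" using \<alpha>(1) by blast
  have a0: "\<alpha> \<noteq> 0" using \<alpha>(2) hecke_mod_proper[OF hecke] by auto
  then have l0: "\<nu> \<noteq> 0" using x by auto
  have \<gamma>: "1 - \<nu>' * x \<in> cf"
  proof -
    have "1 - \<nu>' * x = (1 - \<alpha>) - x * (\<nu>' - \<nu>)" unfolding x(2) by (simp add: algebra_simps)
    then show ?thesis using addsub_diff[OF _ \<alpha>(2) dM[OF x(1)]] cf(1) unfolding ok_module_def by metis
  qed
  then have l'0: "\<nu>' \<noteq> 0" using hecke_mod_proper[OF hecke] by auto
  have l'cop: "ideal_coprime D ((*) \<nu>' ` ?M) cf"
    unfolding ideal_coprime_iff[OF okM sub[OF l'B] cf] using \<gamma> x(1) by blast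
  have x0: "x \<noteq> 0" using a0 x(2) by auto
  define A where "A = (*) x ` B"
  have A: "int_ideal D A"
  proof -
    have "A \<subseteq> OK D" using x(1) unfolding A_def colon_def by auto
    moreover have "x * \<nu> \<in> A" "x * \<nu> \<noteq> 0" unfolding A_def using l(1) x0 l0 by auto
    ultimately show ?thesis
      unfolding int_ideal_iff using ok_module_scale[OF okB, of x] unfolding A_def by blast
  qed
  have okA: "ok_module D A" "A \<subseteq> OK D" using A unfolding int_ideal_iff by auto
  have Acop: "ideal_coprime D A cf"
    unfolding ideal_coprime_iff[OF okA cf] using \<alpha>(2) l(1) x(2) unfolding A_def
    by (metis image_eqI mult.commute)
  \<comment> \<open>The finite character is trivial on m x for each such m; after division by m the
    value is x / \<phi>(A), which no longer depends on m.\<close>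
  have key: "\<phi> ((*) m ` ?M) * \<phi> A = m * x"
    if m: "m \<in> B" "m \<noteq> 0" "ideal_coprime D ((*) m ` ?M) cf" "1 - m * x \<in> cf" for m
  proof -
    have "setmul ((*) m ` ?M) A = pid D (m * x)"
      unfolding A_def setmul_scale setmul_scale_right setmul_commute[of ?M] inv_module_colon[OF B]
      by (simp add: pid_eq image_image mult.assoc mult.left_commute[of x])
    moreover have "m * x \<in> OK D" using x(1) m(1) unfolding colon_def by (auto simp: mult.commute)
    moreover have "m * x - 1 \<in> cf"
      using m(4) addsub_minus[of cf "1 - m * x"] cf(1) unfolding ok_module_def by simp
    ultimately have u: "unit_mod D cf (m * x)"
      unfolding unit_mod_def using one_in_OK by (auto intro!: bexI[of _ 1])
    have u1: "unit_mod D cf 1"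
      using one_in_OK addsub_zero cf unfolding unit_mod_def ok_module_def by force
    have "\<eta> (m * x) = \<eta> 1"
      using ch u u1 \<open>m * x - 1 \<in> cf\<close> unfolding char_mod_def by blast
    then have "\<phi> (pid D (m * x)) = m * x"
      using pr[OF u] hecke_mod_one[OF hecke] by simp
    then show ?thesis
      using mult[OF colon_ideal(1)[OF B m(1,2)] A m(3) Acop] \<open>setmul ((*) m ` ?M) A = _\<close> by simp
  qed
  have 1: "\<phi> ((*) \<nu> ` ?M) * \<phi> A = \<nu> * x" using key l l0 \<alpha>(2) x(2) by simp
  have 2: "\<phi> ((*) \<nu>' ` ?M) * \<phi> A = \<nu>' * x" using key l'B l'0 l'cop \<gamma> by simp
  have "\<phi> ((*) \<nu>' ` ?M) / \<nu>' = x / \<phi> A" "\<phi> ((*) \<nu> ` ?M) / \<nu> = x / \<phi> A"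
    using 1 2 nz[OF A Acop] l0 l'0 by (simp_all add: field_simps)
  then show ?thesis unfolding psi_def using l(1) l'B by simp
qed

lemma psi_zero: "psi \<phi> B 0 = 0"
  unfolding psi_def by simp

text \<open>If one of the two ideals is prime to the conductor, the coprime case applied from that
  side gives equality; if neither is, both values are 0.\<close>

lemma psi_cong:
  assumes hecke: "hecke_mod D cf \<phi> \<eta>" and B: "inv_module D B"
    and d: "\<nu>' - \<nu> \<in> setmul cf B"
  shows "psi \<phi> B \<nu>' = psi \<phi> B \<nu>"
proof -
  have d': "\<nu> - \<nu>' \<in> setmul cf B" using addsub_minus[OF addsub_setmul d] by simp
  have nc: "psi \<phi> B \<mu> = 0" if "\<not> (\<mu> \<in> B \<and> ideal_coprime D ((*) \<mu> ` colon D B) cf)" for \<mu>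
    using that hecke colon_ideal(1)[OF B, of \<mu>] unfolding psi_def hecke_mod_def
    by (cases "\<mu> = 0") auto
  show ?thesis
    using nc[of \<nu>] nc[of \<nu>'] psi_cong_coprime[OF hecke B _ _ d] psi_cong_coprime[OF hecke B _ _ d']
    by metis
qed

text \<open>Passing from \<nu> to g \<nu> multiplies the ideal by (g), hence \<phi> by g \<eta>(g),
  and the factor g cancels against the denominator. If \<nu> B^{-1} is not prime to the conductor,
  neither is the smaller ideal g \<nu> B^{-1}, and both sides vanish.\<close>

lemma psi_mult:
  assumes hecke: "hecke_mod D cf \<phi> \<eta>" and B: "inv_module D B"
    and l: "\<nu> \<in> B" and g: "unit_mod D cf g"
  shows "psi \<phi> B (g * \<nu>) = \<eta> g * psi \<phi> B \<nu>"
proof (cases "\<nu> = 0")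
  case False
  have cf: "ok_module D cf" "cf \<subseteq> OK D"
    and mult: "\<And>I J. int_ideal D I \<Longrightarrow> int_ideal D J \<Longrightarrow> ideal_coprime D I cf \<Longrightarrow>
        ideal_coprime D J cf \<Longrightarrow> \<phi> (setmul I J) = \<phi> I * \<phi> J"
    and z: "\<And>I. int_ideal D I \<Longrightarrow> \<not> ideal_coprime D I cf \<Longrightarrow> \<phi> I = 0"
    and pr: "\<And>\<alpha>. unit_mod D cf \<alpha> \<Longrightarrow> \<phi> (pid D \<alpha>) = \<alpha> * \<eta> \<alpha>"
    using hecke unfolding hecke_mod_def int_ideal_iff by auto
  let ?M = "colon D B"
  obtain h where gO: "g \<in> OK D" and h: "h \<in> OK D" "g * h - 1 \<in> cf"
    using g unfolding unit_mod_def by blast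
  then have gh: "1 - g * h \<in> cf"
    using addsub_minus[of cf "g * h - 1"] cf(1) unfolding ok_module_def by simp
  then have g0: "g \<noteq> 0" using hecke_mod_proper[OF hecke] by auto
  have glB: "g * \<nu> \<in> B" using gO l inv_module_ok[OF B] unfolding ok_module_def by blast
  note I = colon_ideal(1)[OF B l False]
  have I': "int_ideal D ((*) (g * \<nu>) ` ?M)" using colon_ideal(1)[OF B glB] g0 False by simp
  have P: "int_ideal D (pid D g)"
    unfolding int_ideal_iff pid_eq
    using ok_module_scale[OF ok_module_OK, of g] gO g0 one_in_OK mult_in_OK[OF gO] by force
  have eq: "(*) (g * \<nu>) ` ?M = setmul (pid D g) ((*) \<nu> ` ?M)"
    unfolding setmul_pid[OF ok_module_scale[OF ok_module_colon]] by (simp add: image_image mult.assoc)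
  have Ii: "ok_module D ((*) \<nu> ` ?M)" "(*) \<nu> ` ?M \<subseteq> OK D"
    "ok_module D ((*) (g * \<nu>) ` ?M)" "(*) (g * \<nu>) ` ?M \<subseteq> OK D"
    "ok_module D (pid D g)" "pid D g \<subseteq> OK D"
    using I I' P unfolding int_ideal_iff by auto
  show ?thesis
  proof (cases "ideal_coprime D ((*) \<nu> ` ?M) cf")
    case True
    have "g * h \<in> pid D g" using h unfolding pid_def by blast
    then have "ideal_coprime D (pid D g) cf"
      unfolding ideal_coprime_iff[OF Ii(5,6) cf] using gh by blast
    then have "\<phi> ((*) (g * \<nu>) ` ?M) = g * \<eta> g * \<phi> ((*) \<nu> ` ?M)"
      unfolding eq using mult[OF P I _ True] pr[OF g] by simp
    then show ?thesis unfolding psi_def using l glB g0 by simp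
  next
    case nc: False
    have "(*) (g * \<nu>) ` ?M \<subseteq> (*) \<nu> ` ?M"
      unfolding eq using setmul_subset[OF Ii(1,6)] .
    then have "\<not> ideal_coprime D ((*) (g * \<nu>) ` ?M) cf"
      using nc unfolding ideal_coprime_iff[OF Ii(1,2) cf] ideal_coprime_iff[OF Ii(3,4) cf] by blast
    then show ?thesis unfolding psi_def using z[OF I nc] z[OF I'] by simp
  qed
qed (simp add: psi_zero)

end

section \<open>Convergence of the lattice sums\<close>

lemma summable_exp_neg_abs_int:
  fixes d :: real
  assumes "d > 0"
  shows "(\<lambda>m::int. exp (- d * \<bar>of_int m\<bar>)) summable_on UNIV"
proof -
  have "(\<lambda>n::nat. exp (- d * real n)) summable_on UNIV"
  proof (rule norm_summable_imp_summable_on)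
    have "summable (\<lambda>n. exp (- d) ^ n)" using assms by (intro summable_geometric) simp
    then show "summable (\<lambda>n. norm (exp (- d * real n)))"
      by (simp add: exp_of_nat_mult[symmetric] mult.commute)
  qed
  then have "(\<lambda>m::int. exp (- d * \<bar>of_int m\<bar>)) summable_on range int"
    "(\<lambda>m::int. exp (- d * \<bar>of_int m\<bar>)) summable_on range (\<lambda>n. - int n)"
    by (subst summable_on_reindex, auto simp: inj_def o_def)+
  then have "(\<lambda>m::int. exp (- d * \<bar>of_int m\<bar>)) summable_on (range int \<union> range (\<lambda>n. - int n))"
    by (rule summable_on_union)
  moreover have "range int \<union> range (\<lambda>n. - int n) = UNIV"
    by (auto simp: image_iff) (metis int_cases2)
  ultimately show ?thesis by simp
qed

lemma lattice_norm_bound: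
  assumes "Im z > 0"
  obtains d where "d > 0" "\<And>m n. d * (\<bar>of_int m\<bar> + \<bar>of_int n\<bar>) \<le> cmod (of_int m + of_int n * z)"
proof -
  \<comment> \<open>With l = m + n z, the constant comes from |n| Im z \<le> |l| and |m| \<le> |l| +
    |n| |z|.\<close>
  define K where "K = 1 + (1 + cmod z) / Im z"
  have K: "K > 0" unfolding K_def using assms by (simp add: add_pos_nonneg)
  have "\<bar>of_int m\<bar> + \<bar>of_int n\<bar> \<le> K * cmod (of_int m + of_int n * z)" for m n :: int
  proof -
    let ?l = "of_int m + of_int n * z"
    have "\<bar>Im ?l\<bar> \<le> cmod ?l" by (rule abs_Im_le_cmod)
    then have "\<bar>of_int n\<bar> * Im z \<le> cmod ?l" using assms by (simp add: abs_mult)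
    then have n: "\<bar>of_int n\<bar> \<le> cmod ?l / Im z" using assms by (simp add: field_simps)
    have "\<bar>of_int m\<bar> = cmod (?l - of_int n * z)" by simp
    also have "\<dots> \<le> cmod ?l + cmod (of_int n * z)" by (rule norm_triangle_ineq4)
    also have "\<dots> = cmod ?l + \<bar>of_int n\<bar> * cmod z" by (simp add: norm_mult)
    finally have "\<bar>of_int m\<bar> + \<bar>of_int n\<bar> \<le> cmod ?l + \<bar>of_int n\<bar> * (1 + cmod z)"
      by (simp add: algebra_simps)
    also have "\<dots> \<le> cmod ?l + (cmod ?l / Im z) * (1 + cmod z)"
      using n by (intro add_left_mono mult_right_mono) auto
    also have "\<dots> = K * cmod ?l" unfolding K_def by (simp add: field_simps)
    finally show ?thesis .
  qed
  then have "1 / K * (\<bar>of_int m\<bar> + \<bar>of_int n\<bar>) \<le> cmod (of_int m + of_int n * z)" for m n :: int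
    using K by (simp add: field_simps)
  then show ?thesis using that[of "1 / K"] K by auto
qed

lemma inj_lat_coords:
  assumes "Im z > 0"
  shows "inj (\<lambda>(m, n). complex_of_int m + complex_of_int n * z)"
proof (rule injI, clarify)
  fix m n m' n'
  assume e: "complex_of_int m + complex_of_int n * z = complex_of_int m' + complex_of_int n' * z"
  from arg_cong[OF e, of Im] have "n = n'" using assms by simp
  then show "m = m' \<and> n = n'" using e by simp
qed

lemma lat_eq_range: "lat z = range (\<lambda>(m, n). complex_of_int m + complex_of_int n * z)"
  unfolding lat_def by auto

text \<open>Write x = |\<nu>|. From x \<le> exp x and the completed square 2 x - c x^2 \<le> 1 / c,
  the term is at most exp (1 / c) exp (-x). The lower bound for x then dominates exp (-x) by a
  product of two one-variable geometric terms.\<close>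

lemma summable_gaussian_lat:
  assumes z: "Im z > 0" and c: "c > 0"
  shows "(\<lambda>\<nu>. cmod \<nu> * exp (- c * (cmod \<nu>)\<^sup>2)) summable_on lat z"
proof -
  obtain d where d: "d > 0" "\<And>m n. d * (\<bar>of_int m\<bar> + \<bar>of_int n\<bar>) \<le> cmod (of_int m + of_int n * z)"
    using lattice_norm_bound[OF z] by blast
  define h where "h = (\<lambda>(m, n). complex_of_int m + complex_of_int n * z)"
  define g where "g = (\<lambda>m::int. exp (- d * \<bar>of_int m\<bar>) :: real)"
  have g: "g summable_on UNIV" unfolding g_def by (rule summable_exp_neg_abs_int[OF d(1)])
  have "(\<lambda>(m, n). g m * g n) summable_on UNIV \<times> UNIV"
  proof (rule summable_on_SigmaI)
    show "((\<lambda>n. case (m, n) of (m, n) \<Rightarrow> g m * g n) has_sum g m * infsum g UNIV) UNIV" for m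
      using has_sum_cmult_right[OF has_sum_infsum[OF g]] by simp
    show "(\<lambda>m. g m * infsum g UNIV) summable_on UNIV" by (rule summable_on_cmult_left[OF g])
  qed (auto simp: g_def)
  then have "(\<lambda>u. exp (1 / c) * (case u of (m, n) \<Rightarrow> g m * g n)) summable_on UNIV"
    by (intro summable_on_cmult_right) simp
  then have "(\<lambda>u. cmod (h u) * exp (- c * (cmod (h u))\<^sup>2)) summable_on UNIV"
  proof (rule summable_on_comparison_test)
    fix u :: "int \<times> int"
    obtain m n where u: "u = (m, n)" by fastforce
    define x where "x = cmod (h u)"
    have x: "d * (\<bar>of_int m\<bar> + \<bar>of_int n\<bar>) \<le> x" unfolding x_def h_def u using d(2) by simp
    have sq: "2 * x - c * x\<^sup>2 \<le> 1 / c"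
    proof -
      have "0 \<le> (c * x - 1)\<^sup>2" by simp
      then have "c * (2 * x - c * x\<^sup>2) \<le> 1" by (simp add: power2_eq_square algebra_simps)
      then show ?thesis using c by (simp add: field_simps)
    qed
    have "x \<le> exp x" using exp_ge_add_one_self[of x] by linarith
    then have "x * exp (- c * x\<^sup>2) \<le> exp x * exp (- c * x\<^sup>2)" by (rule mult_right_mono) simp
    also have "\<dots> \<le> exp (1 / c + - x)" using sq by (simp flip: exp_add)
    also have "\<dots> \<le> exp (1 / c + (- d * \<bar>of_int m\<bar> + - d * \<bar>of_int n\<bar>))"
      using x by (simp add: algebra_simps)
    also have "\<dots> = exp (1 / c) * (case u of (m, n) \<Rightarrow> g m * g n)"
      unfolding u g_def by (simp only: exp_add prod.case)
    finally show "cmod (h u) * exp (- c * (cmod (h u))\<^sup>2)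
        \<le> exp (1 / c) * (case u of (m, n) \<Rightarrow> g m * g n)" unfolding x_def .
  qed simp
  then show ?thesis
    unfolding lat_eq_range summable_on_reindex[OF inj_lat_coords[OF z]] h_def by (simp add: o_def)
qed

text \<open>The term shared by the theta series and by \<open>fa\<close>. The exponent uses
  \<open>\<nu> * cnj \<nu>\<close> instead of a real norm, so that identities for ideal norms and
  for the Gram form rewrite it directly.\<close>

definition gterm :: "int \<Rightarrow> complex \<Rightarrow> complex \<Rightarrow> complex" where
  "gterm a \<tau> \<nu> = \<nu> * exp (2 * pi * \<i> * \<tau> * (of_int a * (\<nu> * cnj \<nu>)))"

lemma summable_gterm_lat:
  assumes "Im z > 0" "a > 0" "Im \<tau> > 0" and P: "\<And>\<nu>. \<nu> \<in> lat z \<Longrightarrow> cmod (P \<nu>) \<le> K"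
  shows "(\<lambda>\<nu>. P \<nu> * gterm a \<tau> \<nu>) summable_on lat z"
proof (rule abs_summable_summable, rule Infinite_Sum.abs_summable_on_comparison_test')
  define c where "c = 2 * pi * of_int a * Im \<tau>"
  have "c > 0" unfolding c_def using assms by simp
  from summable_gaussian_lat[OF assms(1) this]
  show "(\<lambda>\<nu>. K * (cmod \<nu> * exp (- c * (cmod \<nu>)\<^sup>2))) summable_on lat z"
    by (rule summable_on_cmult_right)
  fix \<nu> assume "\<nu> \<in> lat z"
  have "cmod (gterm a \<tau> \<nu>) = cmod \<nu> * exp (- c * (cmod \<nu>)\<^sup>2)"
    unfolding gterm_def complex_norm_square[symmetric] c_def
    by (simp add: norm_mult norm_exp_eq_Re)
  then show "cmod (P \<nu> * gterm a \<tau> \<nu>) \<le> K * (cmod \<nu> * exp (- c * (cmod \<nu>)\<^sup>2))"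
    using P[OF \<open>\<nu> \<in> lat z\<close>] by (simp add: norm_mult mult_right_mono)
qed

section \<open>The discriminant form\<close>

lemma of_rat_complex: "(of_rat t :: complex) = complex_of_real (of_rat t)"
  by (cases t) (simp add: of_rat_rat)

locale CM_lattice = imag_quad_field +
  fixes f :: int and z :: complex and a b c :: int
  assumes f_pos: "f > 0" and z: "Im z > 0" and ring: "mult_ring (lat z) = OK D"
    and qc: "qcoef z = (a, b, c)"
begin

lemma a_pos: "a > 0"
  and quad: "of_int a * z\<^sup>2 + of_int b * z + of_int c = 0"
  and sq: "2 * of_int a * z + of_int b = sqrtD D" and disc: "b\<^sup>2 - 4 * a * c = D"
  using CM_coeffs[OF z ring] unfolding qc by auto

lemma z_sqrtD: "z * sqrtD D = - of_int b * z - 2 * of_int c"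
proof -
  have "z * sqrtD D = 2 * (of_int a * z\<^sup>2 + of_int b * z + of_int c) - of_int b * z - 2 * of_int c"
    unfolding sq[symmetric] by (simp add: power2_eq_square algebra_simps)
  then show ?thesis unfolding quad by simp
qed

lemmas a_cnj_z = CM_cnj(1)[OF z ring qc] and a_z_cnj_z = CM_cnj(2)[OF z ring qc]

text \<open>The closed form of \<open>Omega\<close>: i sqrt |G| equals f sqrt D once |G| = f^2 |D|,
  and the roots of 2 a f cancel. It is introduced separately because the order of G is itself
  computed by transporting cosets along this map.\<close>

definition om :: "rat \<times> rat \<Rightarrow> complex" where
  "om v = of_int f * sqrtD D * (of_rat (fst v) - of_rat (snd v) * z)"

abbreviation cL :: "complex set" where "cL \<equiv> setmul (cund D f) (lat z)"

lemma om_eq: "om (x, y) = of_rat (of_int f * (of_int b * x + 2 * of_int c * y))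
    + of_rat (of_int f * (2 * of_int a * x + of_int b * y)) * z"
proof -
  have "om (x, y) = of_int f * (of_rat x * sqrtD D - of_rat y * (z * sqrtD D))"
    unfolding om_def by (simp add: algebra_simps)
  also have "\<dots> = of_int f * (of_rat x * (2 * of_int a * z + of_int b)
      + of_rat y * (of_int b * z + 2 * of_int c))"
    unfolding z_sqrtD sq by (simp add: algebra_simps)
  finally show ?thesis by (simp add: of_rat_add of_rat_mult algebra_simps)
qed

lemma of_rat_coords_eq:
  assumes "of_rat x + of_rat y * z = of_rat x' + of_rat y' * z"
  shows "x = x' \<and> y = y'"
proof -
  have "of_rat y * Im z = of_rat y' * Im z"
    using arg_cong[OF assms, of Im] unfolding of_rat_complex by simp
  then have "y = y'" using z by simp
  then show ?thesis using assms by simp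
qed

lemma inj_om: "inj om"
proof (rule injI)
  fix v w :: "rat \<times> rat" assume "om v = om w"
  then have "of_rat (fst v) - of_rat (snd v) * z = of_rat (fst w) - of_rat (snd w) * z"
    unfolding om_def using f_pos sqrtD_nonzero by simp
  then have "of_rat (fst v) + of_rat (- snd v) * z = of_rat (fst w) + of_rat (- snd w) * z"
    by (simp add: of_rat_minus)
  then show "v = w" by (metis of_rat_coords_eq neg_equal_iff_equal prod_eq_iff)
qed

lemma om_add: "om (fst v + fst w, snd v + snd w) = om v + om w"
  unfolding om_def by (simp add: of_rat_add algebra_simps)

text \<open>The coordinates of \<open>om v\<close> in the basis 1, z are the pairings of v with e_1
  and e_2, so their integrality is duality.\<close>

lemma Lam_dual_iff: "v \<in> Lam_dual f z \<longleftrightarrow> om v \<in> lat z"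
proof -
  obtain x y where v: "v = (x, y)" by fastforce
  define s t where "s = of_int f * (2 * of_int a * x + of_int b * y)"
    and "t = of_int f * (of_int b * x + 2 * of_int c * y)"
  have gr: "gram f z v (of_int m, of_int n) = of_int m * s + of_int n * t" for m n
    unfolding gram_def qc v s_def t_def by (simp add: algebra_simps)
  have "v \<in> Lam_dual f z \<longleftrightarrow> s \<in> \<int> \<and> t \<in> \<int>"
  proof
    assume "v \<in> Lam_dual f z"
    then have "gram f z v (of_int m, of_int n) \<in> \<int>" for m n
      unfolding Lam_dual_def Lam_def by blast
    from this[of 1 0] this[of 0 1] show "s \<in> \<int> \<and> t \<in> \<int>" unfolding gr by simp
  next
    assume "s \<in> \<int> \<and> t \<in> \<int>"
    then show "v \<in> Lam_dual f z" unfolding Lam_dual_def Lam_def by (auto simp: gr)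
  qed
  also have "\<dots> \<longleftrightarrow> om v \<in> lat z"
  proof
    assume "s \<in> \<int> \<and> t \<in> \<int>"
    then obtain i j where "s = of_int i" "t = of_int j" by (auto elim!: Ints_cases)
    then have "om v = of_int j + of_int i * z"
      unfolding v om_eq s_def[symmetric] t_def[symmetric] by simp
    then show "om v \<in> lat z" using lat_mem by metis
  next
    assume "om v \<in> lat z"
    then obtain m n where "om v = of_int m + of_int n * z" by (rule latE)
    then have "of_rat t + of_rat s * z = of_rat (of_int m) + of_rat (of_int n) * z"
      unfolding v om_eq s_def[symmetric] t_def[symmetric] by simp
    from of_rat_coords_eq[OF this] show "s \<in> \<int> \<and> t \<in> \<int>" by simp
  qed
  finally show ?thesis .
qed

lemma om_surj:
  assumes "\<nu> \<in> lat z"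
  obtains v where "v \<in> Lam_dual f z" "om v = \<nu>"
proof -
  obtain t s where nu: "\<nu> = of_int t + of_int s * z" using assms by (rule latE)
  define d :: rat where "d = of_int f * of_int D"
  have d: "d \<noteq> 0" unfolding d_def using f_pos D_neg by simp
  have D: "(of_int D :: rat) = of_int b * of_int b - 4 * of_int a * of_int c"
    unfolding disc[symmetric] by (simp add: power2_eq_square)
  \<comment> \<open>Cramer's rule for prescribed pairings t and s; one factor f of the Gram
    determinant cancels, which up to sign leaves d = f D.\<close>
  define x y where "x = (of_int b * of_int t - 2 * of_int c * of_int s) / d"
    and "y = (of_int b * of_int s - 2 * of_int a * of_int t) / d"
  have dx: "d * x = of_int b * of_int t - 2 * of_int c * of_int s"
    and dy: "d * y = of_int b * of_int s - 2 * of_int a * of_int t"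
    unfolding x_def y_def using d by auto
  have "d * (of_int f * (of_int b * x + 2 * of_int c * y))
      = of_int f * (of_int b * (d * x) + 2 * of_int c * (d * y))" by (simp add: algebra_simps)
  also have "\<dots> = d * of_int t" by (simp only: dx dy) (simp add: d_def D algebra_simps)
  finally have 1: "of_int f * (of_int b * x + 2 * of_int c * y) = of_int t" using d by simp
  have "d * (of_int f * (2 * of_int a * x + of_int b * y))
      = of_int f * (2 * of_int a * (d * x) + of_int b * (d * y))" by (simp add: algebra_simps)
  also have "\<dots> = d * of_int s" by (simp only: dx dy) (simp add: d_def D algebra_simps)
  finally have 2: "of_int f * (2 * of_int a * x + of_int b * y) = of_int s" using d by simp
  have "om (x, y) = \<nu>" unfolding om_eq 1 2 nu by simp
  then show ?thesis using that Lam_dual_iff assms by blast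
qed

lemma ok_lat: "ok_module D (lat z)"
  by (rule CM_ok_module[OF ring])

lemma cL_eq: "cL = (*) (of_int f * sqrtD D) ` lat z"
  unfolding cund_def by (rule setmul_pid[OF ok_lat])

text \<open>Together with \<open>Lam_dual_iff\<close> and \<open>om_surj\<close> this is the
  isomorphism of the discriminant group with \<bb> / c \<bb>.\<close>

lemma om_Lam: "om ` Lam = cL"
proof -
  have "om (of_int m, of_int n) = of_int f * sqrtD D * (of_int m + of_int (- n) * z)" for m n
    unfolding om_def by simp
  then have "om ` Lam = {of_int f * sqrtD D * (of_int m + of_int (- n) * z) | m n. True}"
    unfolding Lam_def by (auto simp: image_iff simp del: of_int_minus) metis
  also have "\<dots> = {of_int f * sqrtD D * (of_int m + of_int n * z) | m n. True}"
    by (metis (no_types, opaque_lifting) minus_minus)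
  also have "\<dots> = cL" unfolding cL_eq by (auto simp: lat_def)
  finally show ?thesis .
qed

lemma sqrtD_in_OK: "of_int f * sqrtD D \<in> OK D"
proof -
  have "sqrtD D = 2 * \<omega> - of_int D" unfolding omegaK_def by (simp add: field_simps)
  then have "sqrtD D \<in> OK D"
    using addsub_diff[OF addsub_OK addsub_of_int[OF addsub_OK omega_in_OK, of 2] of_int_in_OK[of D]]
    by simp
  then show ?thesis by (rule mult_in_OK[OF of_int_in_OK])
qed

lemma cL_subset: "cL \<subseteq> lat z"
  unfolding cL_eq using ok_lat sqrtD_in_OK unfolding ok_module_def by blast

lemma lcoset_iff_om:
  assumes "v \<in> Lam_dual f z"
  shows "u \<in> lcoset v \<longleftrightarrow> u \<in> Lam_dual f z \<and> om u - om v \<in> cL"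
proof
  assume "u \<in> lcoset v"
  then obtain w where w: "w \<in> Lam" "u = (fst v + fst w, snd v + snd w)" unfolding lcoset_def by blast
  then have e: "om u = om v + om w" by (simp add: om_add)
  have "om w \<in> cL" using w(1) om_Lam by blast
  moreover have "om v \<in> lat z" using assms Lam_dual_iff by blast
  ultimately show "u \<in> Lam_dual f z \<and> om u - om v \<in> cL"
    using addsub_add[OF addsub_lat] cL_subset unfolding Lam_dual_iff e by auto
next
  assume "u \<in> Lam_dual f z \<and> om u - om v \<in> cL"
  then obtain w where w: "w \<in> Lam" "om u - om v = om w" using om_Lam by blast
  then have "om u = om (fst v + fst w, snd v + snd w)" by (simp add: om_add algebra_simps)
  then have "u = (fst v + fst w, snd v + snd w)" using inj_om by (simp add: inj_eq)
  then show "u \<in> lcoset v" unfolding lcoset_def using w(1) by blast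
qed

lemma om_lcoset:
  assumes "v \<in> Lam_dual f z"
  shows "om ` lcoset v = {\<mu>. \<mu> - om v \<in> cL}"
proof (intro set_eqI iffI)
  fix \<mu> assume "\<mu> \<in> om ` lcoset v" then show "\<mu> \<in> {\<mu>. \<mu> - om v \<in> cL}"
    using lcoset_iff_om[OF assms] by auto
next
  fix \<mu> assume \<mu>: "\<mu> \<in> {\<mu>. \<mu> - om v \<in> cL}"
  then have "(\<mu> - om v) + om v \<in> lat z"
    using cL_subset assms by (intro addsub_add[OF addsub_lat]) (auto simp: Lam_dual_iff)
  then have "\<mu> \<in> lat z" by simp
  then obtain u where "u \<in> Lam_dual f z" "om u = \<mu>" by (rule om_surj)
  then show "\<mu> \<in> om ` lcoset v" using \<mu> lcoset_iff_om[OF assms] by blast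
qed

lemma lcoset_eq_iff:
  assumes "v \<in> Lam_dual f z" "w \<in> Lam_dual f z"
  shows "lcoset v = lcoset w \<longleftrightarrow> om v - om w \<in> cL"
proof
  assume "lcoset v = lcoset w"
  moreover have "v \<in> lcoset v"
    using lcoset_iff_om[OF assms(1)] assms(1) addsub_zero[OF addsub_setmul] by simp
  ultimately show "om v - om w \<in> cL" using lcoset_iff_om[OF assms(2)] by simp
next
  assume h: "om v - om w \<in> cL"
  have "om u - om v \<in> cL \<longleftrightarrow> om u - om w \<in> cL" for u
    using addsub_add[OF addsub_setmul _ h, of "om u - om v"]
      addsub_diff[OF addsub_setmul _ h, of "om u - om w"] by auto
  then show "lcoset v = lcoset w"
    using lcoset_iff_om[OF assms(1)] lcoset_iff_om[OF assms(2)] by auto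
qed

text \<open>The index is computed in Z x Z, where the image of the lattice is spanned by the rows of
  the Gram matrix, of determinant f^2 (4 a c - b^2).\<close>

lemma card_GLam: "card (GLam f z) = nat (f * f * - D)"
proof -
  \<comment> \<open>The coefficient of z is listed first, so that the spanning rows appear as the
    Gram matrix in its original order.\<close>
  define h :: "int \<times> int \<Rightarrow> complex" where "h = (\<lambda>(s, t). of_int t + of_int s * z)"
  define H where "H = {u. h u \<in> cL}"
  define cl where "cl = (\<lambda>(x, y). {(x', y'). (x - x', y - y') \<in> H})"
  have h_inj: "inj h"
    using inj_lat_coords[OF z] unfolding h_def inj_def by auto
  have h_range: "lat z = range h" unfolding h_def lat_def by auto
  have H: "(s, t) \<in> H \<longleftrightarrow> (\<exists>i j. s = i * (2 * a * f) + j * (b * f) \<and> t = i * (b * f) + j * (2 * c * f))"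
    for s t
  proof -
    have om_h: "om (of_int i, of_int j) = h (i * (2 * a * f) + j * (b * f), i * (b * f) + j * (2 * c * f))"
      for i j unfolding om_eq h_def by (simp add: of_rat_add of_rat_mult algebra_simps)
    have "(s, t) \<in> H \<longleftrightarrow> h (s, t) \<in> om ` Lam" unfolding H_def om_Lam by simp
    also have "\<dots> \<longleftrightarrow> (\<exists>i j. h (s, t) = om (of_int i, of_int j))" unfolding Lam_def by auto
    finally show ?thesis unfolding om_h inj_eq[OF h_inj] by simp
  qed
  have cl_h: "{\<mu>. \<mu> - h u \<in> cL} = h ` cl u" for u
  proof -
    obtain s t where u: "u = (s, t)" by fastforce
    have "\<mu> - h u \<in> cL \<longleftrightarrow> \<mu> \<in> h ` cl u" for \<mu>
    proof
      assume m: "\<mu> - h u \<in> cL"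
      then have "(\<mu> - h u) + h u \<in> lat z"
        using cL_subset h_range by (intro addsub_add[OF addsub_lat]) auto
      then obtain s' t' where \<mu>: "\<mu> = h (s', t')" unfolding h_range by auto
      have "h (s - s', t - t') = - (\<mu> - h u)" unfolding \<mu> u h_def by (simp add: algebra_simps)
      then have "h (s - s', t - t') \<in> cL" using addsub_minus[OF addsub_setmul m] by simp
      then show "\<mu> \<in> h ` cl u" unfolding \<mu> u cl_def H_def by blast
    next
      assume "\<mu> \<in> h ` cl u"
      then obtain s' t' where \<mu>: "\<mu> = h (s', t')" and c: "h (s - s', t - t') \<in> cL"
        unfolding u cl_def H_def by auto
      have "\<mu> - h u = - h (s - s', t - t')" unfolding \<mu> u h_def by (simp add: algebra_simps)
      then show "\<mu> - h u \<in> cL" using addsub_minus[OF addsub_setmul c] by simp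
    qed
    then show ?thesis by blast
  qed
  have "(`) om ` GLam f z = (\<lambda>v. om ` lcoset v) ` Lam_dual f z"
    unfolding GLam_def by auto
  also have "\<dots> = (\<lambda>v. {\<mu>. \<mu> - om v \<in> cL}) ` Lam_dual f z"
    by (rule image_cong) (auto simp: om_lcoset)
  also have "\<dots> = (\<lambda>\<nu>. {\<mu>. \<mu> - \<nu> \<in> cL}) ` om ` Lam_dual f z" by (simp only: image_image)
  also have "om ` Lam_dual f z = range h"
    unfolding h_range[symmetric]
  proof (intro set_eqI iffI)
    show "\<nu> \<in> lat z" if "\<nu> \<in> om ` Lam_dual f z" for \<nu> using that by (auto simp: Lam_dual_iff)
    show "\<nu> \<in> om ` Lam_dual f z" if "\<nu> \<in> lat z" for \<nu> using om_surj[OF that] by blast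
  qed
  also have "(\<lambda>\<nu>. {\<mu>. \<mu> - \<nu> \<in> cL}) ` range h = (`) h ` range cl" by (simp only: image_image cl_h)
  finally have "card ((`) om ` GLam f z) = card ((`) h ` range cl)" by simp
  moreover have "card ((`) om ` GLam f z) = card (GLam f z)"
    using inj_om by (intro card_image) (auto intro!: inj_onI simp: inj_image_eq_iff)
  moreover have "card ((`) h ` range cl) = card (range cl)"
    using h_inj by (intro card_image) (auto intro!: inj_onI simp: inj_image_eq_iff)
  moreover have "card (range cl) = nat \<bar>(2 * a * f) * (2 * c * f) - (b * f) * (b * f)\<bar>"
    unfolding cl_def
  proof (rule card_quotient_det[OF _ H])
    have "(2 * a * f) * (2 * c * f) - (b * f) * (b * f) = f * f * - D"
      unfolding disc[symmetric] by (simp add: power2_eq_square algebra_simps)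
    then show "(2 * a * f) * (2 * c * f) - (b * f) * (b * f) \<noteq> 0" using f_pos D_neg by simp
  qed
  moreover have "(2 * a * f) * (2 * c * f) - (b * f) * (b * f) = f * f * - D"
    unfolding disc[symmetric] by (simp add: power2_eq_square algebra_simps)
  moreover have "f * f * - D \<ge> 0" using D_neg by (simp add: mult_nonneg_nonpos)
  ultimately show ?thesis by simp
qed

lemma finite_GLam: "finite (GLam f z)"
proof (rule card_ge_0_finite)
  have "f * f * - D > 0" using f_pos D_neg by (simp add: mult_pos_neg)
  then show "card (GLam f z) > 0" unfolding card_GLam by simp
qed

lemma Omega_eq_om: "Omega f z v = om v"
proof -
  have "sqrt (real (card (GLam f z))) = of_int f * sqrt (- of_int D)"
  proof -
    have "real (card (GLam f z)) = (of_int f * of_int f) * (- of_int D)"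
      unfolding card_GLam using D_neg by (simp add: mult_nonneg_nonpos)
    then show ?thesis using f_pos by (simp only: real_sqrt_mult) simp
  qed
  moreover have "sqrt (2 * real_of_int a * real_of_int f) > 0" using a_pos f_pos by simp
  ultimately show ?thesis
    unfolding Omega_def Omega'_def om_def qc sqrtD_def using a_pos by simp
qed

definition kap :: complex where
  "kap = complex_of_real (sqrt (2 * of_int a * of_int f)) / (of_int f * sqrtD D)"

lemma kap_nonzero: "kap \<noteq> 0"
  unfolding kap_def using a_pos f_pos sqrtD_nonzero by simp

lemma Omega'_eq: "Omega' f z v = kap * om v"
  unfolding Omega'_def om_def kap_def qc using f_pos sqrtD_nonzero by simp

text \<open>For v = (x, y) both sides are multiples of a |x - y z|^2: the form contributes the
  factor 2 f, and |f sqrt D|^2 = f^2 |D| the rest. This accounts for the f |D| in the exponent of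
  \<open>fa\<close>.\<close>

lemma gram_eq: "of_int f * of_int \<bar>D\<bar> * of_rat (gram f z v v) = 2 * (of_int a * (om v * cnj (om v)))"
proof -
  obtain x y where v: "v = (x, y)" by fastforce
  have cr: "cnj (of_rat t) = of_rat t" for t
    unfolding of_rat_complex by simp
  have ss: "sqrtD D * cnj (sqrtD D) = - of_int D"
    unfolding cnj_sqrtD using sqrtD_sq by simp
  have "of_int a * ((of_rat x - of_rat y * z) * cnj (of_rat x - of_rat y * z))
      = of_int a * of_rat x * of_rat x - of_rat x * of_rat y * (of_int a * z + of_int a * cnj z)
        + of_rat y * of_rat y * (of_int a * (z * cnj z))"
    by (simp add: cr algebra_simps)
  also have "\<dots> = of_int a * of_rat x * of_rat x + of_int b * of_rat x * of_rat y
      + of_int c * of_rat y * of_rat y"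
    unfolding a_cnj_z a_z_cnj_z by (simp add: algebra_simps)
  finally have 1: "of_int a * ((of_rat x - of_rat y * z) * cnj (of_rat x - of_rat y * z)) = \<dots>" .
  have "om v * cnj (om v) = of_int f * of_int f * (sqrtD D * cnj (sqrtD D))
      * ((of_rat x - of_rat y * z) * cnj (of_rat x - of_rat y * z))"
    unfolding om_def v by (simp add: algebra_simps)
  then have "2 * (of_int a * (om v * cnj (om v))) = 2 * of_int f * of_int f * (- of_int D)
      * (of_int a * ((of_rat x - of_rat y * z) * cnj (of_rat x - of_rat y * z)))"
    unfolding ss by (simp only: mult_ac)
  also have "\<dots> = of_int f * of_int \<bar>D\<bar> * of_rat (gram f z v v)"
    unfolding 1 gram_def qc v using D_neg by (simp add: of_rat_add of_rat_mult algebra_simps)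
  finally show ?thesis by simp
qed

lemma fa_eq: "fa D f z \<tau> \<beta> = kap * infsum (gterm a \<tau>) (om ` \<beta>)"
proof -
  have "Omega' f z v * exp (pi * \<i> * of_int f * of_int \<bar>D\<bar> * \<tau> * of_rat (gram f z v v))
      = kap * (gterm a \<tau> \<circ> om) v" for v
  proof -
    have "pi * \<i> * of_int f * of_int \<bar>D\<bar> * \<tau> * of_rat (gram f z v v)
        = pi * \<i> * \<tau> * (of_int f * of_int \<bar>D\<bar> * of_rat (gram f z v v))" by simp
    also have "\<dots> = 2 * pi * \<i> * \<tau> * (of_int a * (om v * cnj (om v)))" unfolding gram_eq by simp
    finally have e: "pi * \<i> * of_int f * of_int \<bar>D\<bar> * \<tau> * of_rat (gram f z v v)
        = 2 * pi * \<i> * \<tau> * (of_int a * (om v * cnj (om v)))" .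
    show ?thesis unfolding Omega'_eq gterm_def e by simp
  qed
  then have "fa D f z \<tau> \<beta> = infsum (\<lambda>v. kap * (gterm a \<tau> \<circ> om) v) \<beta>" unfolding fa_def by simp
  also have "\<dots> = kap * infsum (gterm a \<tau> \<circ> om) \<beta>" by (rule infsum_cmult_right')
  also have "infsum (gterm a \<tau> \<circ> om) \<beta> = infsum (gterm a \<tau>) (om ` \<beta>)"
    by (rule infsum_reindex[symmetric]) (rule inj_on_subset[OF inj_om subset_UNIV])
  finally show ?thesis .
qed

end

section \<open>Averaging over the unit group\<close>

lemma (in imag_quad_field) finite_unit_classes:
  assumes m: "int_ideal D m"
  shows "finite (unit_classes D m)" and "unit_classes D m \<noteq> {}"
proof -
  have add: "addsub m" using m by (simp add: int_ideal_iff ok_module_def)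
  have "x - \<alpha> \<in> m \<longleftrightarrow> \<alpha> - x \<in> m" for x \<alpha>
    using addsub_minus[OF add, of "x - \<alpha>"] addsub_minus[OF add, of "\<alpha> - x"] by auto
  then have "unit_classes D m \<subseteq> {{y \<in> OK D. x - y \<in> m} | x. x \<in> OK D}"
    unfolding unit_classes_def rcls_def unit_mod_def by auto
  moreover have "finite {{y \<in> OK D. x - y \<in> m} | x. x \<in> OK D}"
    using int_ideal_mult_cnj(2)[OF m] unfolding ideal_norm_def by (rule card_ge_0_finite)
  ultimately show "finite (unit_classes D m)" by (rule finite_subset)
  have "unit_mod D m 1" using one_in_OK addsub_zero[OF add] unfolding unit_mod_def by force
  then show "unit_classes D m \<noteq> {}" unfolding unit_classes_def by blast
qed

text \<open>Being a unit depends only on the class, so the representative chosen in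
  \<open>Fgen\<close> is again a unit.\<close>

lemma (in imag_quad_field) unit_class_rep:
  assumes m: "int_ideal D m" and C: "C \<in> unit_classes D m"
  shows "unit_mod D m (SOME g. g \<in> C)"
proof -
  obtain \<alpha> where \<alpha>: "unit_mod D m \<alpha>" "C = rcls D m \<alpha>" using C unfolding unit_classes_def by blast
  have mm: "addsub m" "\<And>x y. x \<in> OK D \<Longrightarrow> y \<in> m \<Longrightarrow> x * y \<in> m"
    using m by (auto simp: int_ideal_iff ok_module_def)
  obtain \<beta> where \<beta>: "\<alpha> \<in> OK D" "\<beta> \<in> OK D" "\<alpha> * \<beta> - 1 \<in> m" using \<alpha>(1) unfolding unit_mod_def by blast
  have "\<alpha> \<in> C" unfolding \<alpha>(2) rcls_def using \<beta>(1) addsub_zero[OF mm(1)] by simp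
  then have "(SOME g. g \<in> C) \<in> C" by (rule someI)
  then have g: "(SOME g. g \<in> C) \<in> OK D" "(SOME g. g \<in> C) - \<alpha> \<in> m" unfolding \<alpha>(2) rcls_def by auto
  have "(SOME g. g \<in> C) * \<beta> - 1 = \<beta> * ((SOME g. g \<in> C) - \<alpha>) + (\<alpha> * \<beta> - 1)"
    by (simp add: algebra_simps)
  then have "(SOME g. g \<in> C) * \<beta> - 1 \<in> m"
    using addsub_add[OF mm(1) mm(2)[OF \<beta>(2) g(2)] \<beta>(3)] by metis
  then show ?thesis unfolding unit_mod_def using g(1) \<beta>(2) by blast
qed

lemma (in imag_quad_field) inv_mod_props:
  assumes "unit_mod D m g"
  shows "inv_mod D m g \<in> OK D" "g * inv_mod D m g - 1 \<in> m" "unit_mod D m (inv_mod D m g)"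
proof -
  have "\<exists>\<beta>. \<beta> \<in> OK D \<and> g * \<beta> - 1 \<in> m" using assms unfolding unit_mod_def by blast
  then have "inv_mod D m g \<in> OK D \<and> g * inv_mod D m g - 1 \<in> m"
    unfolding inv_mod_def by (rule someI_ex)
  then show "inv_mod D m g \<in> OK D" "g * inv_mod D m g - 1 \<in> m" "unit_mod D m (inv_mod D m g)"
    using assms unfolding unit_mod_def by (auto simp: mult.commute)
qed

context CM_lattice
begin

lemma cund_ideal: "int_ideal D (cund D f)"
proof -
  have "of_int f * sqrtD D \<in> cund D f"
    unfolding cund_def pid_def using one_in_OK by force
  moreover have "of_int f * sqrtD D \<noteq> 0" using f_pos sqrtD_nonzero by simp
  moreover have "cund D f \<subseteq> OK D"
    unfolding cund_def pid_def using mult_in_OK[OF sqrtD_in_OK] by auto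
  moreover have "ok_module D (cund D f)"
    unfolding cund_def pid_eq by (rule ok_module_scale[OF ok_module_OK])
  ultimately show ?thesis unfolding int_ideal_iff by blast
qed

lemma cund_mult_lat: "x \<in> cund D f \<Longrightarrow> \<nu> \<in> lat z \<Longrightarrow> x * \<nu> \<in> cL"
  by (rule setmul_mem)

lemma OK_mult_cL: "x \<in> OK D \<Longrightarrow> \<nu> \<in> cL \<Longrightarrow> x * \<nu> \<in> cL"
  using ok_module_setmul[of D "cund D f" "lat z"] cund_ideal
  unfolding int_ideal_iff ok_module_def by blast

lemma OK_mult_lat: "x \<in> OK D \<Longrightarrow> \<nu> \<in> lat z \<Longrightarrow> x * \<nu> \<in> lat z"
  using ok_lat unfolding ok_module_def by blast

lemma GLamE:
  assumes "\<beta> \<in> GLam f z"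
  obtains v where "v \<in> Lam_dual f z" "\<beta> = lcoset v"
  using assms unfolding GLam_def by blast

text \<open>\<open>cL\<close> is stable under O_K, so the class of g times a representative does not
  depend on the representative, and the existential in \<open>gact\<close> can be tested at
  v.\<close>

lemma gact_lcoset:
  assumes v: "v \<in> Lam_dual f z" and g: "g \<in> OK D" and w: "w \<in> Lam_dual f z" "om w = g * om v"
  shows "gact D f z g (lcoset v) = lcoset w"
proof -
  have "(\<exists>w\<in>lcoset v. om u - g * om w \<in> cL) \<longleftrightarrow> om u - g * om v \<in> cL" for u
  proof
    assume "\<exists>w\<in>lcoset v. om u - g * om w \<in> cL"
    then obtain x where x: "om x - om v \<in> cL" "om u - g * om x \<in> cL" using lcoset_iff_om[OF v] by blast
    have "om u - g * om v = (om u - g * om x) + g * (om x - om v)" by (simp add: algebra_simps)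
    then show "om u - g * om v \<in> cL"
      using addsub_add[OF addsub_setmul x(2) OK_mult_cL[OF g x(1)]] by metis
  next
    have "v \<in> lcoset v" using lcoset_iff_om[OF v] v addsub_zero[OF addsub_setmul] by simp
    then show "om u - g * om v \<in> cL \<Longrightarrow> \<exists>w\<in>lcoset v. om u - g * om w \<in> cL" by blast
  qed
  then show ?thesis
    unfolding gact_def Omega_eq_om using lcoset_iff_om[OF w(1)] w(2) by auto
qed

lemma gact_ex:
  assumes "v \<in> Lam_dual f z" "g \<in> OK D"
  obtains w where "w \<in> Lam_dual f z" "om w = g * om v" "gact D f z g (lcoset v) = lcoset w"
proof -
  have "g * om v \<in> lat z" using assms by (intro OK_mult_lat) (auto simp: Lam_dual_iff)
  then obtain w where "w \<in> Lam_dual f z" "om w = g * om v" by (rule om_surj)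
  then show ?thesis using that gact_lcoset[OF assms] by blast
qed

text \<open>Multiplying by an inverse h of g modulo c undoes the action up to (g h - 1) \<bb>, which
  lies in c \<bb>; this gives injectivity, and finiteness of the group gives the rest.\<close>

lemma gact_bij:
  assumes "unit_mod D (cund D f) g"
  shows "bij_betw (gact D f z g) (GLam f z) (GLam f z)"
proof -
  obtain h where g: "g \<in> OK D" and h: "h \<in> OK D" "g * h - 1 \<in> cund D f"
    using assms unfolding unit_mod_def by blast
  have into: "gact D f z g ` GLam f z \<subseteq> GLam f z"
  proof
    fix \<gamma> assume "\<gamma> \<in> gact D f z g ` GLam f z"
    then obtain v where "v \<in> Lam_dual f z" "\<gamma> = gact D f z g (lcoset v)" by (auto elim: GLamE)
    then show "\<gamma> \<in> GLam f z" using gact_ex[OF _ g] unfolding GLam_def by (metis (mono_tags, lifting) CollectI)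
  qed
  have "inj_on (gact D f z g) (GLam f z)"
  proof (rule inj_onI)
    fix \<beta> \<gamma> assume b: "\<beta> \<in> GLam f z" "\<gamma> \<in> GLam f z" and e: "gact D f z g \<beta> = gact D f z g \<gamma>"
    obtain v w where v: "v \<in> Lam_dual f z" "\<beta> = lcoset v" and w: "w \<in> Lam_dual f z" "\<gamma> = lcoset w"
      using b by (meson GLamE)
    obtain v' where v': "v' \<in> Lam_dual f z" "om v' = g * om v" "gact D f z g \<beta> = lcoset v'"
      using gact_ex[OF v(1) g] v(2) by metis
    obtain w' where w': "w' \<in> Lam_dual f z" "om w' = g * om w" "gact D f z g \<gamma> = lcoset w'"
      using gact_ex[OF w(1) g] w(2) by metis
    have "g * om v - g * om w \<in> cL"
      using e lcoset_eq_iff[OF v'(1) w'(1)] unfolding v'(2,3) w'(2,3) by simp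
    then have 1: "h * (g * om v - g * om w) \<in> cL" by (rule OK_mult_cL[OF h(1)])
    have "om v - om w \<in> lat z" using v w by (intro addsub_diff[OF addsub_lat]) (auto simp: Lam_dual_iff)
    then have 2: "(g * h - 1) * (om v - om w) \<in> cL" by (rule cund_mult_lat[OF h(2)])
    have "om v - om w = h * (g * om v - g * om w) - (g * h - 1) * (om v - om w)"
      by (simp add: algebra_simps)
    then have "om v - om w \<in> cL" using addsub_diff[OF addsub_setmul 1 2] by metis
    then show "\<beta> = \<gamma>" using lcoset_eq_iff[OF v(1) w(1)] v(2) w(2) by simp
  qed
  then show ?thesis
    unfolding bij_betw_def using endo_inj_surj[OF finite_GLam into] by simp
qed

section \<open>Periodic and equivariant weights on a lattice\<close>

definition periodic :: "(complex \<Rightarrow> complex) \<Rightarrow> bool" where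
  "periodic P \<longleftrightarrow> (\<forall>\<nu> \<mu>. \<nu> - \<mu> \<in> cL \<longrightarrow> P \<nu> = P \<mu>)"

definition equivariant :: "(complex \<Rightarrow> complex) \<Rightarrow> (complex \<Rightarrow> complex) \<Rightarrow> bool" where
  "equivariant chi P \<longleftrightarrow> (\<forall>g \<nu>. unit_mod D (cund D f) g \<longrightarrow> \<nu> \<in> lat z \<longrightarrow>
     P (g * \<nu>) = inverse (chi g) * P \<nu>)"

definition cval :: "(complex \<Rightarrow> complex) \<Rightarrow> (rat \<times> rat) set \<Rightarrow> complex" where
  "cval P \<beta> = P (om (SOME v. v \<in> \<beta>))"

lemma cval_lcoset:
  assumes inv: "periodic P" and v: "v \<in> Lam_dual f z"
  shows "cval P (lcoset v) = P (om v)"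
proof -
  have "v \<in> lcoset v" using lcoset_iff_om[OF v] v addsub_zero[OF addsub_setmul] by simp
  then have "(SOME u. u \<in> lcoset v) \<in> lcoset v" by (rule someI)
  then show ?thesis unfolding cval_def using lcoset_iff_om[OF v] inv unfolding periodic_def by blast
qed

text \<open>A periodic weight takes one value for each of finitely many classes, so the sum of their
  absolute values bounds it.\<close>

lemma summable_lattice_sum:
  assumes inv: "periodic P" and "Im \<tau> > 0"
  shows "(\<lambda>\<nu>. P \<nu> * gterm a \<tau> \<nu>) summable_on lat z"
proof (rule summable_gterm_lat[OF z a_pos assms(2)])
  fix \<nu> assume "\<nu> \<in> lat z"
  then obtain v where v: "v \<in> Lam_dual f z" "om v = \<nu>" by (rule om_surj)
  then have "P \<nu> = cval P (lcoset v)" using cval_lcoset[OF inv v(1)] by simp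
  moreover have "lcoset v \<in> GLam f z" unfolding GLam_def using v by blast
  ultimately show "cmod (P \<nu>) \<le> (\<Sum>\<beta>\<in>GLam f z. cmod (cval P \<beta>))"
    using member_le_sum[of "lcoset v" "GLam f z" "\<lambda>\<beta>. cmod (cval P \<beta>)"] finite_GLam by simp
qed

text \<open>Finitely many cosets of c \<bb> partition \<bb>, and P is constant on each. The factor
  \<open>kap\<close> is the ratio of \<open>Omega'\<close> to \<open>om\<close>.\<close>

lemma lattice_sum_eq:
  assumes inv: "periodic P" and "Im \<tau> > 0"
  shows "kap * infsum (\<lambda>\<nu>. P \<nu> * gterm a \<tau> \<nu>) (lat z) = (\<Sum>\<beta>\<in>GLam f z. cval P \<beta> * fa D f z \<tau> \<beta>)"
proof -
  note summ = summable_lattice_sum[OF inv assms(2)]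
  have Un: "(\<Union>\<beta>\<in>GLam f z. om ` \<beta>) = lat z"
  proof (intro set_eqI iffI)
    fix \<nu> assume "\<nu> \<in> (\<Union>\<beta>\<in>GLam f z. om ` \<beta>)"
    then obtain v u where "v \<in> Lam_dual f z" "u \<in> lcoset v" "\<nu> = om u" by (auto elim!: GLamE)
    then show "\<nu> \<in> lat z" using lcoset_iff_om Lam_dual_iff by blast
  next
    fix \<nu> assume "\<nu> \<in> lat z"
    then obtain v where v: "v \<in> Lam_dual f z" "om v = \<nu>" by (rule om_surj)
    then have "v \<in> lcoset v" using lcoset_iff_om[of v] addsub_zero[OF addsub_setmul] by simp
    then show "\<nu> \<in> (\<Union>\<beta>\<in>GLam f z. om ` \<beta>)" unfolding GLam_def using v by blast
  qed
  have disj: "om ` \<beta> \<inter> om ` \<gamma> = {}" if b: "\<beta> \<in> GLam f z" "\<gamma> \<in> GLam f z" "\<beta> \<noteq> \<gamma>" for \<beta> \<gamma>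
  proof -
    obtain v w where v: "v \<in> Lam_dual f z" "\<beta> = lcoset v" and w: "w \<in> Lam_dual f z" "\<gamma> = lcoset w"
      using b by (meson GLamE)
    have "om v - om w \<in> cL" if "u \<in> \<beta>" "u \<in> \<gamma>" for u
    proof -
      have "om u - om v \<in> cL" "om u - om w \<in> cL"
        using that lcoset_iff_om[OF v(1)] lcoset_iff_om[OF w(1)] v(2) w(2) by auto
      from addsub_diff[OF addsub_setmul this(2) this(1)] show ?thesis by simp
    qed
    then have "\<beta> \<inter> \<gamma> = {}" using lcoset_eq_iff[OF v(1) w(1)] v(2) w(2) b(3) by blast
    then show ?thesis using inj_om by (simp add: image_Int[symmetric])
  qed
  have fib: "infsum (\<lambda>\<nu>. P \<nu> * gterm a \<tau> \<nu>) (om ` \<beta>) = cval P \<beta> * infsum (gterm a \<tau>) (om ` \<beta>)"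
    if b: "\<beta> \<in> GLam f z" for \<beta>
  proof -
    obtain v where v: "v \<in> Lam_dual f z" "\<beta> = lcoset v" using b by (rule GLamE)
    have "P \<nu> = cval P \<beta>" if "\<nu> \<in> om ` \<beta>" for \<nu>
      using that om_lcoset[OF v(1)] inv cval_lcoset[OF inv v(1)] v(2) unfolding periodic_def by auto
    then have "infsum (\<lambda>\<nu>. P \<nu> * gterm a \<tau> \<nu>) (om ` \<beta>) = infsum (\<lambda>\<nu>. cval P \<beta> * gterm a \<tau> \<nu>) (om ` \<beta>)"
      by (intro infsum_cong) simp
    then show ?thesis by (simp add: infsum_cmult_right')
  qed
  have "infsum (\<lambda>\<nu>. P \<nu> * gterm a \<tau> \<nu>) (lat z)
      = (\<Sum>\<beta>\<in>GLam f z. infsum (\<lambda>\<nu>. P \<nu> * gterm a \<tau> \<nu>) (om ` \<beta>))"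
    unfolding Un[symmetric]
  proof (rule sum_infsum[symmetric, OF finite_GLam _ disj])
    fix \<beta> assume "\<beta> \<in> GLam f z"
    then have "om ` \<beta> \<subseteq> lat z" using Un by blast
    then show "(\<lambda>\<nu>. P \<nu> * gterm a \<tau> \<nu>) summable_on om ` \<beta>" by (rule summable_on_subset[OF summ])
  qed auto
  also have "\<dots> = (\<Sum>\<beta>\<in>GLam f z. cval P \<beta> * infsum (gterm a \<tau>) (om ` \<beta>))"
    by (rule sum.cong) (auto simp: fib)
  finally show ?thesis by (simp add: fa_eq sum_distrib_left mult.left_commute)
qed

text \<open>Expand \<open>Fgen\<close> and exchange the sums. For each unit g, equivariance moves
  the coefficient \<chi>(g) into the weight at the translated class, and the substitution of \<beta>
  by that class restores the original sum. Every unit class thus contributes equally.\<close>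

lemma sum_Fgen_eq:
  assumes inv: "periodic P"
    and chi: "char_mod D (cund D f) chi"
    and equiv: "equivariant chi P"
  shows "(\<Sum>\<beta>\<in>GLam f z. cval P \<beta> * Fgen D f chi z \<beta> \<tau>)
       = of_nat (card (unit_classes D (cund D f))) * (\<Sum>\<beta>\<in>GLam f z. cval P \<beta> * fa D f z \<tau> \<beta>)"
proof -
  let ?m = "cund D f"
  have one: "(\<Sum>\<beta>\<in>GLam f z. cval P \<beta> * (chi g * fa D f z \<tau> (gact D f z (inv_mod D ?m g) \<beta>)))
      = (\<Sum>\<beta>\<in>GLam f z. cval P \<beta> * fa D f z \<tau> \<beta>)" if g: "unit_mod D ?m g" for g
  proof -
    define h where "h = inv_mod D ?m g"
    have h: "h \<in> OK D" "g * h - 1 \<in> ?m" "unit_mod D ?m h"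
      unfolding h_def by (rule inv_mod_props[OF g])+
    have u1: "unit_mod D ?m 1"
      using one_in_OK cund_ideal unfolding unit_mod_def int_ideal_def by force
    have gh: "unit_mod D ?m (g * h)"
      using g h(1,2) one_in_OK mult_in_OK unfolding unit_mod_def by (metis mult.right_neutral)
    have "chi 1 * chi 1 = chi 1" "chi 1 \<noteq> 0" using chi u1 unfolding char_mod_def by (metis mult_1)+
    then have "chi 1 = 1" by simp
    moreover have "chi (g * h) = chi 1" using chi gh u1 h(2) unfolding char_mod_def by blast
    moreover have "chi (g * h) = chi g * chi h" using chi g h(3) unfolding char_mod_def by blast
    ultimately have "chi g * chi h = 1" by simp
    then have ch: "inverse (chi h) = chi g" by (metis inverse_unique mult.commute)
    \<comment> \<open>As h inverts g modulo c, the equivariance factor of h is \<chi>(g), the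
      coefficient attached to g in \<open>Fgen\<close>.\<close>
    have "cval P (gact D f z h \<beta>) = chi g * cval P \<beta>" if b: "\<beta> \<in> GLam f z" for \<beta>
    proof -
      obtain v where v: "v \<in> Lam_dual f z" "\<beta> = lcoset v" using b by (rule GLamE)
      obtain w where w: "w \<in> Lam_dual f z" "om w = h * om v" "gact D f z h (lcoset v) = lcoset w"
        using gact_ex[OF v(1) h(1)] by metis
      have "cval P (gact D f z h \<beta>) = P (h * om v)"
        using cval_lcoset[OF inv w(1)] unfolding v(2) w(3) w(2) .
      also have "\<dots> = chi g * P (om v)" using equiv h(3) v(1) ch unfolding equivariant_def by (simp add: Lam_dual_iff)
      also have "P (om v) = cval P \<beta>" unfolding v(2) using cval_lcoset[OF inv v(1)] by simp
      finally show ?thesis .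
    qed
    then have "(\<Sum>\<beta>\<in>GLam f z. cval P \<beta> * (chi g * fa D f z \<tau> (gact D f z h \<beta>)))
        = (\<Sum>\<beta>\<in>GLam f z. cval P (gact D f z h \<beta>) * fa D f z \<tau> (gact D f z h \<beta>))"
      by (intro sum.cong) auto
    also have "\<dots> = (\<Sum>\<beta>\<in>GLam f z. cval P \<beta> * fa D f z \<tau> \<beta>)"
      by (rule sum.reindex_bij_betw[OF gact_bij[OF h(3)]])
    finally show ?thesis unfolding h_def .
  qed
  have "(\<Sum>\<beta>\<in>GLam f z. cval P \<beta> * Fgen D f chi z \<beta> \<tau>)
      = (\<Sum>C\<in>unit_classes D ?m. \<Sum>\<beta>\<in>GLam f z. cval P \<beta> * (chi (SOME g. g \<in> C)
          * fa D f z \<tau> (gact D f z (inv_mod D ?m (SOME g. g \<in> C)) \<beta>)))"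
    unfolding Fgen_def sum_distrib_left by (rule sum.swap)
  also have "\<dots> = (\<Sum>C\<in>unit_classes D ?m. \<Sum>\<beta>\<in>GLam f z. cval P \<beta> * fa D f z \<tau> \<beta>)"
    by (rule sum.cong[OF refl]) (rule one[OF unit_class_rep[OF cund_ideal]])
  finally show ?thesis by simp
qed

text \<open>The coefficients are obtained before \<tau>, since membership in a span of functions
  needs them constant. The divisor n undoes the repetition over unit classes, and \<open>kap\<close>
  the rescaling of \<open>fa\<close>.\<close>

lemma lattice_sum_in_span:
  assumes inv: "periodic P"
    and chi: "char_mod D (cund D f) chi"
    and equiv: "equivariant chi P"
  obtains k where "\<And>\<tau>. Im \<tau> > 0 \<Longrightarrow> infsum (\<lambda>\<nu>. P \<nu> * gterm a \<tau> \<nu>) (lat z)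
      = (\<Sum>\<beta>\<in>GLam f z. k \<beta> * Fgen D f chi z \<beta> \<tau>)"
proof -
  define n :: complex where "n = of_nat (card (unit_classes D (cund D f)))"
  have n: "n \<noteq> 0" unfolding n_def using finite_unit_classes[OF cund_ideal] by simp
  show ?thesis
  proof (rule that[of "\<lambda>\<beta>. cval P \<beta> / (n * kap)"])
    fix \<tau> :: complex assume t: "Im \<tau> > 0"
    have "(\<Sum>\<beta>\<in>GLam f z. cval P \<beta> / (n * kap) * Fgen D f chi z \<beta> \<tau>)
        = (\<Sum>\<beta>\<in>GLam f z. cval P \<beta> * Fgen D f chi z \<beta> \<tau>) / (n * kap)"
      by (simp add: sum_divide_distrib)
    also have "\<dots> = n * (kap * infsum (\<lambda>\<nu>. P \<nu> * gterm a \<tau> \<nu>) (lat z)) / (n * kap)"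
      unfolding sum_Fgen_eq[OF inv chi equiv] lattice_sum_eq[OF inv t] n_def ..
    finally show "infsum (\<lambda>\<nu>. P \<nu> * gterm a \<tau> \<nu>) (lat z)
        = (\<Sum>\<beta>\<in>GLam f z. cval P \<beta> / (n * kap) * Fgen D f chi z \<beta> \<tau>)"
      using n kap_nonzero by simp
  qed
qed

end

text \<open>The span is formed over a set of functions, where distinct indices may name the same
  generator; the coefficients of coinciding generators are added up first.\<close>

lemma cspanH_indexed:
  assumes "finite X" "\<And>x. x \<in> X \<Longrightarrow> G x \<in> S"
    and "\<And>\<tau>. Im \<tau> > 0 \<Longrightarrow> h \<tau> = (\<Sum>x\<in>X. k x * G x \<tau>)"
  shows "h \<in> cspanH S"
proof -
  define c where "c = (\<lambda>g. \<Sum>x\<in>{x\<in>X. G x = g}. k x)"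
  have "h \<tau> = (\<Sum>g\<in>G ` X. c g * g \<tau>)" if "Im \<tau> > 0" for \<tau>
  proof -
    have "h \<tau> = (\<Sum>g\<in>G ` X. \<Sum>x\<in>{x\<in>X. G x = g}. k x * G x \<tau>)"
      using assms(3)[OF that] sum.image_gen[OF assms(1), of "\<lambda>x. k x * G x \<tau>" G] by simp
    also have "\<dots> = (\<Sum>g\<in>G ` X. c g * g \<tau>)"
      unfolding c_def sum_distrib_right by (intro sum.cong) auto
    finally show ?thesis .
  qed
  then show ?thesis unfolding cspanH_def using assms(1,2) by blast
qed

section \<open>The theta series as a sum over lattices\<close>

context imag_quad_field
begin

section \<open>Units, norms and the fibres over ideals\<close>

lemma scaled_OK_eq_iff:
  assumes "\<mu> \<noteq> 0"
  shows "(*) \<nu> ` OK D = (*) \<mu> ` OK D \<longleftrightarrow> (\<exists>u\<in>OK_units D. \<nu> = u * \<mu>)"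
proof
  assume e: "(*) \<nu> ` OK D = (*) \<mu> ` OK D"
  have "\<nu> * 1 \<in> (*) \<mu> ` OK D" "\<mu> * 1 \<in> (*) \<nu> ` OK D"
    using one_in_OK e by blast+
  then obtain u v where uv: "u \<in> OK D" "v \<in> OK D" "\<nu> = \<mu> * u" "\<mu> = \<nu> * v"
    unfolding mult_1_right image_iff by blast
  then have "\<mu> * (u * v) = \<mu> * 1" by (metis mult.assoc mult_1_right)
  then have "u * v = 1" using assms by (simp only: mult_cancel_left) simp
  then have "u \<noteq> 0" by auto
  moreover from this \<open>u * v = 1\<close> have "1 / u = v" by (simp add: divide_eq_eq mult.commute)
  ultimately have "u \<in> OK_units D" unfolding OK_units_def using uv by simp
  then show "\<exists>u\<in>OK_units D. \<nu> = u * \<mu>" using uv(3) by (auto simp: mult.commute)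
next
  assume "\<exists>u\<in>OK_units D. \<nu> = u * \<mu>"
  then obtain u where u: "u \<in> OK D" "u \<noteq> 0" "1 / u \<in> OK D" "\<nu> = u * \<mu>"
    unfolding OK_units_def by blast
  show "(*) \<nu> ` OK D = (*) \<mu> ` OK D"
  proof (intro subset_antisym image_subsetI)
    fix x assume "x \<in> OK D"
    then have "\<nu> * x = \<mu> * (u * x)" "u * x \<in> OK D" using u mult_in_OK by (auto simp: mult_ac)
    then show "\<nu> * x \<in> (*) \<mu> ` OK D" by blast
  next
    fix x assume "x \<in> OK D"
    then have "\<mu> * x = \<nu> * (1 / u * x)" "1 / u * x \<in> OK D" using u(2,4) mult_in_OK[OF u(3)] by auto
    then show "\<mu> * x \<in> (*) \<nu> ` OK D" by blast
  qed
qed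

text \<open>A nonzero element of O_K has a positive integer as norm, hence absolute value at least
  1; this applies to u and to 1 / u.\<close>

lemma norm_unit:
  assumes "u \<in> OK_units D" shows "cmod u = 1"
proof -
  have u: "u \<in> OK D" "u \<noteq> 0" "1 / u \<in> OK D" using assms unfolding OK_units_def by auto
  have ge: "cmod x \<ge> 1" if x: "x \<in> OK D" "x \<noteq> 0" for x
  proof -
    obtain n where n: "x * cnj x = of_int n" "n > 0" by (rule norm_int[OF x(1)]) (use x in auto)
    have "complex_of_real ((cmod x)\<^sup>2) = complex_of_real (of_int n)"
      using n(1) by (simp only: complex_norm_square of_real_of_int_eq)
    then have "(cmod x)\<^sup>2 \<ge> 1\<^sup>2" using n(2) by (simp only: of_real_eq_iff) simp
    then show ?thesis by (rule power2_le_imp_le) simp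
  qed
  have "cmod u \<ge> 1" "1 / cmod u \<ge> 1" using ge[OF u(1,2)] ge[OF u(3)] u(2) by (auto simp: norm_divide)
  then show ?thesis using u(2) by (simp add: le_divide_eq_1)
qed

lemma finite_OK_units: "finite (OK_units D)" "card (OK_units D) > 0"
proof -
  obtain d where d: "d > 0" "\<And>m n. d * (\<bar>of_int m\<bar> + \<bar>of_int n\<bar>) \<le> cmod (of_int m + of_int n * \<omega>)"
    using lattice_norm_bound[OF Im_omega_pos] by blast
  define K where "K = \<lceil>1 / d\<rceil>"
  have "OK_units D \<subseteq> (\<lambda>(m, n). of_int m + of_int n * \<omega>) ` ({-K..K} \<times> {-K..K})"
  proof
    fix u assume u: "u \<in> OK_units D"
    then have "u \<in> OK D" unfolding OK_units_def by blast
    then obtain m n where mn: "u = of_int m + of_int n * \<omega>" by (rule OKE)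
    have "d * (\<bar>of_int m\<bar> + \<bar>of_int n\<bar>) \<le> 1" using d(2)[of m n] norm_unit[OF u] mn by simp
    then have "\<bar>of_int m\<bar> + \<bar>of_int n\<bar> \<le> 1 / d" using d(1) by (simp add: field_simps)
    then have "real_of_int (\<bar>m\<bar> + \<bar>n\<bar>) \<le> of_int K" unfolding K_def
      using le_of_int_ceiling[of "1 / d"] by linarith
    then have "\<bar>m\<bar> + \<bar>n\<bar> \<le> K" by (simp only: of_int_le_iff)
    then have "(m, n) \<in> {-K..K} \<times> {-K..K}" by auto
    then show "u \<in> (\<lambda>(m, n). of_int m + of_int n * \<omega>) ` ({-K..K} \<times> {-K..K})" using mn by force
  qed
  then show fin: "finite (OK_units D)" by (rule finite_subset) simp
  have "1 \<in> OK_units D" unfolding OK_units_def using one_in_OK by simp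
  then show "card (OK_units D) > 0" using fin by (auto simp: card_gt_0_iff)
qed

text \<open>Multiplying the module equation q \<bb> J = (\<nu>) by its conjugate turns each factor
  into its norm, r, 1 / a and n. The resulting principal modules determine their generators up to a
  unit.\<close>

lemma norm_colon_ideal:
  assumes z: "Im z > 0" "mult_ring (lat z) = OK D" "qcoef z = (a, b, c)"
    and q: "int_ideal D q" and J: "int_ideal D J" and \<nu>: "\<nu> \<noteq> 0"
    and e: "setmul (setmul q (lat z)) J = (*) \<nu> ` OK D"
  shows "of_int a * (\<nu> * cnj \<nu>) = of_nat (ideal_norm D q) * of_nat (ideal_norm D J)"
proof -
  have a: "a > 0" using CM_coeffs[OF z(1,2)] z(3) by auto
  define r n where "r = ideal_norm D q" and "n = ideal_norm D J"
  have rn: "r > 0" "n > 0" unfolding r_def n_def using int_ideal_mult_cnj(2) q J by auto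
  have "setmul (setmul (setmul q (lat z)) J) (cnj ` setmul (setmul q (lat z)) J)
      = setmul (setmul q (cnj ` q)) (setmul (setmul (lat z) (cnj ` lat z)) (setmul J (cnj ` J)))"
    unfolding setmul_cnj by (simp only: setmul_assoc setmul_left_commute setmul_commute)
  also have "\<dots> = (*) (of_nat r) ` (*) (1 / of_int a) ` (*) (of_nat n) ` OK D"
    by (simp only: int_ideal_mult_cnj(1)[OF q] int_ideal_mult_cnj(1)[OF J] CM_mult_cnj[OF z]
      r_def[symmetric] n_def[symmetric] pid_eq setmul_scale
      setmul_OK[OF ok_module_scale[OF ok_module_scale[OF ok_module_OK]]]
      setmul_OK[OF ok_module_scale[OF ok_module_OK]])
  also have "\<dots> = (*) (of_nat r * of_nat n / of_int a) ` OK D"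
    by (simp add: image_image mult.assoc)
  finally have "setmul ((*) \<nu> ` OK D) (cnj ` (*) \<nu> ` OK D) = (*) (of_nat r * of_nat n / of_int a) ` OK D"
    unfolding e .
  moreover have "cnj ` (*) \<nu> ` OK D = (*) (cnj \<nu>) ` OK D"
  proof -
    have "cnj ` (*) \<nu> ` OK D = (*) (cnj \<nu>) ` cnj ` OK D" by (simp add: image_image)
    then show ?thesis unfolding cnj_OK .
  qed
  ultimately have "(*) (\<nu> * cnj \<nu>) ` OK D = (*) (of_nat r * of_nat n / of_int a) ` OK D"
    by (simp add: setmul_scale setmul_scale_right setmul_OK[OF ok_module_OK] image_image mult.assoc)
  \<comment> \<open>The unit has absolute value 1, and both generators are nonnegative reals, so
    they are equal.\<close>
  then obtain u where u: "u \<in> OK_units D" "\<nu> * cnj \<nu> = u * (of_nat r * of_nat n / of_int a)"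
    using scaled_OK_eq_iff[of "of_nat r * of_nat n / of_int a" "\<nu> * cnj \<nu>"] rn a by auto
  define x where "x = real r * real n / of_int a"
  have x: "x > 0" unfolding x_def using rn a by simp
  have "(cmod \<nu>)\<^sup>2 = cmod (\<nu> * cnj \<nu>)" by (simp add: norm_mult power2_eq_square)
  also have "\<dots> = cmod u * cmod (complex_of_real x)" unfolding u(2) x_def by (simp add: norm_mult norm_divide)
  also have "\<dots> = x" using norm_unit[OF u(1)] x by simp
  finally have "\<nu> * cnj \<nu> = complex_of_real x" by (metis complex_norm_square)
  then show ?thesis unfolding x_def r_def n_def using a by simp
qed

text \<open>The pair (i, \<nu>) yields J exactly when J q \<bb>_i = (\<nu>). The class of J q
  determines i, and \<nu> is then free up to units, so all fibres have the same size and the sum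
  over pairs is that multiple of the theta series.\<close>

lemma theta_eq_lattice_sums:
  assumes zs: "CM_reps D zs" and q: "int_ideal D q"
    and B: "\<And>i. B i = setmul q (lat (zs ! i))" and a: "\<And>i. a i = fst (qcoef (zs ! i))"
    and summ: "\<And>i. i < length zs \<Longrightarrow>
      (\<lambda>\<nu>. psi \<phi> (B i) \<nu> * gterm (a i) \<tau> \<nu>) summable_on lat (zs ! i)"
  shows "of_nat (card (OK_units D)) * theta D \<phi> (of_nat (ideal_norm D q) * \<tau>)
    = (\<Sum>i<length zs. infsum (\<lambda>\<nu>. psi \<phi> (B i) \<nu> * gterm (a i) \<tau> \<nu>) (lat (zs ! i)))"
proof -
  define r where "r = ideal_norm D q"
  have zi: "Im (zs ! i) > 0" "mult_ring (lat (zs ! i)) = OK D" if "i < length zs" for i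
    using zs that unfolding CM_reps_def by auto
  have Bi: "inv_module D (B i)" if "i < length zs" for i
    unfolding B by (intro inv_module_setmul int_ideal_inv_module[OF q] CM_inv_module zi that)
  have Bsub: "B i \<subseteq> lat (zs ! i)" if "i < length zs" for i
    unfolding B using q by (intro setmul_subset CM_ok_module zi that) (simp add: int_ideal_iff)
  define X where "X = Sigma {..<length zs} (\<lambda>i. B i - {0})"
  define Jm where "Jm = (\<lambda>(i, \<nu>). (*) \<nu> ` colon D (B i))"
  define T where "T = (\<lambda>(i, \<nu>). psi \<phi> (B i) \<nu> * gterm (a i) \<tau> \<nu>)"
  define t where "t = (\<lambda>J. \<phi> J * exp (2 * pi * \<i> * (of_nat r * \<tau>) * of_nat (ideal_norm D J)))"
  define Fib where "Fib = (\<lambda>J. {p \<in> X. Jm p = J})"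
  have JmX: "int_ideal D (Jm p)" if "p \<in> X" for p
    using that colon_ideal(1)[OF Bi] unfolding X_def Jm_def by auto
  have Tt: "T p = t (Jm p)" if p: "p \<in> X" for p
  proof -
    obtain i \<nu> where pi: "p = (i, \<nu>)" and i: "i < length zs" and \<nu>: "\<nu> \<in> B i" "\<nu> \<noteq> 0"
      using p unfolding X_def by auto
    obtain b c where qc: "qcoef (zs ! i) = (a i, b, c)" unfolding a by (metis prod.collapse)
    have "of_int (a i) * (\<nu> * cnj \<nu>) = of_nat r * of_nat (ideal_norm D (Jm p))"
      unfolding r_def
    proof (rule norm_colon_ideal[OF zi[OF i] qc q JmX[OF p] \<nu>(2)])
      show "setmul (setmul q (lat (zs ! i))) (Jm p) = (*) \<nu> ` OK D"
        using colon_ideal(2)[OF Bi[OF i] \<nu>] unfolding Jm_def pi B by simp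
    qed
    then have e: "2 * pi * \<i> * \<tau> * (of_int (a i) * (\<nu> * cnj \<nu>))
        = 2 * pi * \<i> * (of_nat r * \<tau>) * of_nat (ideal_norm D (Jm p))" by simp
    have "T p = \<phi> (Jm p) * exp (2 * pi * \<i> * \<tau> * (of_int (a i) * (\<nu> * cnj \<nu>)))"
      unfolding T_def pi gterm_def psi_def prod.case using \<nu> by (simp add: Jm_def)
    then show ?thesis unfolding t_def e .
  qed
  have Fib: "finite (Fib J) \<and> card (Fib J) = card (OK_units D)" if J: "int_ideal D J" for J
  proof -
    \<comment> \<open>The lattice belonging to J is selected by the class of J q, because B contains
      the extra factor q.\<close>
    have Jq: "int_ideal D (setmul J q)"
    proof -
      have okJ: "ok_module D J" "J \<subseteq> OK D" and okq: "ok_module D q" "q \<subseteq> OK D"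
        using J q by (auto simp: int_ideal_iff)
      have "setmul J q \<subseteq> q" by (rule setmul_subset[OF okq(1) okJ(2)])
      moreover obtain x y where xy: "x \<in> J" "x \<noteq> 0" "y \<in> q" "y \<noteq> 0"
        using J q unfolding int_ideal_def by blast
      moreover have "x * y \<in> setmul J q" using xy by (intro setmul_mem)
      ultimately show ?thesis
        unfolding int_ideal_iff using ok_module_setmul[OF okJ(1)] okq(2) by auto
    qed
    obtain i \<nu> where i: "i < length zs" and \<nu>: "\<nu> \<noteq> 0"
      and e: "setmul (setmul J q) (lat (zs ! i)) = (*) \<nu> ` OK D"
      by (rule CM_reps_cover[OF zs Jq])
    have okJ: "ok_module D J" "J \<subseteq> OK D" using J by (auto simp: int_ideal_iff)
    have BJ: "setmul (B j) J = setmul (setmul J q) (lat (zs ! j))" for j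
      unfolding B by (metis setmul_assoc setmul_commute)
    have Jeq: "Jm (j, \<mu>) = J \<longleftrightarrow> setmul (setmul J q) (lat (zs ! j)) = (*) \<mu> ` OK D"
      if "j < length zs" for j \<mu>
      using setmul_eq_scaled_OK[OF Bi[OF that] okJ(1), of \<mu>] unfolding BJ Jm_def by auto
    \<comment> \<open>Integrality of J gives B J inside B, and \<mu> lies in B J as its
      generator.\<close>
    have inB: "\<mu> \<in> B j" if j: "j < length zs" and m: "setmul (setmul J q) (lat (zs ! j)) = (*) \<mu> ` OK D" for j \<mu>
    proof -
      have "\<mu> * 1 \<in> setmul (B j) J" unfolding BJ m using one_in_OK by blast
      also have "\<dots> \<subseteq> B j"
        using setmul_subset[OF inv_module_ok[OF Bi[OF j]] okJ(2)] by (simp add: setmul_commute)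
      finally show ?thesis by simp
    qed
    have "Fib J = (\<lambda>u. (i, u * \<nu>)) ` OK_units D"
    proof (intro set_eqI iffI)
      fix p assume "p \<in> Fib J"
      then obtain j \<mu> where p: "p = (j, \<mu>)" and j: "j < length zs" and m: "\<mu> \<noteq> 0" "Jm (j, \<mu>) = J"
        unfolding Fib_def X_def by auto
      have em: "setmul (setmul J q) (lat (zs ! j)) = (*) \<mu> ` OK D" using Jeq[OF j] m(2) by simp
      have "j = i" by (rule CM_reps_unique[OF zs int_ideal_inv_module[OF Jq] j i m(1) em \<nu> e])
      then have "(*) \<mu> ` OK D = (*) \<nu> ` OK D" using em e by simp
      then show "p \<in> (\<lambda>u. (i, u * \<nu>)) ` OK_units D"
        using scaled_OK_eq_iff[OF \<nu>] p \<open>j = i\<close> by auto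
    next
      fix p assume "p \<in> (\<lambda>u. (i, u * \<nu>)) ` OK_units D"
      then obtain u where u: "u \<in> OK_units D" "p = (i, u * \<nu>)" by blast
      then have "(*) (u * \<nu>) ` OK D = (*) \<nu> ` OK D" using scaled_OK_eq_iff[OF \<nu>] by blast
      then have em: "setmul (setmul J q) (lat (zs ! i)) = (*) (u * \<nu>) ` OK D" using e by simp
      have "u * \<nu> \<noteq> 0" using u(1) \<nu> unfolding OK_units_def by simp
      then show "p \<in> Fib J"
        unfolding Fib_def X_def using i inB[OF i em] Jeq[OF i] em u(2) by auto
    qed
    moreover have "inj_on (\<lambda>u. (i, u * \<nu>)) (OK_units D)" using \<nu> by (auto intro!: inj_onI)
    ultimately show ?thesis using finite_OK_units(1) by (simp add: card_image)
  qed
  have summB: "(\<lambda>\<nu>. psi \<phi> (B i) \<nu> * gterm (a i) \<tau> \<nu>) summable_on (B i - {0})" if "i < length zs" for i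
    using Bsub[OF that] by (intro summable_on_subset[OF summ[OF that]]) auto
  have XU: "X = (\<Union>i\<in>{..<length zs}. Pair i ` (B i - {0}))" unfolding X_def by auto
  have summP: "T summable_on Pair i ` (B i - {0})" if "i < length zs" for i
    using summB[OF that] by (subst summable_on_reindex) (auto simp: inj_on_def o_def T_def)
  have summX: "T summable_on X"
    unfolding XU by (rule summable_on_finite_union_disjoint) (auto simp: summP)
  have "infsum T X = (\<Sum>i<length zs. infsum T (Pair i ` (B i - {0})))"
    unfolding XU by (rule sum_infsum[symmetric]) (auto simp: summP)
  also have "\<dots> = (\<Sum>i<length zs. infsum (\<lambda>\<nu>. psi \<phi> (B i) \<nu> * gterm (a i) \<tau> \<nu>) (lat (zs ! i)))"
  proof (rule sum.cong[OF refl])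
    fix i assume "i \<in> {..<length zs}"
    then have i: "i < length zs" by simp
    have "infsum T (Pair i ` (B i - {0}))
        = infsum (\<lambda>\<nu>. psi \<phi> (B i) \<nu> * gterm (a i) \<tau> \<nu>) (B i - {0})"
      by (subst infsum_reindex) (auto simp: inj_on_def o_def T_def)
    \<comment> \<open>Terms off B vanish with \<open>psi\<close>, and the term at 0 vanishes with
      \<open>gterm\<close>.\<close>
    also have "\<dots> = infsum (\<lambda>\<nu>. psi \<phi> (B i) \<nu> * gterm (a i) \<tau> \<nu>) (lat (zs ! i))"
      using Bsub[OF i] by (intro infsum_cong_neutral) (auto simp: psi_def gterm_def)
    finally show "infsum T (Pair i ` (B i - {0}))
        = infsum (\<lambda>\<nu>. psi \<phi> (B i) \<nu> * gterm (a i) \<tau> \<nu>) (lat (zs ! i))" .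
  qed
  finally have right: "infsum T X = \<dots>" .
  \<comment> \<open>The pairs are regrouped by the ideal they produce; summability over all pairs
    then permits summing over the finite fibres first.\<close>
  have bij: "bij_betw snd (Sigma {J. int_ideal D J} Fib) X"
    unfolding bij_betw_def
  proof
    show "inj_on snd (Sigma {J. int_ideal D J} Fib)" by (auto intro!: inj_onI simp: Fib_def)
    show "snd ` Sigma {J. int_ideal D J} Fib = X" using JmX by (force simp: Fib_def image_iff)
  qed
  have "infsum T X = infsum (\<lambda>p. T (snd p)) (Sigma {J. int_ideal D J} Fib)"
    by (rule infsum_reindex_bij_betw[OF bij, symmetric])
  also have "\<dots> = infsum (\<lambda>J. infsum (\<lambda>p. T (snd (J, p))) (Fib J)) {J. int_ideal D J}"
    using summX summable_on_reindex_bij_betw[OF bij, of T] by (intro infsum_Sigma_banach[symmetric]) simp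
  also have "\<dots> = infsum (\<lambda>J. of_nat (card (OK_units D)) * t J) {J. int_ideal D J}"
  proof (rule infsum_cong)
    fix J assume "J \<in> {J. int_ideal D J}"
    then have J: "finite (Fib J)" "card (Fib J) = card (OK_units D)" using Fib by auto
    have "infsum (\<lambda>p. T (snd (J, p))) (Fib J) = (\<Sum>p\<in>Fib J. T p)" using J(1) by simp
    also have "\<dots> = (\<Sum>p\<in>Fib J. t J)" by (rule sum.cong) (auto simp: Fib_def Tt)
    finally show "infsum (\<lambda>p. T (snd (J, p))) (Fib J) = of_nat (card (OK_units D)) * t J"
      using J(2) by simp
  qed
  also have "\<dots> = of_nat (card (OK_units D)) * theta D \<phi> (of_nat r * \<tau>)"
    unfolding theta_def t_def by (rule infsum_cmult_right')
  finally show ?thesis using right unfolding r_def by simp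
qed

end

section \<open>Membership of the oldform in the span\<close>

theorem theorem3p3p12:
  fixes D f :: int and r :: nat and chi chi' :: "complex \<Rightarrow> complex"
    and \<phi> :: "complex set \<Rightarrow> complex" and cf q :: "complex set" and zs :: "complex list"
  assumes "D < 0" and "fund_disc D"
    and "f > 0"
    and "char_mod D (cund D f) chi"
    and "\<forall>u\<in>OK_units D. chi u = u"
    and "int_ideal D cf" and "ideal_dvd D cf (cund D f)"
    and "hecke_char D cf \<phi> chi'"
    and "\<forall>\<alpha>. unit_mod D (cund D f) \<alpha> \<longrightarrow> chi' \<alpha> = inverse (chi \<alpha>)"
    and "CM_reps D zs"
    and "r > 0"
    and "int_ideal D q" and "ideal_norm D q = r"
    and "ideal_dvd D (setmul q cf) (cund D f)"
  shows "(\<lambda>\<tau>. of_nat r * theta D \<phi> (of_nat r * \<tau>)) \<in> Fspace D f chi zs"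
proof -
  interpret imag_quad_field D using assms(1,2) by unfold_locales
  have hecke: "hecke_mod D cf \<phi> chi'" using assms(8) unfolding hecke_char_def by blast
  have cf: "ok_module D cf" "cf \<subseteq> OK D" and okq: "ok_module D q" "q \<subseteq> OK D"
    using assms(6,12) by (auto simp: int_ideal_iff)
  \<comment> \<open>To divide is to contain; both divisibility hypotheses act through this
    inclusion.\<close>
  have dvd_sub: "J \<subseteq> I" if I: "ok_module D I" and d: "ideal_dvd D I J" for I J
  proof -
    obtain L where "int_ideal D L" "setmul I L = J" using d unfolding ideal_dvd_def by blast
    then show ?thesis using setmul_subset[OF I, of L] by (simp add: int_ideal_iff setmul_commute)
  qed
  have csub: "cund D f \<subseteq> cf" by (rule dvd_sub[OF cf(1) assms(7)])
  have csub2: "cund D f \<subseteq> setmul q cf" by (rule dvd_sub[OF ok_module_setmul[OF okq(1)] assms(14)])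
  define B where "B = (\<lambda>i. setmul q (lat (zs ! i)))"
  define a where "a = (\<lambda>i. fst (qcoef (zs ! i)))"
  define P where "P = (\<lambda>i. psi \<phi> (B i))"
  define h where "h = length zs"
  have key: "\<exists>k. \<forall>\<tau>. Im \<tau> > 0 \<longrightarrow> (\<lambda>\<nu>. P i \<nu> * gterm (a i) \<tau> \<nu>) summable_on lat (zs ! i) \<and>
      infsum (\<lambda>\<nu>. P i \<nu> * gterm (a i) \<tau> \<nu>) (lat (zs ! i))
        = (\<Sum>\<beta>\<in>GLam f (zs ! i). k \<beta> * Fgen D f chi (zs ! i) \<beta> \<tau>)"
    and fin: "finite (GLam f (zs ! i))" if i: "i < h" for i
  proof -
    have zi: "Im (zs ! i) > 0" "mult_ring (lat (zs ! i)) = OK D"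
      using assms(10) i unfolding CM_reps_def h_def by auto
    obtain b c where qc: "qcoef (zs ! i) = (a i, b, c)" unfolding a_def by (metis prod.collapse)
    interpret CM_lattice D f "zs ! i" "a i" b c
      using assms(3) zi qc by unfold_locales
    show "finite (GLam f (zs ! i))" by (rule finite_GLam)
    have Bi: "inv_module D (B i)"
      unfolding B_def by (intro inv_module_setmul int_ideal_inv_module[OF assms(12)] CM_inv_module zi)
    \<comment> \<open>The place where q c_f dividing c is used: periods of the discriminant group
      become periods of \<open>psi\<close>.\<close>
    have cLB: "setmul (cund D f) (lat (zs ! i)) \<subseteq> setmul cf (B i)"
    proof -
      have "setmul (cund D f) (lat (zs ! i)) \<subseteq> setmul (setmul q cf) (lat (zs ! i))"
        by (rule setmul_mono[OF csub2 subset_refl])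
      also have "\<dots> = setmul cf (B i)" unfolding B_def by (metis setmul_assoc setmul_commute)
      finally show ?thesis .
    qed
    have inv: "periodic (P i)"
      unfolding periodic_def P_def using psi_cong[OF hecke Bi] cLB by blast
    \<comment> \<open>On B this is \<open>psi_mult\<close>, as \<chi>' is the inverse of \<chi>. Off
      B both sides vanish: c \<bb> lies in B and g is invertible modulo c, so g \<nu> in B would put
      \<nu> in B.\<close>
    have "P i (g * \<nu>) = inverse (chi g) * P i \<nu>"
      if g: "unit_mod D (cund D f) g" and \<nu>: "\<nu> \<in> lat (zs ! i)" for g \<nu>
    proof (cases "\<nu> \<in> B i")
      case True
      have "unit_mod D cf g" using g csub unfolding unit_mod_def by blast
      then show ?thesis
        unfolding P_def using psi_mult[OF hecke Bi True] assms(9) g by simp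
    next
      case False
      obtain k where k: "k \<in> OK D" "g * k - 1 \<in> cund D f" using g unfolding unit_mod_def by blast
      have okB: "ok_module D (B i)" by (rule inv_module_ok[OF Bi])
      have "(g * k - 1) * \<nu> \<in> B i"
        using cund_mult_lat[OF k(2) \<nu>] cLB setmul_subset[OF okB cf(2)] by blast
      moreover have "\<nu> = k * (g * \<nu>) - (g * k - 1) * \<nu>" by (simp add: algebra_simps)
      ultimately have "g * \<nu> \<notin> B i"
        using False addsub_diff[of "B i" "k * (g * \<nu>)" "(g * k - 1) * \<nu>"] okB k(1)
        unfolding ok_module_def by metis
      then show ?thesis unfolding P_def psi_def using False by simp
    qed
    then have equiv: "equivariant chi (P i)" unfolding equivariant_def by blast
    obtain k where "\<And>\<tau>. Im \<tau> > 0 \<Longrightarrow> infsum (\<lambda>\<nu>. P i \<nu> * gterm (a i) \<tau> \<nu>) (lat (zs ! i))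
        = (\<Sum>\<beta>\<in>GLam f (zs ! i). k \<beta> * Fgen D f chi (zs ! i) \<beta> \<tau>)"
      using lattice_sum_in_span[OF inv assms(4) equiv] by blast
    then show "\<exists>k. \<forall>\<tau>. Im \<tau> > 0 \<longrightarrow> (\<lambda>\<nu>. P i \<nu> * gterm (a i) \<tau> \<nu>) summable_on lat (zs ! i) \<and>
      infsum (\<lambda>\<nu>. P i \<nu> * gterm (a i) \<tau> \<nu>) (lat (zs ! i))
        = (\<Sum>\<beta>\<in>GLam f (zs ! i). k \<beta> * Fgen D f chi (zs ! i) \<beta> \<tau>)"
      using summable_lattice_sum[OF inv] by blast
  qed
  \<comment> \<open>Choice over i alone, so the coefficients for all lattices are fixed at once and
    remain independent of \<tau>.\<close>
  have "\<exists>k. \<forall>i<h. \<forall>\<tau>. Im \<tau> > 0 \<longrightarrow>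
      (\<lambda>\<nu>. P i \<nu> * gterm (a i) \<tau> \<nu>) summable_on lat (zs ! i) \<and>
      infsum (\<lambda>\<nu>. P i \<nu> * gterm (a i) \<tau> \<nu>) (lat (zs ! i))
        = (\<Sum>\<beta>\<in>GLam f (zs ! i). k i \<beta> * Fgen D f chi (zs ! i) \<beta> \<tau>)"
    using key by (intro choice allI) blast
  then obtain k where k: "\<And>i \<tau>. i < h \<Longrightarrow> Im \<tau> > 0 \<Longrightarrow>
      (\<lambda>\<nu>. P i \<nu> * gterm (a i) \<tau> \<nu>) summable_on lat (zs ! i) \<and>
      infsum (\<lambda>\<nu>. P i \<nu> * gterm (a i) \<tau> \<nu>) (lat (zs ! i))
        = (\<Sum>\<beta>\<in>GLam f (zs ! i). k i \<beta> * Fgen D f chi (zs ! i) \<beta> \<tau>)"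
    by blast
  define w :: complex where "w = of_nat (card (OK_units D))"
  have w: "w \<noteq> 0" unfolding w_def using finite_OK_units(2) by simp
  show ?thesis unfolding Fspace_def
  \<comment> \<open>In the coefficients, r comes from the weight 2 slash operator and 1 / w from the
    number of pairs over each ideal.\<close>
  proof (rule cspanH_indexed[where X = "Sigma {..<h} (\<lambda>i. GLam f (zs ! i))"
        and G = "\<lambda>(i, \<beta>). Fgen D f chi (zs ! i) \<beta>"
        and k = "\<lambda>(i, \<beta>). of_nat r / w * k i \<beta>"])
    show "finite (Sigma {..<h} (\<lambda>i. GLam f (zs ! i)))" using fin by auto
    show "(case x of (i, \<beta>) \<Rightarrow> Fgen D f chi (zs ! i) \<beta>)
        \<in> {Fgen D f chi (zs ! a) \<beta>0 |a \<beta>0. a < length zs \<and> \<beta>0 \<in> GLam f (zs ! a)}"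
      if "x \<in> Sigma {..<h} (\<lambda>i. GLam f (zs ! i))" for x
      using that unfolding h_def by auto
    fix \<tau> :: complex assume t: "Im \<tau> > 0"
    have "w * theta D \<phi> (of_nat r * \<tau>) = (\<Sum>i<h. infsum (\<lambda>\<nu>. P i \<nu> * gterm (a i) \<tau> \<nu>) (lat (zs ! i)))"
      unfolding w_def h_def P_def assms(13)[symmetric]
      by (rule theta_eq_lattice_sums[OF assms(10,12)])
         (use k t in \<open>auto simp: B_def a_def P_def h_def\<close>)
    also have "\<dots> = (\<Sum>i<h. \<Sum>\<beta>\<in>GLam f (zs ! i). k i \<beta> * Fgen D f chi (zs ! i) \<beta> \<tau>)"
      using k t by (intro sum.cong) auto
    also have "\<dots> = (\<Sum>(i, \<beta>)\<in>Sigma {..<h} (\<lambda>i. GLam f (zs ! i)). k i \<beta> * Fgen D f chi (zs ! i) \<beta> \<tau>)"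
      using fin by (intro sum.Sigma) auto
    finally have "theta D \<phi> (of_nat r * \<tau>) =
      (\<Sum>(i, \<beta>)\<in>Sigma {..<h} (\<lambda>i. GLam f (zs ! i)). k i \<beta> * Fgen D f chi (zs ! i) \<beta> \<tau>) / w"
      using w by (simp add: field_simps)
    then show "of_nat r * theta D \<phi> (of_nat r * \<tau>) = (\<Sum>x\<in>Sigma {..<h} (\<lambda>i. GLam f (zs ! i)).
        (case x of (i, \<beta>) \<Rightarrow> of_nat r / w * k i \<beta>) * (case x of (i, \<beta>) \<Rightarrow> Fgen D f chi (zs ! i) \<beta>) \<tau>)"
      by (simp add: sum_divide_distrib sum_distrib_left split_def mult.assoc)
  qed
qed

end
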